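(* For every hyperbolic group $G$, the natural action of $G$ on its Gromov boundary $\partial G$ is rational.
   Context: A hyperbolic group is a finitely generated group whose Cayley graph is $\delta$-hyperbolic for some $\delta\ge0$; $\partial G$ denotes its Gromov boundary, a compact metrizable space on which $G$ acts by homeomorphisms. The rational group $\mathcal{R}_2$ is the group of all homeomorphisms of $\{0,1\}^\omega$ (product topology) that are computed by a nondegenerate asynchronous transducer. Such a transducer consists of finitely many states $Q$, an initial state $q_0$, a transition function $t\colon Q\times\{0,1\}\to Q$ and an output function $o\colon Q\times\{0,1\}\to\{0,1\}^*$ (finite, possibly empty, words). It maps $a_1a_2\cdots$ to $o(q_0,a_1)o(q_1,a_2)\cdots$, where $q_n=t(q_{n-1},a_n)$, and "nondegenerate" means this output is always infinite. An action of a group $G$ by homeomorphisms on a compact metrizable space $X$ is rational if there exist a quotient map (continuous surjection) $q\colon\{0,1\}^\omega\to X$ and a homomorphism $\varphi\colon G\to\mathcal{R}_2$ such that $q\circ\varphi(g)=g\circ q$ for all $g\in G$.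
   Formalization: The group G is assumed infinite: a finite group is hyperbolic with empty Gromov boundary, onto which the nonempty Cantor set has no map, so the claim fails for every finite group. *)

theory Defs
  imports "HOL-Analysis.Analysis" "HOL-Algebra.Generated_Groups"
begin

definition word_length :: "('a, 'b) monoid_scheme \<Rightarrow> 'a set \<Rightarrow> 'a \<Rightarrow> nat" where
  "word_length G S g =
     (LEAST n. \<exists>xs. length xs = n \<and> set xs \<subseteq> S \<union> m_inv G ` S \<and> foldr (mult G) xs (one G) = g)"

definition word_dist :: "('a, 'b) monoid_scheme \<Rightarrow> 'a set \<Rightarrow> 'a \<Rightarrow> 'a \<Rightarrow> real" where
  "word_dist G S g h = real (word_length G S (mult G (m_inv G g) h))"

definition gromov_prod :: "('a, 'b) monoid_scheme \<Rightarrow> 'a set \<Rightarrow> 'a \<Rightarrow> 'a \<Rightarrow> 'a \<Rightarrow> real" where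
  "gromov_prod G S w x y = (word_dist G S w x + word_dist G S w y - word_dist G S x y) / 2"

definition finite_generating_set :: "('a, 'b) monoid_scheme \<Rightarrow> 'a set \<Rightarrow> bool" where
  "finite_generating_set G S \<longleftrightarrow> finite S \<and> S \<subseteq> carrier G \<and> generate G S = carrier G"

text \<open>delta-hyperbolicity of the Cayley graph, via Gromov's four-point condition on its vertex set.\<close>
definition hyperbolic_wrt :: "('a, 'b) monoid_scheme \<Rightarrow> 'a set \<Rightarrow> bool" where
  "hyperbolic_wrt G S \<longleftrightarrow> (\<exists>\<delta>::real. \<delta> \<ge> 0 \<and>
     (\<forall>w\<in>carrier G. \<forall>x\<in>carrier G. \<forall>y\<in>carrier G. \<forall>z\<in>carrier G.
        gromov_prod G S w x y \<ge> min (gromov_prod G S w x z) (gromov_prod G S w y z) - \<delta>))"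

definition hyperbolic_group :: "('a, 'b) monoid_scheme \<Rightarrow> bool" where
  "hyperbolic_group G \<longleftrightarrow> group G \<and> (\<exists>S. finite_generating_set G S \<and> hyperbolic_wrt G S)"

definition converges_at_infinity :: "('a, 'b) monoid_scheme \<Rightarrow> 'a set \<Rightarrow> (nat \<Rightarrow> 'a) \<Rightarrow> bool" where
  "converges_at_infinity G S x \<longleftrightarrow> (\<forall>i. x i \<in> carrier G) \<and>
     (\<forall>M::real. \<exists>N. \<forall>i\<ge>N. \<forall>j\<ge>N. gromov_prod G S (one G) (x i) (x j) \<ge> M)"

definition seq_equiv :: "('a, 'b) monoid_scheme \<Rightarrow> 'a set \<Rightarrow> (nat \<Rightarrow> 'a) \<Rightarrow> (nat \<Rightarrow> 'a) \<Rightarrow> bool" where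
  "seq_equiv G S x y \<longleftrightarrow>
     (\<forall>M::real. \<exists>N. \<forall>i\<ge>N. \<forall>j\<ge>N. gromov_prod G S (one G) (x i) (y j) \<ge> M)"

definition gromov_boundary :: "('a, 'b) monoid_scheme \<Rightarrow> 'a set \<Rightarrow> (nat \<Rightarrow> 'a) set set" where
  "gromov_boundary G S =
     {{y. converges_at_infinity G S y \<and> seq_equiv G S x y} | x. converges_at_infinity G S x}"

definition boundary_prod :: "('a, 'b) monoid_scheme \<Rightarrow> 'a set \<Rightarrow> (nat \<Rightarrow> 'a) set \<Rightarrow> (nat \<Rightarrow> 'a) set \<Rightarrow> ereal" where
  "boundary_prod G S \<xi> \<eta> =
     (SUP x\<in>\<xi>. SUP y\<in>\<eta>. Liminf (sequentially \<times>\<^sub>F sequentially)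
        (\<lambda>(i, j). ereal (gromov_prod G S (one G) (x i) (y j))))"

definition boundary_topology :: "('a, 'b) monoid_scheme \<Rightarrow> 'a set \<Rightarrow> (nat \<Rightarrow> 'a) set topology" where
  "boundary_topology G S = topology (\<lambda>U. U \<subseteq> gromov_boundary G S \<and>
     (\<forall>\<xi>\<in>U. \<exists>r::real. {\<eta> \<in> gromov_boundary G S. ereal r < boundary_prod G S \<xi> \<eta>} \<subseteq> U))"

definition boundary_action :: "('a, 'b) monoid_scheme \<Rightarrow> 'a \<Rightarrow> (nat \<Rightarrow> 'a) set \<Rightarrow> (nat \<Rightarrow> 'a) set" where
  "boundary_action G g \<xi> = (\<lambda>x. \<lambda>i. mult G g (x i)) ` \<xi>"

definition cantor_top :: "(nat \<Rightarrow> bool) topology" where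
  "cantor_top = product_topology (\<lambda>_. discrete_topology (UNIV :: bool set)) UNIV"

fun tstate :: "nat \<Rightarrow> (nat \<Rightarrow> bool \<Rightarrow> nat) \<Rightarrow> (nat \<Rightarrow> bool) \<Rightarrow> nat \<Rightarrow> nat" where
  "tstate q0 t w 0 = q0"
| "tstate q0 t w (Suc n) = t (tstate q0 t w n) (w n)"

definition tout_prefix :: "nat \<Rightarrow> (nat \<Rightarrow> bool \<Rightarrow> nat) \<Rightarrow> (nat \<Rightarrow> bool \<Rightarrow> bool list) \<Rightarrow> (nat \<Rightarrow> bool) \<Rightarrow> nat \<Rightarrow> bool list" where
  "tout_prefix q0 t out w n = concat (map (\<lambda>i. out (tstate q0 t w i) (w i)) [0..<n])"

definition computed_by_transducer :: "((nat \<Rightarrow> bool) \<Rightarrow> (nat \<Rightarrow> bool)) \<Rightarrow> bool" where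
  "computed_by_transducer f \<longleftrightarrow>
     (\<exists>(Q::nat set) q0 t out. finite Q \<and> q0 \<in> Q \<and> (\<forall>q\<in>Q. \<forall>a. t q a \<in> Q) \<and>
        (\<forall>w m. \<exists>n. length (tout_prefix q0 t out w n) \<ge> m) \<and>
        (\<forall>w n k. k < length (tout_prefix q0 t out w n) \<longrightarrow> f w k = tout_prefix q0 t out w n ! k))"

definition rational_group :: "((nat \<Rightarrow> bool) \<Rightarrow> (nat \<Rightarrow> bool)) set" where
  "rational_group = {f. homeomorphic_map cantor_top cantor_top f \<and> computed_by_transducer f}"

definition rational_action :: "('a, 'b) monoid_scheme \<Rightarrow> ('a \<Rightarrow> 'x \<Rightarrow> 'x) \<Rightarrow> 'x topology \<Rightarrow> bool" where
  "rational_action G act X \<longleftrightarrow>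
     (\<exists>q \<phi>. continuous_map cantor_top X q \<and> q ` UNIV = topspace X \<and>
        (\<forall>g\<in>carrier G. \<phi> g \<in> rational_group) \<and>
        (\<forall>g\<in>carrier G. \<forall>h\<in>carrier G. \<phi> (mult G g h) = \<phi> g \<circ> \<phi> h) \<and>
        (\<forall>g\<in>carrier G. q \<circ> \<phi> g = act g \<circ> q))"

end

(*
  A horofunction of a hyperbolic group looks like the distance to a point at infinity; the
  horofunctions form a compact G-space H that maps onto the boundary. Choosing descending generators
  canonically gives a path 1 = p_0, p_1, ... for every horofunction phi, hence a self-map
  T phi = p_1^-1 phi of H. By hyperbolicity the restriction of phi to a ball around p_n determines phi
  behind p_n, so the pictures of the translates T^n phi on finitely many bounded balls code H as a
  one-sided Markov shift. The paths of phi and g phi stay close, so g rewrites the coding with finitely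
  many local rules. Multiplying H with the Cantor set, on which G acts trivially, removes isolated
  points, and a prefix code for the symbols turns the coding into {0,1}^omega and the action into one
  by transducers. Finally, geodesics for one word metric fellow-travel those for another, which makes
  the boundary independent of the generating set.
*)
theory Submission
  imports Defs
begin

section \<open>Words, infinite sequences and transducers\<close>

text \<open>The four-point condition survives moving one point to infinity, so horofunctions can be
  defined by clauses that each concern finitely many group elements; limits of normalised distance
  functions satisfy them by inspection. One picture would be too little for the Markov property:
  putting a step in front requires the values on a ball of radius \<open>R + 1\<close>, and these
  are fixed only after the path has run on for a while. Hence a symbol is a window of
  \<open>m + 1\<close> pictures. The local rules are finite in number because, after
  \<open>n\<close> steps, the tail of the image is the translate of a tail of \<phi> by a single
  group element whose length is bounded independently of \<open>n\<close> and \<phi>. Transducers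
  are not built by hand: it suffices that the restrictions of a map to cylinders are, up to a
  prefix, finitely many maps. Hyperbolicity is given for some generating set, the boundary is formed
  with an arbitrary one, so the two word metrics have to be compared. The group is infinite because
  a finite group has empty boundary, which is no image of the Cantor set.\<close>

definition prepend :: "bool list \<Rightarrow> (nat \<Rightarrow> bool) \<Rightarrow> nat \<Rightarrow> bool"  (infixr "\<frown>" 65) where
  "(u \<frown> w) n = (if n < length u then u ! n else w (n - length u))"

lemma prepend_Nil [simp]: "[] \<frown> w = w"
  by (simp add: fun_eq_iff prepend_def)

lemma prepend_append: "(u @ v) \<frown> w = u \<frown> v \<frown> w"
  by (auto simp: fun_eq_iff prepend_def nth_append)

lemma prepend_nth: "k < length u \<Longrightarrow> (u \<frown> w) k = u ! k"
  by (simp add: prepend_def)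

lemma prepend_shift: "(u \<frown> w) (k + length u) = w k"
  by (simp add: prepend_def)

lemma prepend_inject [simp]: "u \<frown> w = u \<frown> w' \<longleftrightarrow> w = w'"
proof
  assume *: "u \<frown> w = u \<frown> w'"
  have "w k = w' k" for k
    using fun_cong[OF *, of "k + length u"] by (simp add: prepend_shift)
  then show "w = w'" by blast
qed simp

lemma prepend_take: "map w [0..<n] \<frown> (\<lambda>k. w (k + n)) = w"
  by (auto simp: fun_eq_iff prepend_def)

lemma prepend_iff: "(\<exists>w'. w = u \<frown> w') \<longleftrightarrow> (\<forall>k<length u. w k = u ! k)"
proof
  assume *: "\<forall>k<length u. w k = u ! k"
  have "w = u \<frown> (\<lambda>k. w (k + length u))"
    using * by (auto simp: fun_eq_iff prepend_def)
  then show "\<exists>w'. w = u \<frown> w'" by (intro exI[of _ "\<lambda>k. w (k + length u)"])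
next
  assume "\<exists>w'. w = u \<frown> w'"
  then show "\<forall>k<length u. w k = u ! k"
    by (elim exE) (simp add: prepend_nth)
qed

lemma prepend_eq_prepend:
  assumes "u \<frown> w = v \<frown> w'" "length u \<le> length v"
  obtains z where "v = u @ z" "w = z \<frown> w'"
proof -
  have "take (length u) v = u"
  proof (intro nth_equalityI)
    fix i assume "i < length (take (length u) v)"
    then show "take (length u) v ! i = u ! i"
      using fun_cong[OF assms(1), of i] by (simp add: prepend_def split: if_splits)
  qed (use assms in simp)
  then have v: "v = u @ drop (length u) v"
    using append_take_drop_id[of "length u" v] by simp
  have "u \<frown> w = u \<frown> drop (length u) v \<frown> w'"
    using assms(1) by (subst prepend_append[symmetric]) (simp only: v[symmetric])
  then show ?thesis
    using v that by simp
qed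

section \<open>Continuity, common prefixes and residuals of maps on sequences\<close>

definition seq_cont :: "((nat \<Rightarrow> bool) \<Rightarrow> (nat \<Rightarrow> bool)) \<Rightarrow> bool" where
  "seq_cont f \<longleftrightarrow> (\<forall>w m. \<exists>n. \<forall>w'. (\<forall>i<n. w' i = w i) \<longrightarrow> (\<forall>i<m. f w' i = f w i))"

definition nonconst :: "((nat \<Rightarrow> bool) \<Rightarrow> (nat \<Rightarrow> bool)) \<Rightarrow> bool" where
  "nonconst F \<longleftrightarrow> (\<exists>w w'. F w \<noteq> F w')"

text \<open>For a constant \<open>F\<close> there is no position of disagreement and the
  \<open>LEAST\<close> is arbitrary, so \<open>lcp_len_differ\<close> and what rests on it ask for
  \<open>nonconst F\<close>.\<close>

definition lcp_len :: "((nat \<Rightarrow> bool) \<Rightarrow> (nat \<Rightarrow> bool)) \<Rightarrow> nat" where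
  "lcp_len F = (LEAST n. \<exists>w w'. F w n \<noteq> F w' n)"

definition lcp :: "((nat \<Rightarrow> bool) \<Rightarrow> (nat \<Rightarrow> bool)) \<Rightarrow> bool list" where
  "lcp F = map (F (\<lambda>_. False)) [0..<lcp_len F]"

definition residual :: "((nat \<Rightarrow> bool) \<Rightarrow> (nat \<Rightarrow> bool)) \<Rightarrow> (nat \<Rightarrow> bool) \<Rightarrow> (nat \<Rightarrow> bool)" where
  "residual F w = (\<lambda>k. F w (k + lcp_len F))"

lemma nonconst_ex: "nonconst F \<Longrightarrow> \<exists>n w w'. F w n \<noteq> F w' n"
  by (auto simp: nonconst_def fun_eq_iff)

lemma lcp_len_differ: "nonconst F \<Longrightarrow> \<exists>w w'. F w (lcp_len F) \<noteq> F w' (lcp_len F)"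
  unfolding lcp_len_def by (rule LeastI_ex) (rule nonconst_ex)

lemma lcp_len_agree: "k < lcp_len F \<Longrightarrow> F w k = F w' k"
  unfolding lcp_len_def using not_less_Least by blast

lemma lcp_residual: "F w = lcp F \<frown> residual F w"
proof
  fix k
  show "F w k = (lcp F \<frown> residual F w) k"
    using lcp_len_agree[of k F w "\<lambda>_. False"]
    by (auto simp: prepend_def lcp_def residual_def)
qed

lemma residual_differ0: "nonconst F \<Longrightarrow> \<exists>w w'. residual F w 0 \<noteq> residual F w' 0"
  using lcp_len_differ by (simp add: residual_def)

text \<open>A prefix common to all values delays the first disagreement by its length. Residuals
  thus forget what has already been printed, which is why finitely many of them can serve as
  states.\<close>

lemma residual_prepend:
  assumes "nonconst F"
  shows "residual (\<lambda>w. u \<frown> F w) = residual F"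
proof -
  have "lcp_len (\<lambda>w. u \<frown> F w) = length u + lcp_len F"
    unfolding lcp_len_def[of "\<lambda>w. u \<frown> F w"]
  proof (rule Least_equality)
    show "\<exists>w w'. (u \<frown> F w) (length u + lcp_len F) \<noteq> (u \<frown> F w') (length u + lcp_len F)"
      using lcp_len_differ[OF assms] by (simp add: prepend_def)
    fix n assume "\<exists>w w'. (u \<frown> F w) n \<noteq> (u \<frown> F w') n"
    then obtain w w' where *: "(u \<frown> F w) n \<noteq> (u \<frown> F w') n" by blast
    then have "n \<ge> length u" by (metis not_le prepend_nth)
    then have "F w (n - length u) \<noteq> F w' (n - length u)"
      using * by (simp add: prepend_def)
    then have "n - length u \<ge> lcp_len F"
      by (meson lcp_len_agree not_le)
    then show "length u + lcp_len F \<le> n"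
      using \<open>n \<ge> length u\<close> by linarith
  qed
  then show ?thesis
    by (auto simp: residual_def fun_eq_iff prepend_def)
qed

text \<open>The states of the transducer are the residuals of the restrictions of \<open>f\<close> to cylinders;
  each transition outputs the longest common prefix that has become known.\<close>

theorem computed_by_transducer_criterion:
  assumes cont: "seq_cont f" and inj: "inj f"
    and fin: "finite \<F>"
    and loc: "\<And>v. \<exists>u. \<exists>F\<in>\<F>. \<forall>w. f (v \<frown> w) = u \<frown> F w"
  shows "computed_by_transducer f"
proof -
  let ?r = "\<lambda>v. residual (\<lambda>w. f (v \<frown> w))"
  \<comment> \<open>The start state is \<open>f\<close> itself, from which no common prefix has been
    removed; every later state is a residual.\<close>
  define Z where "Z = insert f (range ?r)"
  have nc: "nonconst (\<lambda>w. f (v \<frown> w))" for v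
  proof -
    have "(v \<frown> (\<lambda>_. True)) \<noteq> (v \<frown> (\<lambda>_. False))"
      unfolding prepend_inject by metis
    then have "f (v \<frown> (\<lambda>_. True)) \<noteq> f (v \<frown> (\<lambda>_. False))"
      using inj_eq[OF inj] by blast
    then show ?thesis
      unfolding nonconst_def by (intro exI)
  qed
  have "?r v \<in> residual ` \<F>" for v
  proof -
    obtain u F where F: "F \<in> \<F>" "\<And>w. f (v \<frown> w) = u \<frown> F w" using loc by blast
    then have "nonconst F" using nc[of v] by (simp add: nonconst_def)
    then have "residual (\<lambda>w. u \<frown> F w) = residual F" by (rule residual_prepend)
    then show ?thesis using F by simp
  qed
  then have "finite (range ?r)"
    by (meson fin finite_imageI finite_subset image_subsetI)
  then have finZ: "finite Z" by (simp add: Z_def)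
  then obtain e :: "((nat \<Rightarrow> bool) \<Rightarrow> (nat \<Rightarrow> bool)) \<Rightarrow> nat" where e: "inj_on e Z"
    using finite_imp_inj_to_nat_seg by blast
  define dec where "dec = inv_into Z e"
  have dec: "dec (e s) = s" if "s \<in> Z" for s
    using e that by (simp add: dec_def)
  define t where "t q a = e (residual (\<lambda>w. dec q ([a] \<frown> w)))" for q a
  define out where "out q a = lcp (\<lambda>w. dec q ([a] \<frown> w))" for q a
  have step: "residual (\<lambda>w. s ([a] \<frown> w)) \<in> range ?r" if sZ: "s \<in> Z" for s a
  proof (cases "s = f")
    case True
    then show ?thesis by blast
  next
    case False
    then obtain v where v: "s = ?r v" using sZ by (auto simp: Z_def)
    have "f ((v @ [a]) \<frown> w) = lcp (\<lambda>w. f (v \<frown> w)) \<frown> ?r v ([a] \<frown> w)" for w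
      using lcp_residual[of "\<lambda>w. f (v \<frown> w)" "[a] \<frown> w"] by (simp add: prepend_append)
    moreover from this have "nonconst (\<lambda>w. ?r v ([a] \<frown> w))"
      using nc[of "v @ [a]"] by (simp add: nonconst_def)
    ultimately have "?r (v @ [a]) = residual (\<lambda>w. s ([a] \<frown> w))"
      using residual_prepend v by simp
    then show ?thesis by (metis rangeI)
  qed
  \<comment> \<open>The invariant: the output so far, followed by the value of the current state, is
    the restriction of \<open>f\<close> to the cylinder already read.\<close>
  have stZ: "\<exists>s\<in>Z. tstate (e f) t w n = e s \<and> (n > 0 \<longrightarrow> s \<in> range ?r) \<and>
     (\<forall>z. f (map w [0..<n] \<frown> z) = tout_prefix (e f) t out w n \<frown> s z)" for w n
  proof (induction n)
    case 0
    then show ?case by (simp add: Z_def tout_prefix_def)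
  next
    case (Suc n)
    then obtain s where s: "s \<in> Z" "tstate (e f) t w n = e s"
      "\<And>z. f (map w [0..<n] \<frown> z) = tout_prefix (e f) t out w n \<frown> s z" by blast
    let ?s = "residual (\<lambda>z. s ([w n] \<frown> z))"
    have "f (map w [0..<Suc n] \<frown> z) = tout_prefix (e f) t out w (Suc n) \<frown> ?s z" for z
    proof -
      have "f (map w [0..<Suc n] \<frown> z) = tout_prefix (e f) t out w n \<frown> s ([w n] \<frown> z)"
        using s(3)[of "[w n] \<frown> z"] by (simp add: prepend_append)
      also have "s ([w n] \<frown> z) = lcp (\<lambda>z. s ([w n] \<frown> z)) \<frown> ?s z"
        by (rule lcp_residual)
      also have "lcp (\<lambda>z. s ([w n] \<frown> z)) = out (tstate (e f) t w n) (w n)"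
        using s dec by (simp add: out_def)
      finally show ?thesis by (simp add: tout_prefix_def prepend_append)
    qed
    moreover have "tstate (e f) t w (Suc n) = e ?s"
      using s dec by (simp add: t_def)
    moreover have "?s \<in> range ?r" using step s(1) by blast
    ultimately show ?case unfolding Z_def by blast
  qed
  have "finite (e ` Z)" "e f \<in> e ` Z" using finZ by (auto simp: Z_def)
  moreover have "\<forall>q\<in>e ` Z. \<forall>a. t q a \<in> e ` Z"
    using step by (auto simp: t_def dec Z_def)
  moreover have "\<exists>n. length (tout_prefix (e f) t out w n) \<ge> m" for w m
  proof -
    obtain n where n: "\<forall>w'. (\<forall>i<n. w' i = w i) \<longrightarrow> (\<forall>i<m. f w' i = f w i)"
      using cont[unfolded seq_cont_def, THEN spec, THEN spec, of w m] by (rule exE)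
    \<comment> \<open>Reading \<open>Suc n\<close> letters ensures that the state is a residual even
      if \<open>n = 0\<close>. A residual has two values that differ at position 0, whereas
      continuity fixes the first \<open>m\<close> letters of the result; so these have been
      printed.\<close>
    obtain s where s: "s \<in> range ?r" and
      fs: "\<And>z. f (map w [0..<Suc n] \<frown> z) = tout_prefix (e f) t out w (Suc n) \<frown> s z"
      using stZ[of w "Suc n"] by auto
    obtain z z' where zz: "s z 0 \<noteq> s z' 0"
      using s residual_differ0 nc by blast
    let ?l = "length (tout_prefix (e f) t out w (Suc n))"
    have "f (map w [0..<Suc n] \<frown> z) ?l \<noteq> f (map w [0..<Suc n] \<frown> z') ?l"
      using zz unfolding fs by (simp add: prepend_def)
    moreover have "\<forall>i<m. f (map w [0..<Suc n] \<frown> z) i = f w i" for z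
      by (rule n[THEN spec, THEN mp]) (simp add: prepend_def nth_append del: upt_Suc)
    ultimately have "\<not> ?l < m" by blast
    then have "?l \<ge> m" by simp
    then show ?thesis by blast
  qed
  moreover have "f w k = tout_prefix (e f) t out w n ! k"
    if "k < length (tout_prefix (e f) t out w n)" for w n k
  proof -
    obtain s where "\<And>z. f (map w [0..<n] \<frown> z) = tout_prefix (e f) t out w n \<frown> s z"
      using stZ by blast
    from this[of "\<lambda>k. w (k + n)"] show ?thesis
      using that by (simp add: prepend_take prepend_nth)
  qed
  ultimately have "finite (e ` Z) \<and> e f \<in> e ` Z \<and> (\<forall>q\<in>e ` Z. \<forall>a. t q a \<in> e ` Z) \<and>
      (\<forall>w m. \<exists>n. length (tout_prefix (e f) t out w n) \<ge> m) \<and>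
      (\<forall>w n k. k < length (tout_prefix (e f) t out w n) \<longrightarrow> f w k = tout_prefix (e f) t out w n ! k)"
    by (intro conjI allI impI)
  then show ?thesis
    unfolding computed_by_transducer_def by (intro exI)
qed

section \<open>The topology of the Cantor space in terms of finite prefixes\<close>

lemma openin_cantor_top:
  "openin cantor_top A \<longleftrightarrow> (\<forall>w\<in>A. \<exists>n. \<forall>w'. (\<forall>i<n. w' i = w i) \<longrightarrow> w' \<in> A)"
proof
  assume A: "openin cantor_top A"
  show "\<forall>w\<in>A. \<exists>n. \<forall>w'. (\<forall>i<n. w' i = w i) \<longrightarrow> w' \<in> A"
  proof
    fix w assume "w \<in> A"
    then have "\<exists>U. finite {i \<in> UNIV. U i \<noteq> topspace (discrete_topology UNIV)} \<and>
       (\<forall>i\<in>UNIV. openin (discrete_topology UNIV) (U i)) \<and> w \<in> PiE UNIV U \<and> PiE UNIV U \<subseteq> A"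
      using A unfolding cantor_top_def openin_product_topology_alt by (rule bspec[rotated])
    then obtain U where "finite {i. U i \<noteq> UNIV} \<and> (\<forall>i. w i \<in> U i) \<and> PiE UNIV U \<subseteq> A"
      by (elim exE) (simp add: PiE_iff)
    then have U: "finite {i. U i \<noteq> UNIV}" "\<forall>i. w i \<in> U i" "PiE UNIV U \<subseteq> A"
      by simp_all
    obtain n where n: "\<forall>i\<in>{i. U i \<noteq> UNIV}. i < n"
      using U(1) finite_nat_set_iff_bounded by blast
    have "w' \<in> A" if "\<forall>i<n. w' i = w i" for w'
    proof -
      have "w' i \<in> U i" for i
      proof (cases "U i = UNIV")
        case False
        then have "i < n" using n by blast
        then have "w' i = w i" using that by blast
        then show ?thesis using U(2) by simp
      qed simp
      then have "w' \<in> PiE UNIV U" by (simp add: PiE_iff)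
      then show ?thesis using U(3) by blast
    qed
    then show "\<exists>n. \<forall>w'. (\<forall>i<n. w' i = w i) \<longrightarrow> w' \<in> A" by blast
  qed
next
  assume A: "\<forall>w\<in>A. \<exists>n. \<forall>w'. (\<forall>i<n. w' i = w i) \<longrightarrow> w' \<in> A"
  show "openin cantor_top A"
    unfolding cantor_top_def openin_product_topology_alt
  proof (intro ballI)
    fix w assume "w \<in> A"
    then obtain n where n: "\<And>w'. (\<forall>i<n. w' i = w i) \<Longrightarrow> w' \<in> A"
      using A[THEN bspec, of w] by blast
    define U where "U i = (if i < n then {w i} else UNIV)" for i :: nat
    have "finite {i \<in> UNIV. U i \<noteq> topspace (discrete_topology UNIV)}"
      by (rule finite_subset[of _ "{..<n}"]) (auto simp: U_def)
    moreover have "w \<in> PiE UNIV U" by (auto simp: U_def)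
    moreover have "PiE UNIV U \<subseteq> A"
    proof
      fix w' assume "w' \<in> PiE UNIV U"
      then have "w' i \<in> U i" for i by (simp add: PiE_iff)
      then have "w' i = w i" if "i < n" for i
        using that by (metis U_def singletonD)
      then have "\<forall>i<n. w' i = w i" by blast
      then show "w' \<in> A" by (rule n)
    qed
    ultimately show "\<exists>U. finite {i \<in> UNIV. U i \<noteq> topspace (discrete_topology UNIV)} \<and>
       (\<forall>i\<in>UNIV. openin (discrete_topology UNIV) (U i)) \<and> w \<in> PiE UNIV U \<and> PiE UNIV U \<subseteq> A"
      by (intro exI[of _ U]) simp
  qed
qed

lemma topspace_cantor_top [simp]: "topspace cantor_top = UNIV"
  by (simp add: cantor_top_def)

lemma seq_cont_continuous_map:
  assumes "seq_cont f"
  shows "continuous_map cantor_top cantor_top f"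
  unfolding continuous_map_def
proof (intro conjI allI impI)
  fix U assume U: "openin cantor_top U"
  show "openin cantor_top {w \<in> topspace cantor_top. f w \<in> U}"
    unfolding openin_cantor_top
  proof (intro ballI)
    fix w assume "w \<in> {w \<in> topspace cantor_top. f w \<in> U}"
    then have "f w \<in> U" by simp
    then have "\<exists>m. \<forall>z. (\<forall>i<m. z i = f w i) \<longrightarrow> z \<in> U"
      using U unfolding openin_cantor_top by (rule bspec[rotated])
    then obtain m where m: "\<forall>z. (\<forall>i<m. z i = f w i) \<longrightarrow> z \<in> U"
      by (rule exE)
    obtain n where n: "\<forall>w'. (\<forall>i<n. w' i = w i) \<longrightarrow> (\<forall>i<m. f w' i = f w i)"
      using assms[unfolded seq_cont_def, THEN spec, THEN spec, of w m] by (rule exE)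
    have "\<forall>w'. (\<forall>i<n. w' i = w i) \<longrightarrow> f w' \<in> U"
      using n[rule_format] m[rule_format] by blast
    then show "\<exists>n. \<forall>w'. (\<forall>i<n. w' i = w i) \<longrightarrow> w' \<in> {w \<in> topspace cantor_top. f w \<in> U}"
      by (intro exI[of _ n]) simp
  qed
qed auto

section \<open>Markov systems and their encoding in the Cantor set\<close>

definition is_prefix :: "bool list \<Rightarrow> (nat \<Rightarrow> bool) \<Rightarrow> bool" where
  "is_prefix u w \<longleftrightarrow> (\<forall>k<length u. w k = u ! k)"

lemma is_prefix_iff: "is_prefix u w \<longleftrightarrow> (\<exists>w'. w = u \<frown> w')"
  unfolding is_prefix_def by (rule prepend_iff[symmetric])

lemma is_prefix_prepend [simp]: "is_prefix u (u \<frown> w)"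
  by (simp add: is_prefix_def prepend_nth)

lemma is_prefix_Nil [simp]: "is_prefix [] w"
  by (simp add: is_prefix_def)

lemma is_prefix_Cons: "is_prefix (a # c) w \<longleftrightarrow> w 0 = a \<and> is_prefix c (\<lambda>k. w (Suc k))"
  by (simp add: is_prefix_def All_less_Suc2)

lemma is_prefix_append_prepend: "is_prefix (u @ v) (u \<frown> w) \<longleftrightarrow> is_prefix v w"
  by (simp add: is_prefix_iff prepend_append)

lemma is_prefix_appendD: "is_prefix (u @ v) w \<Longrightarrow> is_prefix u w"
  by (auto simp: is_prefix_iff prepend_append)

text \<open>Uniqueness says that the code is prefix-free, existence that every bit sequence can be
  parsed.\<close>

definition complete_code :: "'b set \<Rightarrow> ('b \<Rightarrow> bool list) \<Rightarrow> bool" where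
  "complete_code B c \<longleftrightarrow> (\<forall>w. \<exists>!b. b \<in> B \<and> is_prefix (c b) w)"

text \<open>A comb: a single symbol gets the empty word, and each further symbol gets
  \<open>[False]\<close> while the earlier codewords move behind a \<open>True\<close>.\<close>

lemma complete_code_exists:
  assumes "finite B" "B \<noteq> {}"
  shows "\<exists>c. complete_code B c"
  using assms
proof (induction B rule: finite_ne_induct)
  case (singleton x)
  have "complete_code {x} (\<lambda>_. [])"
    by (simp add: complete_code_def)
  then show ?case by blast
next
  case (insert x F)
  then obtain c where c: "complete_code F c" by blast
  define c' where "c' b = (if b = x then [False] else True # c b)" for b
  have "\<exists>!b. b \<in> insert x F \<and> is_prefix (c' b) w" for w
  proof (cases "w 0")
    case True
    then have "b \<in> insert x F \<and> is_prefix (c' b) w \<longleftrightarrow> b \<in> F \<and> is_prefix (c b) (\<lambda>k. w (Suc k))" for b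
      using insert(3) by (auto simp: c'_def is_prefix_Cons)
    then show ?thesis using c by (simp add: complete_code_def)
  next
    case False
    then have "b \<in> insert x F \<and> is_prefix (c' b) w \<longleftrightarrow> b = x" for b
      by (auto simp: c'_def is_prefix_Cons)
    then show ?thesis by simp
  qed
  then show ?case unfolding complete_code_def by blast
qed

text \<open>A one-sided Markov shift described without a topology on \<open>X\<close>: by
  \<open>markov\<close>, whether a symbol may be put in front of \<open>x\<close> depends on
  \<open>W x\<close> alone, while \<open>separated\<close> and \<open>complete\<close> say that the
  itinerary map is injective with closed image.\<close>

locale symbolic_system =
  fixes X :: "'x set" and T :: "'x \<Rightarrow> 'x" and W :: "'x \<Rightarrow> 'k"
  assumes T_in: "x \<in> X \<Longrightarrow> T x \<in> X"
    and finite_W: "finite (W ` X)"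
    and markov: "\<lbrakk>x \<in> X; y \<in> X; W x = W (T y)\<rbrakk> \<Longrightarrow> \<exists>z\<in>X. W z = W y \<and> T z = x"
    and separated: "\<lbrakk>x \<in> X; y \<in> X; \<And>n. W ((T ^^ n) x) = W ((T ^^ n) y)\<rbrakk> \<Longrightarrow> x = y"
    and complete: "\<lbrakk>\<And>n. \<xi> n \<in> X; \<And>n i. i \<le> n \<Longrightarrow> W ((T ^^ i) (\<xi> n)) = a i\<rbrakk>
                    \<Longrightarrow> \<exists>x\<in>X. \<forall>i. W ((T ^^ i) x) = a i"
begin

lemma Tn_in: "x \<in> X \<Longrightarrow> (T ^^ n) x \<in> X"
  by (induction n) (auto simp: T_in)

end

text \<open>Two possible symbols at the start and after each symbol force every codeword to be
  nonempty, so that long itineraries have long codes.\<close>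

locale branching_system = symbolic_system +
  assumes branch0: "\<exists>x\<in>X. \<exists>y\<in>X. W x \<noteq> W y"
    and branch: "x \<in> X \<Longrightarrow> \<exists>y\<in>X. W y = W x \<and> W (T y) \<noteq> W (T x)"
begin

text \<open>The state \<open>None\<close> is the start; \<open>Some a\<close> remembers the last symbol read.\<close>

definition succs :: "'b option \<Rightarrow> 'b set" where
  "succs v = (case v of None \<Rightarrow> W ` X | Some a \<Rightarrow> {W (T x) | x. x \<in> X \<and> W x = a})"

definition states :: "'b option set" where
  "states = insert None (Some ` W ` X)"

definition cyl :: "'b option \<Rightarrow> 'a set" where
  "cyl v = {x \<in> X. W x \<in> succs v}"

definition code :: "'b option \<Rightarrow> 'b \<Rightarrow> bool list" where
  "code v = (SOME c. complete_code (succs v) c)"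

lemma finite_states: "finite states"
  by (simp add: states_def finite_W)

lemma succs_subset: "succs v \<subseteq> W ` X"
  by (auto simp: succs_def T_in split: option.splits)

lemma finite_succs: "finite (succs v)"
  using succs_subset finite_W finite_subset by blast

lemma succs_two:
  assumes "v \<in> states"
  shows "\<exists>b\<in>succs v. \<exists>b'\<in>succs v. b \<noteq> b'"
proof (cases v)
  case None
  then show ?thesis using branch0 by (auto simp: succs_def)
next
  case (Some a)
  then obtain x where x: "x \<in> X" "W x = a" using assms by (auto simp: states_def)
  then obtain y where y: "y \<in> X" "W y = W x" "W (T y) \<noteq> W (T x)" using branch by blast
  then have "W (T x) \<in> succs v" "W (T y) \<in> succs v"
    using Some x by (auto simp: succs_def)
  then show ?thesis using y(3) by blast
qed

lemma code_complete: "v \<in> states \<Longrightarrow> complete_code (succs v) (code v)"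
  unfolding code_def using succs_two complete_code_exists[OF finite_succs] by (metis empty_iff someI_ex)

lemma code_unique:
  "\<lbrakk>v \<in> states; b \<in> succs v; b' \<in> succs v; is_prefix (code v b) w; is_prefix (code v b') w\<rbrakk> \<Longrightarrow> b = b'"
  using code_complete unfolding complete_code_def by blast

lemma code_ex: "v \<in> states \<Longrightarrow> \<exists>b\<in>succs v. is_prefix (code v b) w"
  using code_complete unfolding complete_code_def by blast

lemma code_nonempty:
  assumes "v \<in> states" "b \<in> succs v"
  shows "code v b \<noteq> []"
proof
  assume e: "code v b = []"
  obtain b' where b': "b' \<in> succs v" "b' \<noteq> b" using succs_two[OF assms(1)] by metis
  then show False
    using code_unique[OF assms b'(1), of "code v b' \<frown> undefined"] e by simp
qed

lemma W_in_states: "x \<in> X \<Longrightarrow> Some (W x) \<in> states"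
  by (auto simp: states_def)

lemma T_in_cyl: "x \<in> X \<Longrightarrow> T x \<in> cyl (Some (W x))"
  by (auto simp: cyl_def succs_def T_in)

lemma cyl_in: "x \<in> cyl v \<Longrightarrow> x \<in> X"
  by (simp add: cyl_def)

lemma cyl_None: "cyl None = X"
  by (auto simp: cyl_def succs_def)

section \<open>Coding the points of a branching system by bit sequences\<close>

primrec codeword :: "'b option \<Rightarrow> 'a \<Rightarrow> nat \<Rightarrow> bool list" where
  "codeword v x 0 = []"
| "codeword v x (Suc n) = codeword v x n @ code (case n of 0 \<Rightarrow> v | Suc k \<Rightarrow> Some (W ((T ^^ k) x))) (W ((T ^^ n) x))"

definition state_after :: "'b option \<Rightarrow> 'a \<Rightarrow> nat \<Rightarrow> 'b option" where
  "state_after v x n = (case n of 0 \<Rightarrow> v | Suc k \<Rightarrow> Some (W ((T ^^ k) x)))"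

lemma codeword_Suc: "codeword v x (Suc n) = codeword v x n @ code (state_after v x n) (W ((T ^^ n) x))"
  by (simp add: state_after_def)

declare codeword.simps(2) [simp del]

lemma state_after_0 [simp]: "state_after v x 0 = v" and state_after_Suc [simp]: "state_after v x (Suc n) = Some (W ((T ^^ n) x))"
  by (simp_all add: state_after_def)

lemma state_after_in: "\<lbrakk>v \<in> states; x \<in> X\<rbrakk> \<Longrightarrow> state_after v x n \<in> states"
  by (cases n) (auto simp: W_in_states Tn_in)

lemma Tn_cyl: "x \<in> cyl v \<Longrightarrow> (T ^^ n) x \<in> cyl (state_after v x n)"
  by (cases n) (auto simp: T_in_cyl Tn_in cyl_in)

lemma W_Tn_succs: "x \<in> cyl v \<Longrightarrow> W ((T ^^ n) x) \<in> succs (state_after v x n)"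
  using Tn_cyl[of x v n] by (simp add: cyl_def)

lemma state_after_add: "state_after (state_after v x n) ((T ^^ n) x) m = state_after v x (n + m)"
proof (cases m)
  case (Suc k)
  have "(T ^^ k) ((T ^^ n) x) = (T ^^ (n + k)) x"
    by (metis add.commute comp_apply funpow_add)
  then show ?thesis using Suc by simp
qed simp

lemma codeword_add: "codeword v x (n + m) = codeword v x n @ codeword (state_after v x n) ((T ^^ n) x) m"
proof (induction m)
  case (Suc m)
  have "(T ^^ m) ((T ^^ n) x) = (T ^^ (n + m)) x"
    by (metis add.commute comp_apply funpow_add)
  then show ?case using Suc by (simp add: codeword_Suc state_after_add)
qed simp

lemma codeword_length:
  assumes "v \<in> states" "x \<in> cyl v"
  shows "n \<le> length (codeword v x n)"
proof (induction n)
  case (Suc n)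
  have "code (state_after v x n) (W ((T ^^ n) x)) \<noteq> []"
    using assms by (intro code_nonempty state_after_in W_Tn_succs) (auto simp: cyl_in)
  then have "length (code (state_after v x n) (W ((T ^^ n) x))) > 0" by simp
  then show ?case using Suc by (simp add: codeword_Suc del: length_greater_0_conv)
qed simp

lemma codeword_cong:
  "(\<And>i. i < n \<Longrightarrow> W ((T ^^ i) x) = W ((T ^^ i) y)) \<Longrightarrow> codeword v x n = codeword v y n"
proof (induction n)
  case (Suc n)
  moreover have "state_after v x n = state_after v y n" using Suc(2) by (cases n) auto
  ultimately show ?case by (simp add: codeword_Suc)
qed simp

text \<open>For points of \<open>cyl v\<close> the codewords are nonempty, so \<open>Suc k\<close>
  of them together have a letter at position \<open>k\<close>.\<close>

definition encode :: "'b option \<Rightarrow> 'a \<Rightarrow> nat \<Rightarrow> bool" where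
  "encode v x k = codeword v x (Suc k) ! k"

lemma encode_nth:
  assumes "v \<in> states" "x \<in> cyl v" "k < length (codeword v x n)"
  shows "encode v x k = codeword v x n ! k"
proof -
  have "k < length (codeword v x (Suc k))" using codeword_length[OF assms(1,2), of "Suc k"] by simp
  moreover have "codeword v x (Suc k + n) ! k = codeword v x (Suc k) ! k" if "k < length (codeword v x (Suc k))"
    using that unfolding codeword_add[of v x "Suc k" n] by (simp add: nth_append)
  moreover have "codeword v x (n + Suc k) ! k = codeword v x n ! k"
    using assms(3) unfolding codeword_add[of v x n "Suc k"] by (simp add: nth_append)
  ultimately show ?thesis by (simp only: encode_def add.commute)
qed

lemma encode_unfold:
  assumes "v \<in> states" "x \<in> cyl v"
  shows "encode v x = codeword v x n \<frown> encode (state_after v x n) ((T ^^ n) x)"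
proof
  fix k
  let ?l = "length (codeword v x n)"
  show "encode v x k = (codeword v x n \<frown> encode (state_after v x n) ((T ^^ n) x)) k"
  proof (cases "k < ?l")
    case True
    then show ?thesis using encode_nth[OF assms] by (simp add: prepend_nth)
  next
    case False
    let ?m = "Suc (k - ?l)"
    have "?m \<le> length (codeword (state_after v x n) ((T ^^ n) x) ?m)"
      using assms by (intro codeword_length state_after_in Tn_cyl) (auto simp: cyl_in)
    then have "k < length (codeword v x (n + ?m))"
      using False unfolding codeword_add by simp
    then have "encode v x k = codeword v x (n + ?m) ! k" by (rule encode_nth[OF assms])
    also have "\<dots> = codeword (state_after v x n) ((T ^^ n) x) ?m ! (k - ?l)"
      using False unfolding codeword_add by (simp add: nth_append)
    finally show ?thesis using False by (simp add: prepend_def encode_def)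
  qed
qed

lemma prefix_encode: "\<lbrakk>v \<in> states; x \<in> cyl v\<rbrakk> \<Longrightarrow> is_prefix (codeword v x n) (encode v x)"
  by (metis encode_unfold is_prefix_prepend)

text \<open>Parsing is deterministic: equal symbols so far lead to the same state, and the code of
  that state is prefix-free.\<close>

lemma prefix_unique:
  assumes "v \<in> states" "x \<in> cyl v" "y \<in> cyl v" "is_prefix (codeword v x n) w" "is_prefix (codeword v y n) w"
  shows "\<forall>i<n. W ((T ^^ i) x) = W ((T ^^ i) y)"
  using assms(4,5)
proof (induction n)
  case (Suc n)
  have IH: "\<forall>i<n. W ((T ^^ i) x) = W ((T ^^ i) y)"
    using Suc is_prefix_appendD unfolding codeword_Suc by blast
  then have pxy: "codeword v x n = codeword v y n" "state_after v x n = state_after v y n"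
    by (auto intro!: codeword_cong) (cases n, auto)
  obtain w' where w': "w = codeword v x n \<frown> w'"
    using is_prefix_appendD[of "codeword v x n"] Suc(2) unfolding codeword_Suc is_prefix_iff by blast
  have "W ((T ^^ n) x) = W ((T ^^ n) y)"
  proof (rule code_unique)
    show "state_after v x n \<in> states" using assms by (intro state_after_in) (auto simp: cyl_in)
    show "W ((T ^^ n) x) \<in> succs (state_after v x n)" using assms by (intro W_Tn_succs)
    show "W ((T ^^ n) y) \<in> succs (state_after v x n)" unfolding pxy using assms by (intro W_Tn_succs)
    show "is_prefix (code (state_after v x n) (W ((T ^^ n) x))) w'"
      using Suc(2) unfolding codeword_Suc w' is_prefix_append_prepend .
    show "is_prefix (code (state_after v x n) (W ((T ^^ n) y))) w'"
      using Suc(3) unfolding codeword_Suc w' pxy is_prefix_append_prepend .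
  qed
  then show ?case using IH less_Suc_eq by auto
qed simp

lemma encode_inj: "v \<in> states \<Longrightarrow> inj_on (encode v) (cyl v)"
proof (rule inj_onI)
  fix x y assume v: "v \<in> states" and xy: "x \<in> cyl v" "y \<in> cyl v" "encode v x = encode v y"
  show "x = y"
  proof (rule separated)
    fix n
    have "\<forall>i<Suc n. W ((T ^^ i) x) = W ((T ^^ i) y)"
      using prefix_unique[OF v xy(1,2), of "Suc n" "encode v x"] prefix_encode[OF v xy(1)] prefix_encode[OF v xy(2)] xy(3)
      by simp
    then show "W ((T ^^ n) x) = W ((T ^^ n) y)" by simp
  qed (use xy cyl_in in auto)
qed

text \<open>Parse one codeword of \<open>w\<close>, take a point for the remaining sequence from the
  new state, and put the parsed symbol in front of it by \<open>markov\<close>.\<close>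

lemma prefix_exists:
  "v \<in> states \<Longrightarrow> \<exists>x\<in>cyl v. is_prefix (codeword v x n) w"
proof (induction n arbitrary: v w)
  case 0
  obtain b where "b \<in> succs v" using succs_two[OF 0] by blast
  then obtain x where "x \<in> X" "W x = b" using succs_subset by blast
  then show ?case using \<open>b \<in> succs v\<close> by (auto simp: cyl_def)
next
  case (Suc n)
  obtain b where b: "b \<in> succs v" "is_prefix (code v b) w" using code_ex[OF Suc(2)] by blast
  then obtain w' where w': "w = code v b \<frown> w'" by (auto simp: is_prefix_iff)
  obtain x0 where x0: "x0 \<in> X" "W x0 = b" using b(1) succs_subset by blast
  then obtain x where x: "x \<in> cyl (Some b)" "is_prefix (codeword (Some b) x n) w'"
    using Suc(1)[of "Some b"] W_in_states by blast
  then obtain y where y: "y \<in> X" "W y = b" "W x = W (T y)"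
    by (auto simp: cyl_def succs_def)
  obtain z where z: "z \<in> X" "W z = b" "T z = x"
    using markov[of x y] x y by (auto simp: cyl_def)
  have "codeword v z (Suc n) = code v b @ codeword (Some b) x n"
    using codeword_add[of v z 1 n] z by (simp add: codeword_Suc)
  then have "is_prefix (codeword v z (Suc n)) w"
    using x(2) by (simp add: w' is_prefix_append_prepend)
  moreover have "z \<in> cyl v" using z b by (simp add: cyl_def)
  ultimately show ?case by blast
qed

text \<open>Points that match longer and longer prefixes of \<open>w\<close> have compatible
  itineraries because parsing is unique; \<open>complete\<close> supplies a point with the common
  itinerary.\<close>

lemma encode_surj:
  assumes v: "v \<in> states"
  shows "encode v ` cyl v = UNIV"
proof -
  have "w \<in> encode v ` cyl v" for w
  proof -
    define \<xi> where "\<xi> n = (SOME x. x \<in> cyl v \<and> is_prefix (codeword v x (Suc n)) w)" for n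
    have \<xi>: "\<xi> n \<in> cyl v" "is_prefix (codeword v (\<xi> n) (Suc n)) w" for n
      using someI_ex[of "\<lambda>x. x \<in> cyl v \<and> is_prefix (codeword v x (Suc n)) w"]
        prefix_exists[OF v, of "Suc n" w] unfolding \<xi>_def by auto
    have pre: "is_prefix (codeword v (\<xi> n) (Suc i)) w" if "i \<le> n" for i n
    proof -
      have j: "Suc n = Suc i + (n - i)" using that by simp
      show ?thesis using \<xi>(2)[of n] by (subst (asm) j, subst (asm) codeword_add) (rule is_prefix_appendD)
    qed
    have "W ((T ^^ i) (\<xi> n)) = W ((T ^^ i) (\<xi> i))" if "i \<le> n" for i n
      using prefix_unique[OF v \<xi>(1) \<xi>(1), of n "Suc i" w i] pre[OF that] \<xi>(2)[of i] by simp
    then obtain x where x: "x \<in> X" "\<forall>i. W ((T ^^ i) x) = W ((T ^^ i) (\<xi> i))"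
      using complete[of \<xi> "\<lambda>i. W ((T ^^ i) (\<xi> i))"] \<xi>(1) cyl_in by blast
    have "W x = W (\<xi> 0)" using x(2)[rule_format, of 0] by simp
    then have xc: "x \<in> cyl v" using x(1) \<xi>(1)[of 0] by (simp add: cyl_def)
    have "encode v x k = w k" for k
    proof -
      have "W ((T ^^ i) x) = W ((T ^^ i) (\<xi> k))" if "i < Suc k" for i
        using x(2) \<open>\<And>n i. i \<le> n \<Longrightarrow> W ((T ^^ i) (\<xi> n)) = W ((T ^^ i) (\<xi> i))\<close>[of i k] that by simp
      then have "codeword v x (Suc k) = codeword v (\<xi> k) (Suc k)" by (rule codeword_cong)
      moreover have "k < length (codeword v (\<xi> k) (Suc k))"
        using codeword_length[OF v \<xi>(1), of "Suc k" k] by simp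
      ultimately show ?thesis using \<xi>(2)[of k] by (simp add: encode_def is_prefix_def)
    qed
    then have "w = encode v x" by (simp add: fun_eq_iff)
    then show ?thesis using xc by blast
  qed
  then show ?thesis by blast
qed

definition decode :: "'b option \<Rightarrow> (nat \<Rightarrow> bool) \<Rightarrow> 'a" where
  "decode v = inv_into (cyl v) (encode v)"

lemma decode_in: "v \<in> states \<Longrightarrow> decode v w \<in> cyl v"
  unfolding decode_def by (rule inv_into_into) (simp add: encode_surj)

lemma encode_decode: "v \<in> states \<Longrightarrow> encode v (decode v w) = w"
  unfolding decode_def by (rule f_inv_into_f) (simp add: encode_surj)

lemma decode_encode: "\<lbrakk>v \<in> states; x \<in> cyl v\<rbrakk> \<Longrightarrow> decode v (encode v x) = x"
  unfolding decode_def using encode_inj by (rule inv_into_f_f)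

lemma None_in_states [simp]: "None \<in> states"
  by (simp add: states_def)

lemma decode_None_in: "decode None w \<in> X"
  using decode_in[of None] by (simp add: cyl_None)

lemma decode_cont:
  "\<exists>m. \<forall>w'. (\<forall>i<m. w' i = w i) \<longrightarrow>
     (\<forall>i<n. W ((T ^^ i) (decode None w')) = W ((T ^^ i) (decode None w)))"
proof (intro exI allI impI)
  let ?x = "decode None w"
  fix w' i
  assume *: "\<forall>i<length (codeword None ?x n). w' i = w i" and "i < n"
  have x: "?x \<in> cyl None" by (simp add: decode_in)
  have "is_prefix (codeword None ?x n) w"
    using prefix_encode[OF None_in_states x] by (simp add: encode_decode)
  then have 1: "is_prefix (codeword None ?x n) w'" using * by (simp add: is_prefix_def)
  have 2: "is_prefix (codeword None (decode None w') n) w'"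
    using prefix_encode[OF None_in_states decode_in[OF None_in_states], of w' n] by (simp add: encode_decode)
  show "W ((T ^^ i) (decode None w')) = W ((T ^^ i) ?x)"
    using prefix_unique[OF None_in_states decode_in[OF None_in_states] x 2 1] \<open>i < n\<close> by simp
qed

section \<open>Self-maps with finitely many local rules become transducers\<close>

definition conj_map :: "('a \<Rightarrow> 'a) \<Rightarrow> (nat \<Rightarrow> bool) \<Rightarrow> (nat \<Rightarrow> bool)" where
  "conj_map h w = encode None (h (decode None w))"

lemma conj_map_comp:
  assumes "\<And>x. x \<in> X \<Longrightarrow> h x \<in> X"
  shows "conj_map g \<circ> conj_map h = conj_map (g \<circ> h)"
  by (auto simp: conj_map_def decode_encode cyl_None assms decode_None_in)

lemma conj_map_id: "(\<And>x. x \<in> X \<Longrightarrow> h x = x) \<Longrightarrow> conj_map h = id"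
  by (auto simp: conj_map_def encode_decode decode_None_in)

lemma code_bounded: "\<exists>L. \<forall>v\<in>states. \<forall>b\<in>succs v. length (code v b) \<le> L"
proof -
  have "finite (\<Union>v\<in>states. (\<lambda>b. length (code v b)) ` succs v)"
    using finite_states finite_succs by blast
  then obtain L where "\<forall>l\<in>(\<Union>v\<in>states. (\<lambda>b. length (code v b)) ` succs v). l \<le> L"
    using finite_nat_set_iff_bounded_le by blast
  then show ?thesis by blast
qed

text \<open>The map \<open>h\<close> has delay \<open>c\<close>: the first \<open>n + c\<close>
  symbols fix the first \<open>n\<close> symbols of the image. The rule \<beta> for the remainder
  may vary with \<open>n\<close> and with the symbols read, but it is the same for all points
  sharing these symbols.\<close>

context
  fixes h :: "'a \<Rightarrow> 'a" and c :: nat and \<Phi> :: "('a \<Rightarrow> 'a) set"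
  assumes h_in: "\<And>x. x \<in> X \<Longrightarrow> h x \<in> X"
    and fin: "finite \<Phi>"
    and loc: "\<And>x n. x \<in> X \<Longrightarrow> \<exists>\<beta>\<in>\<Phi>. \<forall>y\<in>X.
        (\<forall>i<n + c. W ((T ^^ i) y) = W ((T ^^ i) x)) \<longrightarrow>
        (\<forall>i<n. W ((T ^^ i) (h y)) = W ((T ^^ i) (h x))) \<and> (T ^^ n) (h y) = \<beta> ((T ^^ (n + c)) y)"
begin

lemma conj_map_cont: "seq_cont (conj_map h)"
  unfolding seq_cont_def
proof (intro allI)
  fix w m
  obtain n where n: "\<forall>w'. (\<forall>i<n. w' i = w i) \<longrightarrow>
     (\<forall>i<m + c. W ((T ^^ i) (decode None w')) = W ((T ^^ i) (decode None w)))"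
    using decode_cont[of w "m + c"] by (rule exE)
  have "conj_map h w' i = conj_map h w i" if w': "\<forall>i<n. w' i = w i" and i: "i < m" for w' i
  proof -
    have "\<forall>i<m + c. W ((T ^^ i) (decode None w')) = W ((T ^^ i) (decode None w))"
      using n w' by blast
    then have "\<forall>i<m. W ((T ^^ i) (h (decode None w'))) = W ((T ^^ i) (h (decode None w)))"
      using loc[of "decode None w" m] decode_None_in by blast
    then have "codeword None (h (decode None w')) (Suc i) = codeword None (h (decode None w)) (Suc i)"
      using i by (intro codeword_cong) simp
    then show ?thesis by (simp add: conj_map_def encode_def)
  qed
  then show "\<exists>n. \<forall>w'. (\<forall>i<n. w' i = w i) \<longrightarrow> (\<forall>i<m. conj_map h w' i = conj_map h w i)"
    by blast
qed

text \<open>A word splits into whole codewords and a remainder \<open>s\<close> of at most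
  \<open>L\<close> bits. What is still to be printed depends on two states, on \<beta> and on
  \<open>s\<close>, hence on finitely many data; the words too short to contain \<open>c\<close>
  codewords are added one by one.\<close>

lemma conj_map_computed:
  assumes inj: "inj (conj_map h)"
  shows "computed_by_transducer (conj_map h)"
proof -
  obtain L where L: "\<And>v b. \<lbrakk>v \<in> states; b \<in> succs v\<rbrakk> \<Longrightarrow> length (code v b) \<le> L"
    using code_bounded by blast
  define mk where "mk = (\<lambda>(v', v, \<beta>, s) w. encode v' (\<beta> (decode v (s \<frown> w))))"
  \<comment> \<open>A word longer than \<open>L * Suc c\<close> contains at least \<open>c\<close>
    whole codewords, which allows \<open>N = n + c\<close> below.\<close>
  define \<F> where "\<F> = mk ` (states \<times> states \<times> \<Phi> \<times> {s. set s \<subseteq> UNIV \<and> length s \<le> L}) \<union>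
    (\<lambda>v w. conj_map h (v \<frown> w)) ` {v. set v \<subseteq> UNIV \<and> length v \<le> L * Suc c}"
  have finF: "finite \<F>"
    unfolding \<F>_def by (intro finite_UnI finite_imageI finite_cartesian_product finite_states fin
      finite_lists_length_le finite)
  have "\<exists>u. \<exists>F\<in>\<F>. \<forall>w. conj_map h (v \<frown> w) = u \<frown> F w" for v
  proof (cases "length v \<le> L * Suc c")
    case True
    then have "(\<lambda>w. conj_map h (v \<frown> w)) \<in> \<F>" by (auto simp: \<F>_def)
    then show ?thesis by (intro exI[of _ "[]"] bexI) auto
  next
    case False
    define x where "x = decode None (v \<frown> undefined)"
    have x: "x \<in> cyl None" "x \<in> X" by (auto simp: x_def decode_in decode_None_in)
    have pSuc: "length (codeword None x (Suc n)) \<le> length (codeword None x n) + L" for n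
      using L[of "state_after None x n" "W ((T ^^ n) x)"] x by (auto simp: codeword_Suc state_after_in W_Tn_succs)
    have plen: "length (codeword None x n) \<le> L * n" for n
    proof (induction n)
      case (Suc n)
      then show ?case using pSuc[of n] by simp
    qed simp
    \<comment> \<open>The number of whole codewords of \<open>x\<close> that fit into
      \<open>v\<close>; the maximum exists since every codeword has a letter.\<close>
    define N where "N = (GREATEST n. length (codeword None x n) \<le> length v)"
    have bnd: "\<forall>n. length (codeword None x n) \<le> length v \<longrightarrow> n \<le> length v"
      using codeword_length[OF None_in_states x(1)] le_trans by blast
    have N: "length (codeword None x N) \<le> length v"
      unfolding N_def by (rule GreatestI_nat[of _ 0 "length v"]) (use bnd in auto)
    have Nmax: "n \<le> N" if "length (codeword None x n) \<le> length v" for n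
      unfolding N_def by (rule Greatest_le_nat[of _ _ "length v"]) (use bnd that in auto)
    have "length (codeword None x (Suc N)) > length v" using Nmax[of "Suc N"] by force
    then have short: "length v \<le> length (codeword None x N) + L" using pSuc[of N] by linarith
    have "c \<le> N"
    proof (rule ccontr)
      assume "\<not> c \<le> N"
      then have "L * Suc N \<le> L * Suc c" by (intro mult_le_mono2) simp
      moreover have "L * Suc N = L * N + L" by simp
      ultimately show False using short plen[of N] False by linarith
    qed
    then obtain n where n: "N = n + c" using le_Suc_ex by (metis add.commute)
    have Ex: "encode None x = v \<frown> undefined" by (simp add: x_def encode_decode)
    obtain s where s: "v = codeword None x N @ s"
      using encode_unfold[OF None_in_states x(1), of N] Ex N
      by (metis prepend_eq_prepend)
    obtain \<beta> where \<beta>: "\<beta> \<in> \<Phi>" and loc': "\<forall>y\<in>X. (\<forall>i<n + c. W ((T ^^ i) y) = W ((T ^^ i) x)) \<longrightarrow>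
        (\<forall>i<n. W ((T ^^ i) (h y)) = W ((T ^^ i) (h x))) \<and> (T ^^ n) (h y) = \<beta> ((T ^^ (n + c)) y)"
      using loc[OF x(2), of n] by (rule bexE)
    let ?F = "mk (state_after None (h x) n, state_after None x N, \<beta>, s)"
    have "?F \<in> \<F>"
      unfolding \<F>_def using short s \<beta> x h_in by (intro UnI1 imageI) (auto simp: state_after_in)
    moreover have "conj_map h (v \<frown> w) = codeword None (h x) n \<frown> ?F w" for w
    proof -
      define y where "y = decode None (v \<frown> w)"
      have y: "y \<in> cyl None" "y \<in> X" by (auto simp: y_def decode_in decode_None_in)
      have Ey: "encode None y = codeword None x N \<frown> s \<frown> w" by (simp add: y_def encode_decode s prepend_append)
      then have "is_prefix (codeword None x N) (encode None y)" by simp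
      then have sym: "\<forall>i<N. W ((T ^^ i) y) = W ((T ^^ i) x)"
        using prefix_unique[OF None_in_states y(1) x(1) prefix_encode[OF None_in_states y(1)]] by blast
      then have pyx: "codeword None y N = codeword None x N" and sty: "state_after None y N = state_after None x N"
        by (auto intro!: codeword_cong) (cases N, auto)
      have "encode (state_after None x N) ((T ^^ N) y) = s \<frown> w"
        using encode_unfold[OF None_in_states y(1), of N] Ey pyx sty by simp
      then have TN: "(T ^^ N) y = decode (state_after None x N) (s \<frown> w)"
        using decode_encode[of "state_after None x N" "(T ^^ N) y"] Tn_cyl[OF y(1), of N] sty state_after_in[OF None_in_states x(2)]
        by simp
      have hy: "\<forall>i<n. W ((T ^^ i) (h y)) = W ((T ^^ i) (h x))" "(T ^^ n) (h y) = \<beta> ((T ^^ N) y)"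
        using loc' y(2) sym n by blast+
      have state_after_h: "state_after None (h y) n = state_after None (h x) n" using hy(1) by (cases n) auto
      have "encode None (h y) = codeword None (h y) n \<frown> encode (state_after None (h y) n) ((T ^^ n) (h y))"
        using h_in[OF y(2)] by (intro encode_unfold) (auto simp: cyl_None)
      also have "codeword None (h y) n = codeword None (h x) n" using hy(1) by (intro codeword_cong) simp
      finally show ?thesis
        unfolding conj_map_def y_def[symmetric] by (simp add: mk_def hy(2) TN state_after_h)
    qed
    ultimately show ?thesis by blast
  qed
  then show ?thesis
    by (rule computed_by_transducer_criterion[OF conj_map_cont inj finF])
qed

end

end

text \<open>The space of a symbolic system may have isolated points. Multiplying it with the Cantor set
  removes them.\<close>

context symbolic_system
begin

definition T2 :: "'x \<times> (nat \<Rightarrow> bool) \<Rightarrow> 'x \<times> (nat \<Rightarrow> bool)" where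
  "T2 z = (T (fst z), \<lambda>k. snd z (Suc k))"

definition W2 :: "'x \<times> (nat \<Rightarrow> bool) \<Rightarrow> 'k \<times> bool" where
  "W2 z = (W (fst z), snd z 0)"

lemma T2_funpow: "(T2 ^^ n) z = ((T ^^ n) (fst z), \<lambda>k. snd z (k + n))"
  by (induction n arbitrary: z) (auto simp: T2_def)

lemma W2_T2: "W2 ((T2 ^^ n) z) = (W ((T ^^ n) (fst z)), snd z n)"
  by (simp add: W2_def T2_funpow)

lemma branching_product:
  assumes "X \<noteq> {}"
  shows "branching_system (X \<times> UNIV) T2 W2"
proof
  show "T2 x \<in> X \<times> UNIV" if "x \<in> X \<times> UNIV" for x
    using that by (auto simp: T2_def T_in)
  have "W2 ` (X \<times> UNIV) \<subseteq> W ` X \<times> UNIV" by (auto simp: W2_def)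
  then show "finite (W2 ` (X \<times> UNIV))"
    by (rule finite_subset) (simp add: finite_W)
  show "\<exists>z\<in>X \<times> UNIV. W2 z = W2 y \<and> T2 z = x"
    if xy: "x \<in> X \<times> UNIV" "y \<in> X \<times> UNIV" "W2 x = W2 (T2 y)" for x y
  proof -
    obtain z where z: "z \<in> X" "W z = W (fst y)" "T z = fst x"
      using markov[of "fst x" "fst y"] xy by (auto simp: W2_def T2_def)
    have "W2 (z, case_nat (snd y 0) (snd x)) = W2 y \<and> T2 (z, case_nat (snd y 0) (snd x)) = x"
      using z by (simp add: W2_def T2_def)
    then show ?thesis using z(1) by blast
  qed
  show "x = y" if xy: "x \<in> X \<times> UNIV" "y \<in> X \<times> UNIV" "\<And>n. W2 ((T2 ^^ n) x) = W2 ((T2 ^^ n) y)" for x y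
  proof (rule prod_eqI)
    show "fst x = fst y" using xy by (intro separated) (auto simp: W2_T2)
    show "snd x = snd y" using xy(3) by (auto simp: W2_T2 fun_eq_iff)
  qed
  show "\<exists>x\<in>X \<times> UNIV. \<forall>i. W2 ((T2 ^^ i) x) = a i"
    if \<xi>: "\<And>n. \<xi> n \<in> X \<times> UNIV" "\<And>n i. i \<le> n \<Longrightarrow> W2 ((T2 ^^ i) (\<xi> n)) = a i" for \<xi> a
  proof -
    have "fst (\<xi> n) \<in> X" for n using \<xi>(1)[of n] by auto
    moreover have "W ((T ^^ i) (fst (\<xi> n))) = fst (a i)" if "i \<le> n" for n i
      using arg_cong[OF \<xi>(2)[OF that], of fst] by (simp add: W2_T2)
    ultimately obtain x where x: "x \<in> X" "\<forall>i. W ((T ^^ i) x) = fst (a i)"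
      using complete[of "\<lambda>n. fst (\<xi> n)" "\<lambda>i. fst (a i)"] by blast
    have "W2 ((T2 ^^ i) (x, \<lambda>k. snd (a k))) = a i" for i
      using x(2) by (simp add: W2_T2)
    then show ?thesis using x(1) by blast
  qed
  obtain x0 where x0: "x0 \<in> X" using assms by blast
  have "W2 (x0, \<lambda>_. True) \<noteq> W2 (x0, \<lambda>_. False)" by (simp add: W2_def)
  then show "\<exists>x\<in>X \<times> UNIV. \<exists>y\<in>X \<times> UNIV. W2 x \<noteq> W2 y" using x0 by blast
  show "\<exists>y\<in>X \<times> UNIV. W2 y = W2 x \<and> W2 (T2 y) \<noteq> W2 (T2 x)" if "x \<in> X \<times> UNIV" for x
  proof -
    \<comment> \<open>Bit 1 belongs to the next symbol and leaves the current one unchanged.\<close>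
    have "W2 (fst x, (snd x)(1 := \<not> snd x 1)) = W2 x \<and> W2 (T2 (fst x, (snd x)(1 := \<not> snd x 1))) \<noteq> W2 (T2 x)"
      by (simp add: W2_def T2_def)
    moreover have "(fst x, (snd x)(1 := \<not> snd x 1)) \<in> X \<times> UNIV" using that by auto
    ultimately show ?thesis by blast
  qed
qed

end

section \<open>Word metrics\<close>

locale word_metric = group G for G (structure) +
  fixes S :: "'a set"
  assumes gen: "finite_generating_set G S"
begin

definition gens :: "'a set" where "gens = S \<union> m_inv G ` S"

abbreviation wprod :: "'a list \<Rightarrow> 'a" where "wprod xs \<equiv> foldr (mult G) xs \<one>"

abbreviation len :: "'a \<Rightarrow> nat" where "len \<equiv> word_length G S"

definition dd :: "'a \<Rightarrow> 'a \<Rightarrow> nat" where "dd x y = len (inv x \<otimes> y)"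

lemma gens_closed: "gens \<subseteq> carrier G"
  using gen by (auto simp: gens_def finite_generating_set_def)

lemma gens_in [simp]: "s \<in> gens \<Longrightarrow> s \<in> carrier G"
  using gens_closed by blast

lemma finite_gens: "finite gens"
  using gen by (auto simp: gens_def finite_generating_set_def)

lemma gens_inv: "s \<in> gens \<Longrightarrow> inv s \<in> gens"
  using gen by (auto simp: gens_def finite_generating_set_def subset_iff image_iff)

lemma wprod_closed [simp]: "set xs \<subseteq> gens \<Longrightarrow> wprod xs \<in> carrier G"
  by (induction xs) auto

lemma wprod_append:
  "\<lbrakk>set xs \<subseteq> gens; set ys \<subseteq> gens\<rbrakk> \<Longrightarrow> wprod (xs @ ys) = wprod xs \<otimes> wprod ys"
  by (induction xs) (auto simp: m_assoc)

lemma wprod_inv: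
  "set xs \<subseteq> gens \<Longrightarrow> wprod (map (m_inv G) (rev xs)) = inv (wprod xs)"
proof (induction xs)
  case (Cons x xs)
  have "set (map (m_inv G) (rev xs)) \<subseteq> gens" "set [inv x] \<subseteq> gens"
    using Cons gens_inv by auto
  then show ?case
    using Cons by (simp add: wprod_append inv_mult_group del: foldr_append)
qed simp

lemma wprod_ex:
  assumes "g \<in> carrier G"
  shows "\<exists>xs. set xs \<subseteq> gens \<and> wprod xs = g"
proof -
  have "g \<in> generate G S" using gen assms by (simp add: finite_generating_set_def)
  then show ?thesis
  proof induction
    case one
    show ?case by (intro exI[of _ "[]"]) simp
  next
    case (incl h)
    then have "h \<in> gens" by (simp add: gens_def)
    then show ?case by (intro exI[of _ "[h]"]) simp
  next
    case (inv h)
    then have "inv h \<in> gens" by (simp add: gens_def)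
    then show ?case by (intro exI[of _ "[inv h]"]) simp
  next
    case (eng h1 h2)
    then obtain xs ys where "set xs \<subseteq> gens" "wprod xs = h1" "set ys \<subseteq> gens" "wprod ys = h2"
      by blast
    then show ?case by (intro exI[of _ "xs @ ys"]) (auto simp: wprod_append simp del: foldr_append)
  qed
qed

lemma len_ex:
  assumes "g \<in> carrier G"
  obtains xs where "length xs = len g" "set xs \<subseteq> gens" "wprod xs = g"
proof -
  have "\<exists>xs. length xs = len g \<and> set xs \<subseteq> S \<union> m_inv G ` S \<and> foldr (mult G) xs (one G) = g"
    unfolding word_length_def
    by (rule LeastI_ex) (use wprod_ex[OF assms] in \<open>auto simp: gens_def\<close>)
  then show ?thesis using that by (auto simp: gens_def)
qed

lemma len_le: "set xs \<subseteq> gens \<Longrightarrow> len (wprod xs) \<le> length xs"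
  unfolding word_length_def by (rule Least_le) (auto simp: gens_def)

lemma len_one [simp]: "len \<one> = 0"
  using len_le[of "[]"] by simp

lemma len_eq_0: "\<lbrakk>g \<in> carrier G; len g = 0\<rbrakk> \<Longrightarrow> g = \<one>"
  by (erule len_ex) auto

lemma len_gens: "s \<in> gens \<Longrightarrow> len s \<le> 1"
  using len_le[of "[s]"] by simp

lemma len_mult:
  assumes "g \<in> carrier G" "h \<in> carrier G"
  shows "len (g \<otimes> h) \<le> len g + len h"
proof -
  obtain xs where xs: "length xs = len g" "set xs \<subseteq> gens" "wprod xs = g" by (rule len_ex[OF assms(1)])
  obtain ys where ys: "length ys = len h" "set ys \<subseteq> gens" "wprod ys = h" by (rule len_ex[OF assms(2)])
  have "len (wprod (xs @ ys)) \<le> length (xs @ ys)"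
    using xs ys by (intro len_le) auto
  then show ?thesis using xs ys wprod_append[OF xs(2) ys(2)] by simp
qed

lemma len_inv_le: "g \<in> carrier G \<Longrightarrow> len (inv g) \<le> len g"
proof -
  assume "g \<in> carrier G"
  then obtain xs where xs: "length xs = len g" "set xs \<subseteq> gens" "wprod xs = g" by (rule len_ex)
  then have "set (map (m_inv G) (rev xs)) \<subseteq> gens" using gens_inv by auto
  from len_le[OF this] show ?thesis unfolding wprod_inv[OF xs(2)] using xs by simp
qed

lemma len_inv [simp]: "g \<in> carrier G \<Longrightarrow> len (inv g) = len g"
  using len_inv_le[of g] len_inv_le[of "inv g"] by simp

lemma finite_ball: "finite {g \<in> carrier G. len g \<le> n}"
proof (rule finite_subset)
  show "{g \<in> carrier G. len g \<le> n} \<subseteq> wprod ` {xs. set xs \<subseteq> gens \<and> length xs \<le> n}"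
  proof
    fix g assume "g \<in> {g \<in> carrier G. len g \<le> n}"
    then show "g \<in> wprod ` {xs. set xs \<subseteq> gens \<and> length xs \<le> n}"
      by (auto elim!: len_ex)
  qed
  show "finite (wprod ` {xs. set xs \<subseteq> gens \<and> length xs \<le> n})"
    by (intro finite_imageI finite_lists_length_le finite_gens)
qed

lemma dd_one [simp]: "x \<in> carrier G \<Longrightarrow> dd \<one> x = len x"
  by (simp add: dd_def)

lemma dd_self [simp]: "x \<in> carrier G \<Longrightarrow> dd x x = 0"
  by (simp add: dd_def)

lemma dd_sym: "\<lbrakk>x \<in> carrier G; y \<in> carrier G\<rbrakk> \<Longrightarrow> dd x y = dd y x"
  using len_inv[of "inv x \<otimes> y"] by (simp add: dd_def inv_mult_group)

lemma inv_cancel [simp]: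
  "\<lbrakk>x \<in> carrier G; y \<in> carrier G\<rbrakk> \<Longrightarrow> x \<otimes> (inv x \<otimes> y) = y"
  "\<lbrakk>x \<in> carrier G; y \<in> carrier G\<rbrakk> \<Longrightarrow> inv x \<otimes> (x \<otimes> y) = y"
  by (simp_all add: m_assoc[symmetric])

lemma dd_tri:
  assumes "x \<in> carrier G" "y \<in> carrier G" "z \<in> carrier G"
  shows "dd x z \<le> dd x y + dd y z"
  using len_mult[of "inv x \<otimes> y" "inv y \<otimes> z"] assms by (simp add: dd_def m_assoc)

lemma dd_left [simp]:
  "\<lbrakk>g \<in> carrier G; x \<in> carrier G; y \<in> carrier G\<rbrakk> \<Longrightarrow> dd (g \<otimes> x) (g \<otimes> y) = dd x y"
  by (simp add: dd_def inv_mult_group m_assoc)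

lemma dd_eq_0: "\<lbrakk>x \<in> carrier G; y \<in> carrier G; dd x y = 0\<rbrakk> \<Longrightarrow> x = y"
  using len_eq_0[of "inv x \<otimes> y"] by (simp add: dd_def) (metis inv_cancel(1) r_one)

lemma dd_mult_right [simp]: "\<lbrakk>x \<in> carrier G; s \<in> carrier G\<rbrakk> \<Longrightarrow> dd x (x \<otimes> s) = len s"
  by (simp add: dd_def)

lemma len_le_dd: "\<lbrakk>x \<in> carrier G; y \<in> carrier G\<rbrakk> \<Longrightarrow> len y \<le> len x + dd x y"
  using dd_tri[of \<one> x y] by simp

text \<open>The first letter of a shortest word for \<open>g\<close>.\<close>

lemma len_descend:
  assumes "g \<in> carrier G" "g \<noteq> \<one>"
  shows "\<exists>s\<in>gens. Suc (len (inv s \<otimes> g)) = len g"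
proof -
  obtain xs where xs: "length xs = len g" "set xs \<subseteq> gens" "wprod xs = g" by (rule len_ex[OF assms(1)])
  then obtain s ys where s: "xs = s # ys" using assms(2) by (cases xs) auto
  then have g: "s \<in> gens" "g = s \<otimes> wprod ys" "set ys \<subseteq> gens" using xs by auto
  then have "inv s \<otimes> g = wprod ys" by simp
  then have "len (inv s \<otimes> g) \<le> length ys" using len_le[OF g(3)] by simp
  moreover have "len g \<le> len s + len (inv s \<otimes> g)"
    using len_mult[of s "inv s \<otimes> g"] g assms(1) by simp
  ultimately have "Suc (len (inv s \<otimes> g)) = len g" using xs(1) s len_gens[OF g(1)] by simp
  then show ?thesis using g(1) by blast
qed

lemma dd_step:
  assumes "x \<in> carrier G" "y \<in> carrier G" "x \<noteq> y"
  shows "\<exists>s\<in>gens. Suc (dd (x \<otimes> s) y) = dd x y"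
proof -
  have "inv x \<otimes> y \<noteq> \<one>" using assms by (metis inv_cancel(1) r_one)
  then obtain s where "s \<in> gens" "Suc (len (inv s \<otimes> (inv x \<otimes> y))) = len (inv x \<otimes> y)"
    using len_descend[of "inv x \<otimes> y"] assms(1,2) by (meson inv_closed m_closed)
  then show ?thesis using assms by (auto simp: dd_def inv_mult_group m_assoc)
qed

lemma word_dist_dd: "word_dist G S x y = real (dd x y)"
  by (simp add: word_dist_def dd_def)

end

section \<open>Horofunctions of a hyperbolic group\<close>

text \<open>Gromov's inequality rewritten as a comparison of the three ways to pair four points.
  Gromov products carry a factor 1/2, so \<open>D\<close> plays the role of twice \<delta>.\<close>

locale hyperbolic_metric = word_metric +
  fixes D :: nat
  assumes four_point:
    "\<lbrakk>x \<in> carrier G; y \<in> carrier G; z \<in> carrier G; w \<in> carrier G\<rbrakk> \<Longrightarrow>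
      dd x y + dd z w \<le> max (dd x z + dd y w) (dd x w + dd y z) + D"
begin

text \<open>Functions that look like the distance to a point at infinity, normalised at the identity.
  The last clause is the four-point condition with one point moved to infinity.\<close>

definition Hor :: "('a \<Rightarrow> int) set" where
  "Hor = {\<phi>. \<phi> \<one> = 0 \<and> (\<forall>x. x \<notin> carrier G \<longrightarrow> \<phi> x = 0) \<and>
     (\<forall>x\<in>carrier G. \<forall>y\<in>carrier G. \<phi> x \<le> \<phi> y + int (dd x y)) \<and>
     (\<forall>x\<in>carrier G. \<exists>s\<in>gens. \<phi> (x \<otimes> s) = \<phi> x - 1) \<and>
     (\<forall>x\<in>carrier G. \<forall>y\<in>carrier G. \<forall>w\<in>carrier G.
        int (dd x y) + \<phi> w \<le> max (\<phi> x + int (dd y w)) (\<phi> y + int (dd x w)) + int D)}"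

lemma HorD:
  assumes "\<phi> \<in> Hor"
  shows Hor_one: "\<phi> \<one> = 0"
    and Hor_out: "x \<notin> carrier G \<Longrightarrow> \<phi> x = 0"
    and Hor_lip: "\<lbrakk>x \<in> carrier G; y \<in> carrier G\<rbrakk> \<Longrightarrow> \<phi> x \<le> \<phi> y + int (dd x y)"
    and Hor_desc: "x \<in> carrier G \<Longrightarrow> \<exists>s\<in>gens. \<phi> (x \<otimes> s) = \<phi> x - 1"
    and Hor_four: "\<lbrakk>x \<in> carrier G; y \<in> carrier G; w \<in> carrier G\<rbrakk> \<Longrightarrow>
      int (dd x y) + \<phi> w \<le> max (\<phi> x + int (dd y w)) (\<phi> y + int (dd x w)) + int D"
  using assms unfolding Hor_def by auto

text \<open>The translate of \<phi>, shifted by a constant so that it vanishes at the identity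
  again. The value 0 off the carrier makes horofunctions equal as soon as they agree on the
  group.\<close>

definition act :: "'a \<Rightarrow> ('a \<Rightarrow> int) \<Rightarrow> 'a \<Rightarrow> int" where
  "act g \<phi> x = (if x \<in> carrier G then \<phi> (inv g \<otimes> x) - \<phi> (inv g) else 0)"

lemma act_Hor:
  assumes g: "g \<in> carrier G" and \<phi>: "\<phi> \<in> Hor"
  shows "act g \<phi> \<in> Hor"
proof -
  have 1: "act g \<phi> x \<le> act g \<phi> y + int (dd x y)" if "x \<in> carrier G" "y \<in> carrier G" for x y
    using Hor_lip[OF \<phi>, of "inv g \<otimes> x" "inv g \<otimes> y"] that g by (simp add: act_def)
  have 2: "\<exists>s\<in>gens. act g \<phi> (x \<otimes> s) = act g \<phi> x - 1" if x: "x \<in> carrier G" for x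
  proof -
    obtain s where "s \<in> gens" "\<phi> ((inv g \<otimes> x) \<otimes> s) = \<phi> (inv g \<otimes> x) - 1"
      using Hor_desc[OF \<phi>, of "inv g \<otimes> x"] x g by auto
    then show ?thesis using x g by (intro bexI[of _ s]) (simp_all add: act_def m_assoc)
  qed
  have 3: "int (dd x y) + act g \<phi> w \<le> max (act g \<phi> x + int (dd y w)) (act g \<phi> y + int (dd x w)) + int D"
    if "x \<in> carrier G" "y \<in> carrier G" "w \<in> carrier G" for x y w
    using Hor_four[OF \<phi>, of "inv g \<otimes> x" "inv g \<otimes> y" "inv g \<otimes> w"] that g
    by (simp add: act_def max_def split: if_splits)
  show ?thesis unfolding Hor_def using 1 2 3 g by (auto simp: act_def)
qed

lemma act_act:
  assumes "g \<in> carrier G" "h \<in> carrier G"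
  shows "act g (act h \<phi>) = act (g \<otimes> h) \<phi>"
  using assms by (auto simp: act_def fun_eq_iff inv_mult_group m_assoc)

lemma act_one: "\<phi> \<in> Hor \<Longrightarrow> act \<one> \<phi> = \<phi>"
  by (auto simp: act_def fun_eq_iff Hor_one Hor_out)

lemma act_inv_eq: "\<lbrakk>g \<in> carrier G; x \<in> carrier G\<rbrakk> \<Longrightarrow> act (inv g) \<phi> x = \<phi> (g \<otimes> x) - \<phi> g"
  by (simp add: act_def)

lemma Hor_bound: "\<lbrakk>\<phi> \<in> Hor; x \<in> carrier G\<rbrakk> \<Longrightarrow> \<bar>\<phi> x\<bar> \<le> int (len x)"
  using Hor_lip[of \<phi> x \<one>] Hor_lip[of \<phi> \<one> x] dd_sym[of x \<one>] by (simp add: Hor_one)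

lemma Hor_ray:
  assumes "\<phi> \<in> Hor" "z \<in> carrier G"
  shows "\<exists>y\<in>carrier G. dd z y \<le> t \<and> \<phi> y = \<phi> z - int t"
proof (induction t)
  case 0
  show ?case using assms by (intro bexI[of _ z]) auto
next
  case (Suc t)
  then obtain y where y: "y \<in> carrier G" "dd z y \<le> t" "\<phi> y = \<phi> z - int t" by blast
  obtain s where s: "s \<in> gens" "\<phi> (y \<otimes> s) = \<phi> y - 1" using Hor_desc[OF assms(1) y(1)] by blast
  have "dd z (y \<otimes> s) \<le> Suc t"
    using dd_tri[of z y "y \<otimes> s"] len_gens[OF s(1)] y s assms by simp
  then show ?case using y s by (intro bexI[of _ "y \<otimes> s"]) auto
qed

text \<open>Every descending path of \<open>\<phi>\<close> from a point \<open>z\<close> that lies behind \<open>p\<close> passes near \<open>p\<close>,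
  so \<open>\<phi> z\<close> is determined by \<open>\<phi>\<close> near \<open>p\<close>.\<close>

lemma behind_le:
  assumes \<phi>: "\<phi> \<in> Hor" and \<psi>: "\<psi> \<in> Hor"
    and c: "w \<in> carrier G" "p \<in> carrier G" "z \<in> carrier G"
    and wp: "\<phi> w = \<phi> p + int (dd w p)" and zw: "dd z w + D < dd w p"
    and R: "2 * D \<le> R"
    and eq: "\<And>y. \<lbrakk>y \<in> carrier G; dd p y \<le> R\<rbrakk> \<Longrightarrow> \<phi> y - \<phi> p = \<psi> y - \<psi> p"
  shows "\<psi> z - \<psi> p \<le> \<phi> z - \<phi> p"
proof -
  let ?t = "dd p z"
  have "dd w p \<le> dd z w + ?t" using dd_tri[of w z p] c by (simp add: dd_sym)
  moreover have "int ?t + \<phi> w \<le> max (\<phi> p + int (dd z w)) (\<phi> z + int (dd p w)) + int D"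
    using Hor_four[OF \<phi>] c by blast
  moreover have "dd p w = dd w p" using c by (simp add: dd_sym)
  \<comment> \<open>The first term of the maximum is excluded by \<open>zw\<close>. The second says
    that, up to an error \<open>D\<close>, the point \<open>p\<close> lies on a way down from
    \<open>z\<close>.\<close>
  ultimately have ge: "\<phi> z \<ge> \<phi> p + int ?t - int D"
    using wp zw by (auto simp: max_def split: if_splits)
  obtain y where y: "y \<in> carrier G" "dd z y \<le> ?t" "\<phi> y = \<phi> z - int ?t"
    using Hor_ray[OF \<phi> c(3)] by blast
  \<comment> \<open>Going down \<open>?t\<close> steps from \<open>z\<close> ends near
    \<open>p\<close>: one error \<open>D\<close> comes from \<open>ge\<close>, the other from this
    inequality, hence the radius \<open>2 * D\<close>.\<close>
  have "int (dd p y) + \<phi> z \<le> max (\<phi> p + int (dd y z)) (\<phi> y + int ?t) + int D"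
    using Hor_four[OF \<phi>] c y(1) by blast
  moreover have "dd y z \<le> ?t" using y c by (simp add: dd_sym)
  moreover have "\<phi> z \<le> \<phi> p + int ?t" using Hor_lip[OF \<phi>, of z p] c by (simp add: dd_sym)
  ultimately have "dd p y \<le> 2 * D"
    using ge y(3) by (auto simp: max_def split: if_splits)
  then have "\<phi> y - \<phi> p = \<psi> y - \<psi> p" using eq y(1) R by simp
  moreover have "\<psi> z \<le> \<psi> y + int (dd z y)" using Hor_lip[OF \<psi>] c y by blast
  ultimately show ?thesis using y by linarith
qed

lemma behind:
  assumes "\<phi> \<in> Hor" "\<psi> \<in> Hor" "w \<in> carrier G" "p \<in> carrier G" "z \<in> carrier G"
    and "\<phi> w = \<phi> p + int (dd w p)" "\<psi> w = \<psi> p + int (dd w p)" "dd z w + D < dd w p"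
    and "2 * D \<le> R"
    and "\<And>y. \<lbrakk>y \<in> carrier G; dd p y \<le> R\<rbrakk> \<Longrightarrow> \<phi> y - \<phi> p = \<psi> y - \<psi> p"
  shows "\<psi> z - \<psi> p = \<phi> z - \<phi> p"
proof (rule antisym)
  show "\<psi> z - \<psi> p \<le> \<phi> z - \<phi> p"
    by (rule behind_le[of \<phi> \<psi> w p z R]) (use assms in auto)
  show "\<phi> z - \<phi> p \<le> \<psi> z - \<psi> p"
    by (rule behind_le[of \<psi> \<phi> w p z R]) (use assms in auto)
qed

subsection \<open>The canonical descending path\<close>

text \<open>\<open>R\<close> is the radius of the pictures, and \<open>m\<close> the number of further steps recorded in a symbol; \<open>m\<close> is
  large enough for one symbol to determine the picture of the preceding one.\<close>

definition R :: nat where "R = 2 * D + 1"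

definition m :: nat where "m = R + D + 2"

text \<open>The choice is made from a predicate on generators alone, so horofunctions with equal
  values on \<open>gens\<close> choose the same generator.\<close>

definition N :: "('a \<Rightarrow> int) \<Rightarrow> 'a" where
  "N \<phi> = (SOME s. s \<in> gens \<and> \<phi> s = -1)"

definition T :: "('a \<Rightarrow> int) \<Rightarrow> ('a \<Rightarrow> int)" where
  "T \<phi> = act (inv (N \<phi>)) \<phi>"

primrec descent :: "('a \<Rightarrow> int) \<Rightarrow> nat \<Rightarrow> 'a" where
  "descent \<phi> 0 = \<one>"
| "descent \<phi> (Suc n) = descent \<phi> n \<otimes> N ((T ^^ n) \<phi>)"

definition picture :: "('a \<Rightarrow> int) \<Rightarrow> 'a \<Rightarrow> int" where
  "picture \<phi> x = (if x \<in> carrier G \<and> len x \<le> R then \<phi> x else 0)"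

definition W :: "('a \<Rightarrow> int) \<Rightarrow> ('a \<Rightarrow> int) list" where
  "W \<phi> = map (\<lambda>i. picture ((T ^^ i) \<phi>)) [0..<Suc m]"

definition agree :: "nat \<Rightarrow> ('a \<Rightarrow> int) \<Rightarrow> ('a \<Rightarrow> int) \<Rightarrow> bool" where
  "agree n \<phi> \<psi> \<longleftrightarrow> (\<forall>i\<le>n. picture ((T ^^ i) \<phi>) = picture ((T ^^ i) \<psi>))"

lemma N_props:
  assumes "\<phi> \<in> Hor"
  shows "N \<phi> \<in> gens" "\<phi> (N \<phi>) = -1"
proof -
  obtain s where "s \<in> gens" "\<phi> (\<one> \<otimes> s) = \<phi> \<one> - 1"
    using Hor_desc[OF assms, of \<one>] by auto
  then have "\<exists>s. s \<in> gens \<and> \<phi> s = -1" using Hor_one[OF assms] by auto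
  then show "N \<phi> \<in> gens" "\<phi> (N \<phi>) = -1"
    unfolding N_def using someI_ex[of "\<lambda>s. s \<in> gens \<and> \<phi> s = -1"] by auto
qed

lemma pictureD: "\<lbrakk>picture \<phi> = picture \<psi>; x \<in> carrier G; len x \<le> R\<rbrakk> \<Longrightarrow> \<phi> x = \<psi> x"
  by (drule fun_cong[of _ _ x]) (simp add: picture_def)

lemma N_cong:
  assumes "picture \<phi> = picture \<psi>"
  shows "N \<phi> = N \<psi>"
proof -
  have "\<phi> s = \<psi> s" if "s \<in> gens" for s
    using pictureD[OF assms, of s] len_gens[OF that] that by (simp add: R_def)
  then have "(\<lambda>s. s \<in> gens \<and> \<phi> s = -1) = (\<lambda>s. s \<in> gens \<and> \<psi> s = -1)" by auto
  then show ?thesis unfolding N_def by simp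
qed

lemma T_Hor: "\<phi> \<in> Hor \<Longrightarrow> T \<phi> \<in> Hor"
  unfolding T_def using N_props(1) by (intro act_Hor) auto

lemma Tn_Hor: "\<phi> \<in> Hor \<Longrightarrow> (T ^^ n) \<phi> \<in> Hor"
  by (induction n) (auto simp: T_Hor)

lemma p_in [simp]: "\<phi> \<in> Hor \<Longrightarrow> descent \<phi> n \<in> carrier G"
  by (induction n) (auto simp: N_props(1) Tn_Hor)

lemma Tn_eq: "\<phi> \<in> Hor \<Longrightarrow> (T ^^ n) \<phi> = act (inv (descent \<phi> n)) \<phi>"
proof (induction n)
  case 0
  then show ?case by (simp add: act_one)
next
  case (Suc n)
  have "N ((T ^^ n) \<phi>) \<in> carrier G" using Suc(2) by (simp add: N_props(1) Tn_Hor)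
  moreover have "(T ^^ Suc n) \<phi> = act (inv (N ((T ^^ n) \<phi>))) ((T ^^ n) \<phi>)"
    by (simp add: T_def)
  moreover have "(T ^^ n) \<phi> = act (inv (descent \<phi> n)) \<phi>" using Suc by simp
  ultimately have "(T ^^ Suc n) \<phi> = act (inv (N ((T ^^ n) \<phi>))) (act (inv (descent \<phi> n)) \<phi>)"
    by simp
  then show ?case
    using Suc(2) \<open>N ((T ^^ n) \<phi>) \<in> carrier G\<close> by (simp add: act_act inv_mult_group)
qed

lemma Tn_apply:
  "\<lbrakk>\<phi> \<in> Hor; x \<in> carrier G\<rbrakk> \<Longrightarrow> ((T ^^ n) \<phi>) x = \<phi> (descent \<phi> n \<otimes> x) - \<phi> (descent \<phi> n)"
  by (simp add: Tn_eq act_inv_eq)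

lemma phi_p: "\<phi> \<in> Hor \<Longrightarrow> \<phi> (descent \<phi> n) = - int n"
proof (induction n)
  case (Suc n)
  then show ?case
    using N_props[OF Tn_Hor[OF Suc(2), of n]] Tn_apply[OF Suc(2), of "N ((T ^^ n) \<phi>)" n] by simp
qed (simp add: Hor_one)

text \<open>\<phi> falls by one at each step and is 1-Lipschitz, so descending paths are
  geodesics.\<close>

lemma dd_p:
  assumes "\<phi> \<in> Hor" "i \<le> j"
  shows "dd (descent \<phi> i) (descent \<phi> j) = j - i"
proof (rule antisym)
  show "dd (descent \<phi> i) (descent \<phi> j) \<le> j - i"
    using assms(2)
  proof (induction j rule: dec_induct)
    case (step j)
    have "N ((T ^^ j) \<phi>) \<in> gens" using assms(1) by (simp add: N_props(1) Tn_Hor)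
    then show ?case
      using dd_tri[of "descent \<phi> i" "descent \<phi> j" "descent \<phi> (Suc j)"] len_gens[of "N ((T ^^ j) \<phi>)"] step assms(1)
      by (simp add: Suc_diff_le)
  qed (simp add: assms)
  show "j - i \<le> dd (descent \<phi> i) (descent \<phi> j)"
    using Hor_lip[OF assms(1), of "descent \<phi> i" "descent \<phi> j"] assms by (simp add: phi_p)
qed

lemma len_p: "\<phi> \<in> Hor \<Longrightarrow> len (descent \<phi> n) = n"
  using dd_p[of \<phi> 0 n] by simp

text \<open>The picture at \<open>i\<close> determines the step from \<open>i\<close> to
  \<open>Suc i\<close>; hence the range up to \<open>Suc n\<close>.\<close>

lemma agree_p: "\<lbrakk>agree n \<phi> \<psi>; i \<le> Suc n\<rbrakk> \<Longrightarrow> descent \<phi> i = descent \<psi> i"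
proof (induction i)
  case (Suc i)
  then show ?case using N_cong[of "(T ^^ i) \<phi>" "(T ^^ i) \<psi>"] by (simp add: agree_def)
qed simp

lemma agree_mono: "\<lbrakk>agree n \<phi> \<psi>; k \<le> n\<rbrakk> \<Longrightarrow> agree k \<phi> \<psi>"
  by (simp add: agree_def)

text \<open>A picture shows values relative to a point of the path. At that point both horofunctions
  have the value \<open>- int i\<close>, so the absolute values agree as well.\<close>

lemma agree_ball:
  assumes "\<phi> \<in> Hor" "\<psi> \<in> Hor" "agree n \<phi> \<psi>" "i \<le> n" "y \<in> carrier G" "dd (descent \<phi> i) y \<le> R"
  shows "\<phi> y = \<psi> y"
proof -
  have eq: "descent \<phi> i = descent \<psi> i" using agree_p assms by simp
  have "((T ^^ i) \<phi>) (inv (descent \<phi> i) \<otimes> y) = ((T ^^ i) \<psi>) (inv (descent \<phi> i) \<otimes> y)"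
    using assms by (intro pictureD) (auto simp: agree_def dd_def)
  then show ?thesis
    using assms phi_p[OF assms(1), of i] phi_p[OF assms(2), of i] by (simp add: Tn_apply eq)
qed

text \<open>This is \<open>behind\<close> with \<open>w\<close> the point \<open>i\<close> and
  \<open>p\<close> the point \<open>n\<close> of the common path: whatever is closer than
  \<open>n - i - D\<close> to the former lies behind the latter.\<close>

lemma agree_far:
  assumes "\<phi> \<in> Hor" "\<psi> \<in> Hor" "agree n \<phi> \<psi>" "i \<le> n" "z \<in> carrier G"
    and "dd z (descent \<phi> i) + D < n - i"
  shows "\<phi> z = \<psi> z"
proof -
  have eq: "descent \<phi> i = descent \<psi> i" "descent \<phi> n = descent \<psi> n" using agree_p assms by simp_all
  have "\<psi> z - \<psi> (descent \<phi> n) = \<phi> z - \<phi> (descent \<phi> n)"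
  proof (rule behind[of \<phi> \<psi> "descent \<phi> i" "descent \<phi> n" z R])
    show "\<phi> (descent \<phi> i) = \<phi> (descent \<phi> n) + int (dd (descent \<phi> i) (descent \<phi> n))"
      using assms by (simp add: phi_p dd_p)
    show "\<psi> (descent \<phi> i) = \<psi> (descent \<phi> n) + int (dd (descent \<phi> i) (descent \<phi> n))"
      unfolding eq using assms by (simp add: phi_p dd_p)
    show "dd z (descent \<phi> i) + D < dd (descent \<phi> i) (descent \<phi> n)" using assms by (simp add: dd_p)
    show "\<phi> y - \<phi> (descent \<phi> n) = \<psi> y - \<psi> (descent \<phi> n)" if "y \<in> carrier G" "dd (descent \<phi> n) y \<le> R" for y
      using agree_ball[OF assms(1-3) order.refl that] phi_p[OF assms(1), of n] phi_p[OF assms(2), of n]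
      by (simp add: eq)
  qed (use assms in \<open>auto simp: R_def\<close>)
  moreover have "\<psi> (descent \<phi> n) = \<phi> (descent \<phi> n)" using phi_p[OF assms(1), of n] phi_p[OF assms(2), of n] by (simp add: eq)
  ultimately show ?thesis by simp
qed

text \<open>Only balls along the path of \<phi> are compared; that \<psi> has the same path follows
  step by step from the equality of pictures.\<close>

lemma agreeI:
  assumes "\<phi> \<in> Hor" "\<psi> \<in> Hor"
    and eq: "\<And>i y. \<lbrakk>i \<le> k; y \<in> carrier G; dd (descent \<phi> i) y \<le> R\<rbrakk> \<Longrightarrow> \<phi> y = \<psi> y"
  shows "agree k \<phi> \<psi>"
proof -
  have pic: "picture ((T ^^ i) \<phi>) = picture ((T ^^ i) \<psi>)" if "descent \<phi> i = descent \<psi> i" "i \<le> k" for i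
  proof
    fix x
    show "picture ((T ^^ i) \<phi>) x = picture ((T ^^ i) \<psi>) x"
      using eq[OF that(2), of "descent \<psi> i \<otimes> x"] eq[OF that(2), of "descent \<phi> i"] assms that(1)
      by (auto simp: picture_def Tn_apply phi_p)
  qed
  have "i \<le> k \<Longrightarrow> descent \<phi> i = descent \<psi> i" for i
  proof (induction i)
    case (Suc i)
    then show ?case using N_cong[OF pic] by simp
  qed simp
  then show ?thesis using pic by (simp add: agree_def)
qed

section \<open>Horofunctions as a symbolic system\<close>

lemma W_eq_iff: "W \<phi> = W \<psi> \<longleftrightarrow> agree m \<phi> \<psi>"
  by (auto simp: W_def agree_def simp del: upt_Suc)

lemma W_Tn_agree:
  "agree (n + m) \<phi> \<psi> \<longleftrightarrow> (\<forall>i\<le>n. W ((T ^^ i) \<phi>) = W ((T ^^ i) \<psi>))"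
proof
  assume "agree (n + m) \<phi> \<psi>"
  then have "picture ((T ^^ j) ((T ^^ i) \<phi>)) = picture ((T ^^ j) ((T ^^ i) \<psi>))" if "i \<le> n" "j \<le> m" for i j
    using that by (simp add: agree_def funpow_add[symmetric] flip: comp_apply[of "T ^^ j" "T ^^ i"])
  then show "\<forall>i\<le>n. W ((T ^^ i) \<phi>) = W ((T ^^ i) \<psi>)"
    by (simp add: W_eq_iff agree_def)
next
  assume *: "\<forall>i\<le>n. W ((T ^^ i) \<phi>) = W ((T ^^ i) \<psi>)"
  show "agree (n + m) \<phi> \<psi>"
    unfolding agree_def
  proof (intro allI impI)
    fix k assume k: "k \<le> n + m"
    \<comment> \<open>Position \<open>k\<close> belongs to the window that starts at
      \<open>min k n\<close>.\<close>
    define i where "i = min k n"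
    have i: "i \<le> n" "k - i \<le> m" "k = (k - i) + i" using k by (auto simp: i_def)
    then have "picture ((T ^^ (k - i)) ((T ^^ i) \<phi>)) = picture ((T ^^ (k - i)) ((T ^^ i) \<psi>))"
      using * by (simp add: W_eq_iff agree_def)
    then show "picture ((T ^^ k) \<phi>) = picture ((T ^^ k) \<psi>)"
      by (subst (1 2) i(3)) (simp add: funpow_add)
  qed
qed

lemma finite_W: "finite (W ` Hor)"
proof (rule finite_subset)
  let ?B = "{x \<in> carrier G. len x \<le> R}"
  let ?P = "{f. (\<forall>x. (x \<in> ?B \<longrightarrow> f x \<in> {- int R..int R}) \<and> (x \<notin> ?B \<longrightarrow> f x = 0))}"
  have "picture \<phi> \<in> ?P" if "\<phi> \<in> Hor" for \<phi>
  proof (intro CollectI allI conjI impI)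
    fix x assume "x \<in> ?B"
    then show "picture \<phi> x \<in> {- int R..int R}"
      using Hor_bound[OF that, of x] by (auto simp: picture_def)
  qed (auto simp: picture_def)
  then show "W ` Hor \<subseteq> {xs. set xs \<subseteq> ?P \<and> length xs = Suc m}"
    using Tn_Hor by (auto simp: W_def simp del: upt_Suc)
  have "finite ?P" by (intro finite_set_of_finite_funs finite_ball) simp
  then show "finite {xs. set xs \<subseteq> ?P \<and> length xs = Suc m}"
    by (rule finite_lists_length_eq)
qed

text \<open>Translating \<phi> by the generator \<open>N \<psi>\<close> puts a step in front of it.
  As \<phi> and \<open>T \<psi>\<close> agree up to length \<open>R + 1\<close>, the translate has
  the picture of \<psi>; hence its own first step is \<open>N \<psi>\<close>, and \<open>T\<close>
  undoes the translation.\<close>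

lemma markov_Hor:
  assumes \<phi>: "\<phi> \<in> Hor" and \<psi>: "\<psi> \<in> Hor" and eq: "W \<phi> = W (T \<psi>)"
  shows "\<exists>\<theta>\<in>Hor. W \<theta> = W \<psi> \<and> T \<theta> = \<phi>"
proof -
  let ?s = "N \<psi>"
  define \<theta> where "\<theta> = act ?s \<phi>"
  have s: "?s \<in> gens" "?s \<in> carrier G" using N_props(1)[OF \<psi>] by auto
  have T\<psi>: "T \<psi> \<in> Hor" using \<psi> by (rule T_Hor)
  have \<theta>: "\<theta> \<in> Hor" unfolding \<theta>_def using s \<phi> by (intro act_Hor)
  have ag: "agree m \<phi> (T \<psi>)" using eq by (simp add: W_eq_iff)
  \<comment> \<open>The choice \<open>m = R + D + 2\<close> makes \<open>len z + D < m\<close> hold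
    up to length \<open>R + 1\<close>.\<close>
  have near: "\<phi> z = T \<psi> z" if "z \<in> carrier G" "len z \<le> R + 1" for z
  proof (rule agree_far[OF \<phi> T\<psi> ag, of 0])
    show "dd z (descent \<phi> 0) + D < m - 0" using that dd_sym[of z \<one>] by (simp add: m_def)
  qed (use that in auto)
  have "\<theta> x = \<psi> x" if x: "x \<in> carrier G" "len x \<le> R" for x
  proof -
    have "len (inv ?s \<otimes> x) \<le> R + 1"
      using len_mult[of "inv ?s" x] len_gens[OF s(1)] x s by simp
    then have "\<phi> (inv ?s \<otimes> x) = T \<psi> (inv ?s \<otimes> x)" using x s by (intro near) auto
    moreover have "\<phi> (inv ?s) = T \<psi> (inv ?s)"
      using len_gens[OF s(1)] s by (intro near) auto
    ultimately show ?thesis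
      using x s Hor_one[OF \<psi>] by (simp add: \<theta>_def act_def[of ?s] T_def act_inv_eq)
  qed
  then have pic: "picture \<theta> = picture \<psi>" by (auto simp: picture_def)
  have T\<theta>: "T \<theta> = \<phi>"
    unfolding T_def N_cong[OF pic] using s \<phi> by (simp add: \<theta>_def act_act act_one)
  have "agree m \<theta> \<psi>"
    unfolding agree_def
  proof (intro allI impI)
    fix i assume "i \<le> m"
    then show "picture ((T ^^ i) \<theta>) = picture ((T ^^ i) \<psi>)"
    proof (cases i)
      case (Suc j)
      have "(T ^^ i) \<theta> = (T ^^ j) \<phi>" "(T ^^ i) \<psi> = (T ^^ j) (T \<psi>)"
        using T\<theta> by (simp_all add: Suc funpow_swap1)
      then show ?thesis using ag Suc \<open>i \<le> m\<close> by (simp add: agree_def)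
    qed (simp add: pic)
  qed
  then show ?thesis using \<theta> T\<theta> by (auto simp: W_eq_iff)
qed

lemma agree_all_near:
  assumes "\<phi> \<in> Hor" "\<psi> \<in> Hor" "agree n \<phi> \<psi>" "z \<in> carrier G" "len z + D < n"
  shows "\<phi> z = \<psi> z"
  by (rule agree_far[OF assms(1-3), of 0]) (use assms dd_sym[of z \<one>] in auto)

text \<open>The values at each point stabilise along \<xi>, and each clause of \<open>Hor\<close>
  about given points can be read off from a late member.\<close>

lemma complete_Hor:
  assumes \<xi>: "\<And>n. \<xi> n \<in> Hor" "\<And>n i. i \<le> n \<Longrightarrow> W ((T ^^ i) (\<xi> n)) = a i"
  shows "\<exists>x\<in>Hor. \<forall>i. W ((T ^^ i) x) = a i"
proof -
  have ag: "agree (n + m) (\<xi> n) (\<xi> k)" if "n \<le> k" for n k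
    unfolding W_Tn_agree using that \<xi>(2) by simp
  define \<phi> where "\<phi> z = \<xi> (len z + D + 1) z" for z
  have eq: "\<xi> n z = \<phi> z" if "len z + D < n" for n z
  proof (cases "z \<in> carrier G")
    case True
    have "\<xi> (len z + D + 1) z = \<xi> n z"
      by (rule agree_all_near[OF \<xi>(1) \<xi>(1) ag]) (use that True in auto)
    then show ?thesis by (simp add: \<phi>_def)
  qed (simp add: \<phi>_def Hor_out[OF \<xi>(1)])
  have "\<phi> \<in> Hor"
    unfolding Hor_def
  proof (intro CollectI conjI allI ballI impI)
    show "\<phi> \<one> = 0" using Hor_one[OF \<xi>(1)] by (simp add: \<phi>_def)
    show "\<phi> x = 0" if "x \<notin> carrier G" for x using Hor_out[OF \<xi>(1) that] by (simp add: \<phi>_def)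
    show "\<phi> x \<le> \<phi> y + int (dd x y)" if "x \<in> carrier G" "y \<in> carrier G" for x y
      using Hor_lip[OF \<xi>(1) that, of "len x + len y + D + 1"] by (simp add: eq)
    show "int (dd x y) + \<phi> w \<le> max (\<phi> x + int (dd y w)) (\<phi> y + int (dd x w)) + int D"
      if "x \<in> carrier G" "y \<in> carrier G" "w \<in> carrier G" for x y w
      using Hor_four[OF \<xi>(1) that, of "len x + len y + len w + D + 1"] by (simp add: eq)
    show "\<exists>s\<in>gens. \<phi> (x \<otimes> s) = \<phi> x - 1" if x: "x \<in> carrier G" for x
    proof -
      \<comment> \<open>The index ends in \<open>D + 2\<close> because \<open>x \<otimes> s\<close>
        may be longer than \<open>x\<close> by one.\<close>
      obtain s where s: "s \<in> gens" "\<xi> (len x + D + 2) (x \<otimes> s) = \<xi> (len x + D + 2) x - 1"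
        using Hor_desc[OF \<xi>(1) x] by blast
      moreover have "len (x \<otimes> s) \<le> len x + 1" using len_mult[of x s] len_gens[OF s(1)] x s by simp
      ultimately show ?thesis by (intro bexI[of _ s]) (simp_all add: eq)
    qed
  qed
  moreover have "W ((T ^^ i) \<phi>) = a i" for i
  proof -
    \<comment> \<open>Points within \<open>R\<close> of the path up to step \<open>i + m\<close>
      have length at most \<open>i + m + R\<close>, and there \<open>\<xi> ?n\<close> already has
      its final values.\<close>
    let ?n = "i + m + R + D + 1"
    have "agree (i + m) (\<xi> ?n) \<phi>"
    proof (rule agreeI[OF \<xi>(1) \<open>\<phi> \<in> Hor\<close>])
      fix j y assume j: "j \<le> i + m" and y: "y \<in> carrier G" "dd (descent (\<xi> ?n) j) y \<le> R"
      then have "len y \<le> j + R"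
        using len_le_dd[of "descent (\<xi> ?n) j" y] len_p[OF \<xi>(1)] p_in[OF \<xi>(1)] by fastforce
      then show "\<xi> ?n y = \<phi> y" using j by (intro eq) simp
    qed
    then have "W ((T ^^ i) (\<xi> ?n)) = W ((T ^^ i) \<phi>)" by (simp add: W_Tn_agree)
    then show ?thesis using \<xi>(2)[of i ?n] by simp
  qed
  ultimately show ?thesis by blast
qed

sublocale symbolic_system Hor T W
proof
  fix x y assume xy: "x \<in> Hor" "y \<in> Hor" "\<And>n. W ((T ^^ n) x) = W ((T ^^ n) y)"
  have "x z = y z" for z
  proof (cases "z \<in> carrier G")
    case True
    have "agree (len z + D + 1 + m) x y" unfolding W_Tn_agree using xy by blast
    then show ?thesis by (rule agree_all_near[OF xy(1,2)]) (use True in auto)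
  qed (simp add: Hor_out[OF xy(1)] Hor_out[OF xy(2)])
  then show "x = y" by blast
qed (use T_Hor finite_W markov_Hor complete_Hor in blast)+

subsection \<open>Elements of the group act with finitely many local actions\<close>

text \<open>The pulled-back point \<open>?x\<close> has length at most \<open>len g + n\<close> and
  value at most \<open>len g - n\<close>. The four-point clause for \<open>?x\<close>, the point
  \<open>n\<close> of the path and the identity then bounds their distance by
  \<open>len g + D\<close>.\<close>

lemma p_act_near:
  assumes \<phi>: "\<phi> \<in> Hor" and g: "g \<in> carrier G"
  shows "dd (descent (act g \<phi>) n) (g \<otimes> descent \<phi> n) \<le> len g + D"
proof -
  let ?q = "descent (act g \<phi>) n"
  let ?x = "inv g \<otimes> ?q"
  have A: "act g \<phi> \<in> Hor" using act_Hor[OF g \<phi>] .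
  then have q: "?q \<in> carrier G" by simp
  have "act g \<phi> ?q = - int n" using phi_p[OF A] .
  then have "\<phi> ?x = \<phi> (inv g) - int n" using q by (simp add: act_def)
  moreover have "\<bar>\<phi> (inv g)\<bar> \<le> int (len g)" using Hor_bound[OF \<phi>, of "inv g"] g by simp
  ultimately have 1: "\<phi> ?x \<le> int (len g) - int n" by linarith
  have 2: "len ?x \<le> len g + n" using len_mult[of "inv g" ?q] g q len_p[OF A] by simp
  have "int (dd ?x (descent \<phi> n)) + \<phi> \<one> \<le> max (\<phi> ?x + int (dd (descent \<phi> n) \<one>)) (\<phi> (descent \<phi> n) + int (dd ?x \<one>)) + int D"
    using Hor_four[OF \<phi>, of ?x "descent \<phi> n" \<one>] g q \<phi> by simp
  moreover have "dd (descent \<phi> n) \<one> = n" "dd ?x \<one> = len ?x"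
    using dd_sym[of _ \<one>] g q \<phi> len_p[OF \<phi>] by simp_all
  ultimately have "dd ?x (descent \<phi> n) \<le> len g + D"
    using 1 2 Hor_one[OF \<phi>] phi_p[OF \<phi>, of n] by (auto simp: max_def split: if_splits)
  moreover have "dd ?q (g \<otimes> descent \<phi> n) = dd ?x (descent \<phi> n)"
    using dd_left[of g ?x "descent \<phi> n"] g q \<phi> by simp
  ultimately show ?thesis by simp
qed

text \<open>\<open>R\<close> is for the ball, \<open>len g + D\<close> for the distance between the
  two paths, and \<open>D + 1\<close> for the strict bound in \<open>agree_far\<close>.\<close>

definition delay :: "'a \<Rightarrow> nat" where "delay g = R + len g + 2 * D + 1"

lemma agree_act:
  assumes \<phi>: "\<phi> \<in> Hor" and \<psi>: "\<psi> \<in> Hor" and g: "g \<in> carrier G"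
    and ag: "agree n \<phi> \<psi>" and k: "k + delay g \<le> n"
  shows "agree k (act g \<phi>) (act g \<psi>)"
proof (rule agreeI)
  show A: "act g \<phi> \<in> Hor" "act g \<psi> \<in> Hor" using act_Hor g \<phi> \<psi> by auto
  fix i y assume i: "i \<le> k" and y: "y \<in> carrier G" "dd (descent (act g \<phi>) i) y \<le> R"
  let ?q = "descent (act g \<phi>) i"
  have q: "?q \<in> carrier G" using A by simp
  have "dd y (g \<otimes> descent \<phi> i) \<le> R + len g + D"
    using dd_tri[of y ?q "g \<otimes> descent \<phi> i"] dd_sym[of y ?q] y q g \<phi> p_act_near[OF \<phi> g, of i] by simp
  moreover have "dd (inv g \<otimes> y) (descent \<phi> i) = dd y (g \<otimes> descent \<phi> i)"
    using dd_left[of g "inv g \<otimes> y" "descent \<phi> i"] y g \<phi> by simp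
  ultimately have "\<phi> (inv g \<otimes> y) = \<psi> (inv g \<otimes> y)"
    using i k y g by (intro agree_far[OF \<phi> \<psi> ag, of i]) (auto simp: delay_def)
  moreover have "\<phi> (inv g) = \<psi> (inv g)"
    using k g by (intro agree_all_near[OF \<phi> \<psi> ag]) (auto simp: delay_def)
  ultimately show "act g \<phi> y = act g \<psi> y" by (simp add: act_def)
qed

lemma Hor_from_Tn:
  assumes "\<phi> \<in> Hor"
  shows "\<phi> = act (descent \<phi> n) ((T ^^ n) \<phi>)"
  using assms by (simp add: Tn_eq act_act act_one)

text \<open>Both tails are translates of \<phi>, hence they differ by one group element.\<close>

lemma Tn_act:
  assumes \<phi>: "\<phi> \<in> Hor" and g: "g \<in> carrier G"
  shows "(T ^^ n) (act g \<phi>) = act (inv (descent (act g \<phi>) n) \<otimes> g \<otimes> descent \<phi> k) ((T ^^ k) \<phi>)"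
proof -
  have A: "act g \<phi> \<in> Hor" using act_Hor g \<phi> by auto
  have "(T ^^ n) (act g \<phi>) = act (inv (descent (act g \<phi>) n)) (act g \<phi>)" using Tn_eq[OF A] .
  also have "\<dots> = act (inv (descent (act g \<phi>) n)) (act g (act (descent \<phi> k) ((T ^^ k) \<phi>)))"
    using Hor_from_Tn[OF \<phi>, of k] by simp
  also have "\<dots> = act (inv (descent (act g \<phi>) n) \<otimes> g \<otimes> descent \<phi> k) ((T ^^ k) \<phi>)"
    using A g \<phi> by (simp add: act_act m_assoc)
  finally show ?thesis .
qed

text \<open>The bound is independent of \<open>n\<close> and \<phi>, so this element ranges over a
  finite ball. The summand \<open>c\<close> is the lag along the path of \<phi>.\<close>

lemma len_local:
  assumes \<phi>: "\<phi> \<in> Hor" and g: "g \<in> carrier G"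
  shows "len (inv (descent (act g \<phi>) n) \<otimes> g \<otimes> descent \<phi> (n + c)) \<le> len g + D + c"
proof -
  have A: "act g \<phi> \<in> Hor" using act_Hor g \<phi> by auto
  let ?q = "descent (act g \<phi>) n"
  have "len (inv ?q \<otimes> g \<otimes> descent \<phi> (n + c)) = dd ?q (g \<otimes> descent \<phi> (n + c))"
    using A g \<phi> by (simp add: dd_def m_assoc)
  also have "\<dots> \<le> dd ?q (g \<otimes> descent \<phi> n) + dd (g \<otimes> descent \<phi> n) (g \<otimes> descent \<phi> (n + c))"
    using A g \<phi> by (intro dd_tri) auto
  also have "\<dots> \<le> len g + D + c"
    using p_act_near[OF \<phi> g, of n] dd_p[OF \<phi>, of n "n + c"] g \<phi> by simp
  finally show ?thesis .
qed

definition act2 :: "'a \<Rightarrow> ('a \<Rightarrow> int) \<times> (nat \<Rightarrow> bool) \<Rightarrow> ('a \<Rightarrow> int) \<times> (nat \<Rightarrow> bool)" where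
  "act2 g z = (act g (fst z), snd z)"

text \<open>The image is continued from position \<open>n\<close>, the input from
  \<open>n + delay g\<close>. Since \<open>g\<close> fixes the Cantor coordinate, a rule has to put
  the \<open>delay g\<close> skipped bits back in front.\<close>

definition local_actions :: "'a \<Rightarrow> (('a \<Rightarrow> int) \<times> (nat \<Rightarrow> bool) \<Rightarrow> ('a \<Rightarrow> int) \<times> (nat \<Rightarrow> bool)) set" where
  "local_actions g = (\<lambda>(k, bs) z. (act k (fst z), bs \<frown> snd z)) `
     ({k \<in> carrier G. len k \<le> len g + D + delay g} \<times> {bs. set bs \<subseteq> UNIV \<and> length bs = delay g})"

lemma finite_local_actions: "finite (local_actions g)"
  unfolding local_actions_def
  by (intro finite_imageI finite_cartesian_product finite_ball finite_lists_length_eq finite)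

lemma act2_local:
  assumes g: "g \<in> carrier G" and x: "x \<in> Hor \<times> UNIV"
  shows "\<exists>\<beta>\<in>local_actions g. \<forall>y\<in>Hor \<times> UNIV.
     (\<forall>i<n + delay g. W2 ((T2 ^^ i) y) = W2 ((T2 ^^ i) x)) \<longrightarrow>
     (\<forall>i<n. W2 ((T2 ^^ i) (act2 g y)) = W2 ((T2 ^^ i) (act2 g x))) \<and>
     (T2 ^^ n) (act2 g y) = \<beta> ((T2 ^^ (n + delay g)) y)"
proof -
  let ?c = "delay g"
  obtain \<phi> b where xb: "x = (\<phi>, b)" and \<phi>: "\<phi> \<in> Hor" using x by auto
  have A: "act g \<phi> \<in> Hor" using act_Hor g \<phi> by auto
  define k where "k = inv (descent (act g \<phi>) n) \<otimes> g \<otimes> descent \<phi> (n + ?c)"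
  define bs where "bs = map b [n..<n + ?c]"
  let ?\<beta> = "(\<lambda>(k, bs) z. (act k (fst z), bs \<frown> snd z)) (k, bs)"
  have c: "?c \<ge> 1" by (simp add: delay_def)
  have "k \<in> carrier G" using A g \<phi> by (simp add: k_def)
  then have "?\<beta> \<in> local_actions g"
    unfolding local_actions_def using len_local[OF \<phi> g, of n ?c]
    by (intro imageI) (auto simp: k_def bs_def)
  moreover have "(\<forall>i<n. W2 ((T2 ^^ i) (act2 g y)) = W2 ((T2 ^^ i) (act2 g x))) \<and>
     (T2 ^^ n) (act2 g y) = ?\<beta> ((T2 ^^ (n + ?c)) y)"
    if y: "y \<in> Hor \<times> UNIV" and eq: "\<forall>i<n + ?c. W2 ((T2 ^^ i) y) = W2 ((T2 ^^ i) x)" for y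
  proof -
    obtain \<psi> b' where yb: "y = (\<psi>, b')" and \<psi>: "\<psi> \<in> Hor" using y by auto
    have W: "W ((T ^^ i) \<psi>) = W ((T ^^ i) \<phi>)" and bb: "b' i = b i" if "i < n + ?c" for i
      using eq that by (auto simp: xb yb W2_T2)
    \<comment> \<open>The last symbol read starts at \<open>n + ?c - 1\<close> and shows
      \<open>m\<close> further pictures.\<close>
    have "agree (n + ?c - 1 + m) \<phi> \<psi>"
      unfolding W_Tn_agree using W c by auto
    then have ag: "agree (n + ?c) \<phi> \<psi>" "agree (n + ?c - 1 + m) \<phi> \<psi>"
      by (auto elim: agree_mono simp: m_def)
    have agn: "agree n (act g \<phi>) (act g \<psi>)"
      by (rule agree_act[OF \<phi> \<psi> g ag(1)]) simp
    have "W ((T ^^ i) (act g \<phi>)) = W ((T ^^ i) (act g \<psi>))" if "i < n" for i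
    proof -
      \<comment> \<open>The symbols of the image below \<open>n\<close> extend to picture
        \<open>n - 1 + m\<close>, so this uses the longer of the two agreements.\<close>
      have "agree (n - 1 + m) (act g \<phi>) (act g \<psi>)"
        by (rule agree_act[OF \<phi> \<psi> g ag(2)]) (use c that in simp)
      then show ?thesis unfolding W_Tn_agree using that by simp
    qed
    then have 1: "\<forall>i<n. W2 ((T2 ^^ i) (act2 g y)) = W2 ((T2 ^^ i) (act2 g x))"
      using bb by (simp add: W2_T2 act2_def xb yb)
    have "descent (act g \<psi>) n = descent (act g \<phi>) n" "descent \<psi> (n + ?c) = descent \<phi> (n + ?c)"
      using agree_p[OF agn, of n] agree_p[OF ag(1), of "n + ?c"] by simp_all
    then have "(T ^^ n) (act g \<psi>) = act k ((T ^^ (n + ?c)) \<psi>)"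
      using Tn_act[OF \<psi> g, of n "n + ?c"] by (simp add: k_def)
    moreover have "(\<lambda>j. b' (j + n)) = bs \<frown> (\<lambda>j. b' (j + (n + ?c)))"
    proof
      fix j
      show "b' (j + n) = (bs \<frown> (\<lambda>j. b' (j + (n + ?c)))) j"
        using bb[of "j + n"] by (auto simp: prepend_def bs_def add.commute)
    qed
    ultimately have "(T2 ^^ n) (act2 g y) = ?\<beta> ((T2 ^^ (n + ?c)) y)"
      by (simp add: T2_funpow act2_def yb)
    then show ?thesis using 1 by blast
  qed
  ultimately show ?thesis by blast
qed

lemma act2_in: "\<lbrakk>g \<in> carrier G; z \<in> Hor \<times> UNIV\<rbrakk> \<Longrightarrow> act2 g z \<in> Hor \<times> UNIV"
  by (auto simp: act2_def act_Hor)

section \<open>The action on the Cantor set and its map to the horofunctions\<close>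

context
  assumes nonempty: "Hor \<noteq> {}"
begin

interpretation prod: branching_system "Hor \<times> UNIV" T2 W2
  by (rule branching_product[OF nonempty])

definition rep :: "'a \<Rightarrow> (nat \<Rightarrow> bool) \<Rightarrow> (nat \<Rightarrow> bool)" where
  "rep g = prod.conj_map (act2 g)"

definition point :: "(nat \<Rightarrow> bool) \<Rightarrow> 'a \<Rightarrow> int" where
  "point w = fst (prod.decode None w)"

lemma rep_mult:
  assumes "g \<in> carrier G" "h \<in> carrier G"
  shows "rep (g \<otimes> h) = rep g \<circ> rep h"
proof -
  have "act2 g \<circ> act2 h = act2 (g \<otimes> h)" using assms by (auto simp: act2_def act_act)
  then show ?thesis
    unfolding rep_def using assms by (subst prod.conj_map_comp) (auto simp: act2_in)
qed

lemma rep_one: "rep \<one> = id"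
  unfolding rep_def by (rule prod.conj_map_id) (auto simp: act2_def act_one)

text \<open>The inverse of \<open>rep g\<close> is \<open>rep (inv g)\<close>, which is continuous
  for the same reason; it also yields the injectivity that the transducer criterion asks
  for.\<close>

lemma rep_rational:
  assumes g: "g \<in> carrier G"
  shows "rep g \<in> rational_group"
proof -
  have cont: "continuous_map cantor_top cantor_top (rep h)" if "h \<in> carrier G" for h
    unfolding rep_def
    by (intro seq_cont_continuous_map prod.conj_map_cont[where \<Phi> = "local_actions h" and c = "delay h"]
        act2_in act2_local finite_local_actions that)
  have i: "rep (inv g) \<circ> rep g = id" "rep g \<circ> rep (inv g) = id"
    using g rep_mult[of "inv g" g] rep_mult[of g "inv g"] by (simp_all add: rep_one)
  then have inv: "rep (inv g) (rep g w) = w" "rep g (rep (inv g) w) = w" for w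
    by (metis comp_apply id_apply)+
  have "homeomorphic_maps cantor_top cantor_top (rep g) (rep (inv g))"
    unfolding homeomorphic_maps_def using cont g inv by simp
  then have "homeomorphic_map cantor_top cantor_top (rep g)"
    using homeomorphic_maps_map by blast
  moreover have "inj (rep g)" using inv(1) by (metis injI)
  then have "computed_by_transducer (rep g)"
    unfolding rep_def
    by (intro prod.conj_map_computed[where \<Phi> = "local_actions g" and c = "delay g"]
        act2_in act2_local finite_local_actions g)
  ultimately show ?thesis by (simp add: rational_group_def)
qed

lemma point_in: "point w \<in> Hor"
  using prod.decode_None_in[of w] by (auto simp: point_def)

lemma point_surj: "\<phi> \<in> Hor \<Longrightarrow> \<exists>w. point w = \<phi>"
  using prod.decode_encode[of None "(\<phi>, \<lambda>_. True)"]
  by (intro exI[of _ "prod.encode None (\<phi>, \<lambda>_. True)"]) (simp add: point_def prod.cyl_None)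

lemma point_rep: "g \<in> carrier G \<Longrightarrow> point (rep g w) = act g (point w)"
  using prod.decode_None_in[of w] act2_in[of g "prod.decode None w"]
  by (simp add: point_def rep_def prod.conj_map_def prod.decode_encode prod.cyl_None) (simp add: act2_def)

lemma point_cont: "\<exists>k. \<forall>w'. (\<forall>i<k. w' i = w i) \<longrightarrow> agree n (point w) (point w')"
proof -
  obtain k where k: "\<forall>w'. (\<forall>i<k. w' i = w i) \<longrightarrow>
      (\<forall>i<Suc n. W2 ((T2 ^^ i) (prod.decode None w')) = W2 ((T2 ^^ i) (prod.decode None w)))"
    using prod.decode_cont[of w "Suc n"] by (rule exE)
  have "agree n (point w) (point w')" if "\<forall>i<k. w' i = w i" for w'
  proof -
    have "\<forall>i<Suc n. W2 ((T2 ^^ i) (prod.decode None w')) = W2 ((T2 ^^ i) (prod.decode None w))"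
      using k that by blast
    then have "agree (n + m) (point w) (point w')"
      unfolding W_Tn_agree by (auto simp: W2_T2 point_def)
    then show ?thesis by (rule agree_mono) simp
  qed
  then show ?thesis by blast
qed

end

end

section \<open>Gromov products and the boundary\<close>

context word_metric
begin

text \<open>Twice the Gromov product at the identity, to stay within the integers.\<close>

definition gp2 :: "'a \<Rightarrow> 'a \<Rightarrow> int" where
  "gp2 x y = int (len x) + int (len y) - int (dd x y)"

definition diverge :: "(nat \<Rightarrow> 'a) \<Rightarrow> (nat \<Rightarrow> 'a) \<Rightarrow> bool" where
  "diverge x y \<longleftrightarrow> (\<forall>M. \<exists>N. \<forall>i\<ge>N. \<forall>j\<ge>N. M \<le> gp2 (x i) (y j))"

definition conv :: "(nat \<Rightarrow> 'a) \<Rightarrow> bool" where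
  "conv x \<longleftrightarrow> (\<forall>i. x i \<in> carrier G) \<and> diverge x x"

lemma gromov_prod_gp2:
  "\<lbrakk>x \<in> carrier G; y \<in> carrier G\<rbrakk> \<Longrightarrow> gromov_prod G S \<one> x y = real_of_int (gp2 x y) / 2"
  by (simp add: gromov_prod_def word_dist_dd gp2_def)

lemma seq_equiv_iff:
  assumes "\<And>i. x i \<in> carrier G" "\<And>i. y i \<in> carrier G"
  shows "(\<forall>M::real. \<exists>N. \<forall>i\<ge>N. \<forall>j\<ge>N. gromov_prod G S \<one> (x i) (y j) \<ge> M) \<longleftrightarrow> diverge x y"
proof
  assume *: "\<forall>M::real. \<exists>N. \<forall>i\<ge>N. \<forall>j\<ge>N. gromov_prod G S \<one> (x i) (y j) \<ge> M"
  show "diverge x y"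
    unfolding diverge_def
  proof
    fix M :: int
    obtain N where "\<forall>i\<ge>N. \<forall>j\<ge>N. gromov_prod G S \<one> (x i) (y j) \<ge> real_of_int M / 2"
      using * by blast
    then show "\<exists>N. \<forall>i\<ge>N. \<forall>j\<ge>N. M \<le> gp2 (x i) (y j)"
      using assms by (intro exI[of _ N]) (simp add: gromov_prod_gp2)
  qed
next
  assume *: "diverge x y"
  show "\<forall>M::real. \<exists>N. \<forall>i\<ge>N. \<forall>j\<ge>N. gromov_prod G S \<one> (x i) (y j) \<ge> M"
  proof
    fix M :: real
    obtain N where N: "\<forall>i\<ge>N. \<forall>j\<ge>N. \<lceil>2 * M\<rceil> \<le> gp2 (x i) (y j)"
      using * unfolding diverge_def by blast
    have "M \<le> gromov_prod G S \<one> (x i) (y j)" if "i \<ge> N" "j \<ge> N" for i j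
      using N[rule_format, OF that] assms by (simp add: gromov_prod_gp2 ceiling_le_iff)
    then show "\<exists>N. \<forall>i\<ge>N. \<forall>j\<ge>N. gromov_prod G S \<one> (x i) (y j) \<ge> M" by blast
  qed
qed

lemma converges_iff: "converges_at_infinity G S x \<longleftrightarrow> conv x"
  unfolding converges_at_infinity_def conv_def using seq_equiv_iff[of x x] by blast

lemma equiv_iff: "\<lbrakk>conv x; conv y\<rbrakk> \<Longrightarrow> seq_equiv G S x y \<longleftrightarrow> diverge x y"
  unfolding seq_equiv_def conv_def using seq_equiv_iff[of x y] by blast

lemma boundary_eq: "gromov_boundary G S = {{y. conv y \<and> diverge x y} | x. conv x}"
proof -
  have "{y. converges_at_infinity G S y \<and> seq_equiv G S x y} = {y. conv y \<and> diverge x y}"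
    if "conv x" for x
    using that by (auto simp: converges_iff equiv_iff)
  then show ?thesis unfolding gromov_boundary_def converges_iff by blast
qed

lemma gp2_le: "\<lbrakk>x \<in> carrier G; y \<in> carrier G\<rbrakk> \<Longrightarrow> gp2 x y \<le> 2 * int (len x)"
  using len_le_dd[of x y] by (simp add: gp2_def)

lemma gp2_sym: "\<lbrakk>x \<in> carrier G; y \<in> carrier G\<rbrakk> \<Longrightarrow> gp2 x y = gp2 y x"
  by (simp add: gp2_def dd_sym)

lemma between_ex:
  assumes "x \<in> carrier G" "y \<in> carrier G" "t \<le> dd x y"
  shows "\<exists>z\<in>carrier G. dd x z = t \<and> dd z y = dd x y - t"
  using assms(3)
proof (induction t)
  case 0
  then show ?case using assms by (intro bexI[of _ x]) auto
next
  case (Suc t)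
  then obtain z where z: "z \<in> carrier G" "dd x z = t" "dd z y = dd x y - t" by auto
  then have "z \<noteq> y" using Suc(2) assms by auto
  then obtain s where s: "s \<in> gens" "Suc (dd (z \<otimes> s) y) = dd z y"
    using dd_step z assms by blast
  have "dd x (z \<otimes> s) \<le> Suc t"
    using dd_tri[of x z "z \<otimes> s"] len_gens[OF s(1)] z s assms by simp
  moreover have "dd x y \<le> dd x (z \<otimes> s) + dd (z \<otimes> s) y"
    using dd_tri[of x "z \<otimes> s" y] z s assms by simp
  ultimately show ?case using z s Suc(2) by (intro bexI[of _ "z \<otimes> s"]) auto
qed

lemma geodesic_ex:
  assumes "x \<in> carrier G" "y \<in> carrier G"
  shows "\<exists>u. u 0 = x \<and> u (dd x y) = y \<and> (\<forall>i\<le>dd x y. u i \<in> carrier G) \<and>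
     (\<forall>i j. i \<le> j \<longrightarrow> j \<le> dd x y \<longrightarrow> dd (u i) (u j) = j - i)"
  using assms
proof (induction "dd x y" arbitrary: x)
  case 0
  then have "x = y" by (intro dd_eq_0) auto
  then show ?case using 0 by (intro exI[of _ "\<lambda>_. x"]) auto
next
  case (Suc n)
  then have "x \<noteq> y" by auto
  then obtain s where s: "s \<in> gens" "Suc (dd (x \<otimes> s) y) = dd x y" using dd_step Suc by metis
  let ?x = "x \<otimes> s"
  have n: "n = dd ?x y" using s Suc(2) by simp
  then obtain u where u: "u 0 = ?x" "u n = y" "\<forall>i\<le>n. u i \<in> carrier G"
     "\<forall>i j. i \<le> j \<longrightarrow> j \<le> n \<longrightarrow> dd (u i) (u j) = j - i"
    using Suc(1)[OF n _ Suc(4)] s(1) Suc(3) unfolding n[symmetric] by (metis gens_in m_closed)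
  have xu: "dd x (u j) = Suc j" if "j \<le> n" for j
  proof -
    have uj: "u j \<in> carrier G" "dd ?x (u j) = j" "dd (u j) y = n - j"
      using u that by (auto simp: u(1)[symmetric] simp flip: u(2))
    then show ?thesis
      using dd_tri[of x ?x "u j"] dd_tri[of x "u j" y] len_gens[OF s(1)] s Suc(2,3,4) that by simp
  qed
  have "dd (case_nat x u i) (case_nat x u j) = j - i" if "i \<le> j" "j \<le> Suc n" for i j
    using that xu u(4) Suc by (cases i; cases j) auto
  then show ?case
    using u Suc(3,4) unfolding Suc(2)[symmetric]
    by (intro exI[of _ "case_nat x u"]) (auto split: nat.splits)
qed

text \<open>Each letter of a word over \<open>S'\<close> costs at most the largest length of a
  generator; adding 1 makes the factor positive.\<close>

lemma len_compare:
  assumes "word_metric G S'"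
  shows "\<exists>A\<ge>1. \<forall>g\<in>carrier G. len g \<le> A * word_length G S' g"
proof -
  interpret W: word_metric G S' by fact
  obtain A where A: "\<forall>n\<in>len ` W.gens. n \<le> A"
    using finite_nat_set_iff_bounded_le W.finite_gens by blast
  have "len (wprod xs) \<le> (A + 1) * length xs" if "set xs \<subseteq> W.gens" for xs
    using that
  proof (induction xs)
    case (Cons x xs)
    have "len (x \<otimes> wprod xs) \<le> len x + len (wprod xs)"
      using Cons W.wprod_closed by (intro len_mult) auto
    moreover have "len x \<le> A" using Cons A by auto
    ultimately show ?case using Cons by auto
  qed simp
  then have "len g \<le> (A + 1) * word_length G S' g" if "g \<in> carrier G" for g
    using that by (metis W.len_ex)
  then show ?thesis by (intro exI[of _ "A + 1"]) simp
qed

end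

section \<open>Limit classes of horofunctions\<close>

context hyperbolic_metric
begin

text \<open>If \<phi> is thought of as the normalised distance to a far point,
  \<open>int (len y) - \<phi> y\<close> is twice the Gromov product of \<open>y\<close> with that
  point. So these are the sequences that converge to the point at infinity of \<phi>.\<close>

definition limit_class :: "('a \<Rightarrow> int) \<Rightarrow> (nat \<Rightarrow> 'a) set" where
  "limit_class \<phi> = {x. (\<forall>i. x i \<in> carrier G) \<and> (\<forall>M. \<exists>N. \<forall>i\<ge>N. M \<le> int (len (x i)) - \<phi> (x i))}"

text \<open>\<open>Hor_four\<close> at the identity is Gromov's inequality through the point at
  infinity.\<close>

lemma Hor_gp2:
  assumes "\<phi> \<in> Hor" "x \<in> carrier G" "y \<in> carrier G"
  shows "gp2 x y \<ge> min (int (len x) - \<phi> x) (int (len y) - \<phi> y) - int D"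
  using Hor_four[OF assms one_closed] Hor_one[OF assms(1)] dd_sym[of x \<one>] dd_sym[of y \<one>] assms
  by (simp add: gp2_def min_def max_def split: if_splits)

lemma limit_class_diverge:
  assumes \<phi>: "\<phi> \<in> Hor" and x: "x \<in> limit_class \<phi>" and y: "y \<in> limit_class \<phi>"
  shows "diverge x y"
  unfolding diverge_def
proof
  fix M :: int
  obtain N1 where N1: "\<forall>i\<ge>N1. M + int D \<le> int (len (x i)) - \<phi> (x i)"
    using x unfolding limit_class_def by blast
  obtain N2 where N2: "\<forall>i\<ge>N2. M + int D \<le> int (len (y i)) - \<phi> (y i)"
    using y unfolding limit_class_def by blast
  have "M \<le> gp2 (x i) (y j)" if "i \<ge> max N1 N2" "j \<ge> max N1 N2" for i j
  proof -
    have "x i \<in> carrier G" "y j \<in> carrier G" using x y by (auto simp: limit_class_def)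
    then have "gp2 (x i) (y j) \<ge> min (int (len (x i)) - \<phi> (x i)) (int (len (y j)) - \<phi> (y j)) - int D"
      by (rule Hor_gp2[OF \<phi>])
    moreover have "M + int D \<le> int (len (x i)) - \<phi> (x i)" "M + int D \<le> int (len (y j)) - \<phi> (y j)"
      using N1 N2 that by auto
    ultimately show ?thesis by linarith
  qed
  then show "\<exists>N. \<forall>i\<ge>N. \<forall>j\<ge>N. M \<le> gp2 (x i) (y j)" by blast
qed

lemma ray_in_limit_class:
  assumes "\<phi> \<in> Hor"
  shows "descent \<phi> \<in> limit_class \<phi>"
proof -
  have "\<exists>N. \<forall>i\<ge>N. M \<le> int (len (descent \<phi> i)) - \<phi> (descent \<phi> i)" for M
    using assms by (intro exI[of _ "nat M"]) (auto simp: len_p phi_p)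
  then show ?thesis using assms by (simp add: limit_class_def)
qed

lemma limit_class_conv: "\<lbrakk>\<phi> \<in> Hor; x \<in> limit_class \<phi>\<rbrakk> \<Longrightarrow> conv x"
  using limit_class_diverge[of \<phi> x x] by (auto simp: conv_def limit_class_def)

lemma limit_class_eq:
  assumes \<phi>: "\<phi> \<in> Hor"
  shows "limit_class \<phi> = {y. conv y \<and> diverge (descent \<phi>) y}"
proof (intro equalityI subsetI CollectI conjI)
  fix y assume "y \<in> limit_class \<phi>"
  then show "conv y" "diverge (descent \<phi>) y"
    using limit_class_conv limit_class_diverge ray_in_limit_class \<phi> by auto
next
  fix y assume "y \<in> {y. conv y \<and> diverge (descent \<phi>) y}"
  then have y: "\<And>i. y i \<in> carrier G" "diverge (descent \<phi>) y" by (auto simp: conv_def)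
  have "\<exists>N. \<forall>i\<ge>N. M \<le> int (len (y i)) - \<phi> (y i)" for M
  proof -
    obtain N where N: "\<forall>i\<ge>N. \<forall>j\<ge>N. M \<le> gp2 (descent \<phi> i) (y j)"
      using y(2) unfolding diverge_def by blast
    have "M \<le> int (len (y i)) - \<phi> (y i)" if "i \<ge> N" for i
    proof -
      have "M \<le> gp2 (descent \<phi> N) (y i)" using N that by blast
      \<comment> \<open>Since \<phi> is \<open>- int N\<close> at the point \<open>N\<close> of the
        path, the Lipschitz bound turns the product with this point into a lower bound for the
        product with infinity.\<close>
      moreover have "\<phi> (y i) \<le> \<phi> (descent \<phi> N) + int (dd (y i) (descent \<phi> N))"
        using Hor_lip \<phi> y(1) by simp
      ultimately show ?thesis
        using \<phi> y(1) dd_sym[of "y i" "descent \<phi> N"] by (simp add: gp2_def len_p phi_p)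
    qed
    then show ?thesis by blast
  qed
  then show "y \<in> limit_class \<phi>" using y(1) by (auto simp: limit_class_def)
qed

text \<open>Translation changes length and horofunction by at most \<open>len g\<close> each, hence
  \<open>2 * int (len g)\<close>; the other inclusion is the same argument for
  \<open>inv g\<close>.\<close>

lemma limit_class_act:
  assumes \<phi>: "\<phi> \<in> Hor" and g: "g \<in> carrier G"
  shows "limit_class (act g \<phi>) = boundary_action G g (limit_class \<phi>)"
proof -
  have key: "(\<lambda>i. g \<otimes> x i) \<in> limit_class (act g \<phi>)" if x: "x \<in> limit_class \<phi>" and \<phi>: "\<phi> \<in> Hor" and g: "g \<in> carrier G" for x g \<phi>
  proof -
    have xc: "x i \<in> carrier G" for i using x by (auto simp: limit_class_def)
    have "\<exists>N. \<forall>i\<ge>N. M \<le> int (len (g \<otimes> x i)) - act g \<phi> (g \<otimes> x i)" for M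
    proof -
      obtain N where N: "\<forall>i\<ge>N. M + 2 * int (len g) \<le> int (len (x i)) - \<phi> (x i)"
        using x unfolding limit_class_def by blast
      have "M \<le> int (len (g \<otimes> x i)) - act g \<phi> (g \<otimes> x i)" if "i \<ge> N" for i
      proof -
        have "len (x i) \<le> len g + len (g \<otimes> x i)"
          using len_mult[of "inv g" "g \<otimes> x i"] g xc by simp
        moreover have "act g \<phi> (g \<otimes> x i) = \<phi> (x i) - \<phi> (inv g)" using g xc by (simp add: act_def)
        moreover have "\<bar>\<phi> (inv g)\<bar> \<le> int (len g)" using Hor_bound[OF \<phi>, of "inv g"] g by simp
        moreover have "M + 2 * int (len g) \<le> int (len (x i)) - \<phi> (x i)" using N that by blast
        ultimately show ?thesis by linarith
      qed
      then show ?thesis by blast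
    qed
    then show ?thesis using g xc by (auto simp: limit_class_def)
  qed
  show ?thesis
    unfolding boundary_action_def
  proof (intro equalityI subsetI)
    fix y assume y: "y \<in> limit_class (act g \<phi>)"
    then have yc: "y i \<in> carrier G" for i by (auto simp: limit_class_def)
    have "(\<lambda>i. inv g \<otimes> y i) \<in> limit_class (act (inv g) (act g \<phi>))"
      using y act_Hor[OF g \<phi>] g by (intro key) auto
    also have "act (inv g) (act g \<phi>) = \<phi>" using g \<phi> by (simp add: act_act act_one)
    finally have "(\<lambda>i. inv g \<otimes> y i) \<in> limit_class \<phi>" .
    moreover have "y = (\<lambda>i. g \<otimes> (inv g \<otimes> y i))" using g yc by simp
    ultimately show "y \<in> (\<lambda>x i. g \<otimes> x i) ` limit_class \<phi>"
      by (intro image_eqI[where x = "\<lambda>i. inv g \<otimes> y i"])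
  qed (use key \<phi> g in auto)
qed

text \<open>Both paths pass through the same point at step \<open>n\<close>, and the route through
  it bounds their distance.\<close>

lemma agree_gp2:
  assumes "\<phi> \<in> Hor" "\<psi> \<in> Hor" "agree n \<phi> \<psi>" "i \<ge> n" "j \<ge> n"
  shows "gp2 (descent \<phi> i) (descent \<psi> j) \<ge> 2 * int n"
proof -
  have eq: "descent \<phi> n = descent \<psi> n" using agree_p[OF assms(3)] by simp
  have "dd (descent \<phi> i) (descent \<psi> j) \<le> dd (descent \<phi> i) (descent \<phi> n) + dd (descent \<phi> n) (descent \<psi> j)"
    using assms by (intro dd_tri) auto
  also have "\<dots> = (i - n) + (j - n)"
    using dd_p[OF assms(1,4)] dd_p[OF assms(2,5)] dd_sym[of "descent \<phi> i" "descent \<phi> n"] assms by (simp add: eq)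
  finally show ?thesis using assms by (simp add: gp2_def len_p)
qed

text \<open>A diagonal argument: on a ball the normalised distances to the \<open>x n\<close> have
  finitely many restrictions, so nested infinite index sets make them constant on ball after ball.
  On each ball \<phi> equals such a distance function for arbitrarily large \<open>n\<close> and
  inherits the clauses of \<open>Hor\<close>.\<close>

lemma cluster_Hor:
  fixes x :: "nat \<Rightarrow> 'a"
  assumes x: "\<And>i. x i \<in> carrier G" and unb: "\<And>k. \<exists>N. \<forall>i\<ge>N. k \<le> len (x i)"
  shows "\<exists>\<phi>\<in>Hor. \<forall>r k. \<exists>n\<ge>k. \<forall>y\<in>carrier G. len y \<le> r \<longrightarrow> \<phi> y = int (dd y (x n)) - int (len (x n))"
proof -
  define f where "f n y = int (dd y (x n)) - int (len (x n))" for n y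
  have fb: "\<bar>f n y\<bar> \<le> int (len y)" if "y \<in> carrier G" for n y
    using len_le_dd[of y "x n"] dd_tri[of y \<one> "x n"] dd_sym[of y \<one>] that x by (simp add: f_def)
  have "\<exists>I :: nat \<Rightarrow> nat set. \<forall>n. infinite (I n) \<and> (I (Suc n) \<subseteq> I n \<and>
      (\<forall>i\<in>I (Suc n). \<forall>j\<in>I (Suc n). \<forall>y\<in>carrier G. len y \<le> n \<longrightarrow> f i y = f j y))"
  proof (rule dependent_nat_choice)
    show "\<exists>A :: nat set. infinite A" by (rule exI[of _ UNIV]) simp
    fix A :: "nat set" and n :: nat assume A: "infinite A"
    let ?B = "{y \<in> carrier G. len y \<le> n}"
    define h where "h i y = (if y \<in> ?B then f i y else 0)" for i y
    have "h ` A \<subseteq> {f. \<forall>y. (y \<in> ?B \<longrightarrow> f y \<in> {- int n..int n}) \<and> (y \<notin> ?B \<longrightarrow> f y = 0)}"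
    proof
      fix z assume "z \<in> h ` A"
      then obtain i where i: "z = h i" by blast
      have "\<bar>f i y\<bar> \<le> int n" if "y \<in> ?B" for y using fb[of y i] that by auto
      then show "z \<in> {f. \<forall>y. (y \<in> ?B \<longrightarrow> f y \<in> {- int n..int n}) \<and> (y \<notin> ?B \<longrightarrow> f y = 0)}"
        unfolding i h_def by (auto simp: abs_le_iff minus_le_iff)
    qed
    moreover have "finite {f. \<forall>y. (y \<in> ?B \<longrightarrow> f y \<in> {- int n..int n}) \<and> (y \<notin> ?B \<longrightarrow> f y = 0)}"
      by (intro finite_set_of_finite_funs finite_ball) simp
    ultimately have "finite (h ` A)" by (rule finite_subset)
    then obtain a where a: "infinite {b \<in> A. h b = h a}" using pigeonhole_infinite[OF A] by blast
    have "f i y = f j y" if "h i = h a" "h j = h a" "y \<in> carrier G" "len y \<le> n" for i j y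
    proof -
      have "h i y = h j y" using that(1,2) by simp
      then show ?thesis using that(3,4) by (simp add: h_def)
    qed
    then have "\<forall>i\<in>{b \<in> A. h b = h a}. \<forall>j\<in>{b \<in> A. h b = h a}. \<forall>y\<in>carrier G.
        len y \<le> n \<longrightarrow> f i y = f j y"
      by blast
    then show "\<exists>B. infinite B \<and> (B \<subseteq> A \<and> (\<forall>i\<in>B. \<forall>j\<in>B. \<forall>y\<in>carrier G. len y \<le> n \<longrightarrow> f i y = f j y))"
      using a by (intro exI[of _ "{b \<in> A. h b = h a}"] conjI) blast+
  qed
  then obtain I :: "nat \<Rightarrow> nat set" where I0: "\<forall>n. infinite (I n) \<and> (I (Suc n) \<subseteq> I n \<and>
      (\<forall>i\<in>I (Suc n). \<forall>j\<in>I (Suc n). \<forall>y\<in>carrier G. len y \<le> n \<longrightarrow> f i y = f j y))"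
    by (rule exE)
  have I: "infinite (I n)" "I (Suc n) \<subseteq> I n" for n
    using spec[OF I0, of n] by (simp_all only: simp_thms)
  have I_eq: "f i y = f j y" if "i \<in> I (Suc n)" "j \<in> I (Suc n)" "y \<in> carrier G" "len y \<le> n" for n i j y
    using spec[OF I0, of n] that by blast
  have mono: "I b \<subseteq> I a" if "a \<le> b" for a b
    using that by (rule lift_Suc_antimono_le[of I, OF I(2)])
  define \<phi> where "\<phi> y = (if y \<in> carrier G then f (SOME i. i \<in> I (Suc (len y))) y else 0)" for y
  have \<phi>: "\<phi> y = f n y" if "n \<in> I (Suc r)" "y \<in> carrier G" "len y \<le> r" for n r y
  proof -
    have "n \<in> I (Suc (len y))" using mono[of "Suc (len y)" "Suc r"] that by auto
    then have "(SOME i. i \<in> I (Suc (len y))) \<in> I (Suc (len y))" by (rule someI)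
    then show ?thesis
      using I_eq[OF _ \<open>n \<in> I (Suc (len y))\<close> that(2) order.refl] that(2) unfolding \<phi>_def by presburger
  qed
  have cl: "\<exists>n\<ge>k. \<forall>y\<in>carrier G. len y \<le> r \<longrightarrow> \<phi> y = f n y" for r k
  proof -
    obtain n where "n \<in> I (Suc r)" "n \<ge> k"
      using I(1)[of "Suc r"] by (meson infinite_nat_iff_unbounded_le)
    then show ?thesis using \<phi> by blast
  qed
  have "\<phi> \<in> Hor"
    unfolding Hor_def
  proof (intro CollectI conjI allI ballI impI)
    show "\<phi> \<one> = 0" using cl[of 0 0] x by (auto simp: f_def)
    show "\<phi> y = 0" if "y \<notin> carrier G" for y using that by (simp add: \<phi>_def)
    fix a assume a: "a \<in> carrier G"
    show "\<exists>s\<in>gens. \<phi> (a \<otimes> s) = \<phi> a - 1"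
    proof -
      \<comment> \<open>Here \<open>x n\<close> has to be far away: a step from \<open>a\<close>
        towards \<open>x n\<close> exists only if they differ.\<close>
      obtain N where N: "\<forall>i\<ge>N. Suc (len a) \<le> len (x i)" using unb by blast
      obtain n where n: "n \<ge> N" "\<forall>y\<in>carrier G. len y \<le> Suc (len a) \<longrightarrow> \<phi> y = f n y" using cl by blast
      have "a \<noteq> x n" using N n(1) by (metis Suc_n_not_le_n)
      then obtain s where s: "s \<in> gens" "Suc (dd (a \<otimes> s) (x n)) = dd a (x n)"
        using dd_step a x by blast
      have "len (a \<otimes> s) \<le> Suc (len a)" using len_mult[of a s] len_gens[OF s(1)] a s by simp
      then have "\<phi> (a \<otimes> s) = f n (a \<otimes> s)" "\<phi> a = f n a" using n(2) a s by auto
      then show ?thesis using s by (intro bexI[of _ s]) (auto simp: f_def)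
    qed
    fix b assume b: "b \<in> carrier G"
    show "\<phi> a \<le> \<phi> b + int (dd a b)"
    proof -
      obtain n where n: "\<forall>y\<in>carrier G. len y \<le> len a + len b \<longrightarrow> \<phi> y = f n y" using cl by blast
      then have "\<phi> a = f n a" "\<phi> b = f n b" using a b by auto
      then show ?thesis using dd_tri[of a b "x n"] a b x by (simp add: f_def)
    qed
    fix w assume w: "w \<in> carrier G"
    show "int (dd a b) + \<phi> w \<le> max (\<phi> a + int (dd b w)) (\<phi> b + int (dd a w)) + int D"
    proof -
      obtain n where n: "\<forall>y\<in>carrier G. len y \<le> len a + len b + len w \<longrightarrow> \<phi> y = f n y" using cl by blast
      then have "\<phi> a = f n a" "\<phi> b = f n b" "\<phi> w = f n w" using a b w by auto
      then show ?thesis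
        using four_point[of a b w "x n"] a b w x by (simp add: f_def max_def split: if_splits)
    qed
  qed
  then show ?thesis using cl unfolding f_def by blast
qed

lemma Hor_nonempty:
  assumes "infinite (carrier G)"
  shows "Hor \<noteq> {}"
proof -
  have "\<exists>g\<in>carrier G. n \<le> len g" for n
  proof (rule ccontr)
    assume "\<not> (\<exists>g\<in>carrier G. n \<le> len g)"
    then have "carrier G \<subseteq> {g \<in> carrier G. len g \<le> n}" by force
    then show False using finite_ball[of n] assms finite_subset by blast
  qed
  then obtain x where x: "\<And>n. x n \<in> carrier G" "\<And>n. n \<le> len (x n)" by metis
  have ex: "\<exists>N. \<forall>i\<ge>N. k \<le> len (x i)" for k using x(2) le_trans by blast
  obtain \<phi> where "\<phi> \<in> Hor" by (rule bexE[OF cluster_Hor[OF x(1) ex]])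
  then show ?thesis by blast
qed

text \<open>For a cluster function \<phi> of \<open>x\<close>, the quantity
  \<open>int (len (y i)) - \<phi> (y i)\<close> is the product \<open>gp2 (x n) (y i)\<close> for
  some late \<open>n\<close>.\<close>

lemma limit_class_surj:
  assumes "conv x"
  shows "\<exists>\<phi>\<in>Hor. limit_class \<phi> = {y. conv y \<and> diverge x y}"
proof -
  have x: "\<And>i. x i \<in> carrier G" "diverge x x" using assms by (auto simp: conv_def)
  have ex: "\<exists>N. \<forall>i\<ge>N. k \<le> len (x i)" for k
  proof -
    obtain N where N: "\<forall>i\<ge>N. \<forall>j\<ge>N. 2 * int k \<le> gp2 (x i) (x j)"
      using x(2) unfolding diverge_def by blast
    have "k \<le> len (x i)" if "i \<ge> N" for i
      using N[rule_format, OF that that] gp2_le[OF x(1) x(1), of i i] by linarith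
    then show ?thesis by blast
  qed
  obtain \<phi> where \<phi>: "\<phi> \<in> Hor" and cl: "\<forall>r k. \<exists>n\<ge>k. \<forall>y\<in>carrier G. len y \<le> r \<longrightarrow>
      \<phi> y = int (dd y (x n)) - int (len (x n))"
    by (rule bexE[OF cluster_Hor[OF x(1) ex]])
  have key: "y \<in> limit_class \<phi>" if y0: "conv y" "diverge x y" for y
  proof -
    have y: "\<And>i. y i \<in> carrier G" using that by (auto simp: conv_def)
    have "\<exists>N. \<forall>i\<ge>N. M \<le> int (len (y i)) - \<phi> (y i)" for M
    proof -
      obtain N where N: "\<forall>i\<ge>N. \<forall>j\<ge>N. M \<le> gp2 (x i) (y j)"
        using y0(2) unfolding diverge_def by blast
      have "M \<le> int (len (y i)) - \<phi> (y i)" if i: "i \<ge> N" for i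
      proof -
        obtain n where n: "n \<ge> N" "\<phi> (y i) = int (dd (y i) (x n)) - int (len (x n))"
          using spec[OF spec[OF cl, of "len (y i)"], of N] y by blast
        then show ?thesis using N[rule_format, OF n(1) i] dd_sym[OF x(1)[of n] y[of i]]
          by (simp add: gp2_def)
      qed
      then show ?thesis by blast
    qed
    then show ?thesis using y by (auto simp: limit_class_def)
  qed
  have "limit_class \<phi> = {y. conv y \<and> diverge x y}"
    using key limit_class_conv[OF \<phi>] limit_class_diverge[OF \<phi> key[OF assms x(2)]] by blast
  then show ?thesis using \<phi> by blast
qed

section \<open>Independence of the generating set\<close>

text \<open>Twice the Gromov product with base point \<open>w\<close>.\<close>

definition gpw :: "'a \<Rightarrow> 'a \<Rightarrow> 'a \<Rightarrow> int" where
  "gpw w x y = int (dd w x) + int (dd w y) - int (dd x y)"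

lemma gpw_four:
  assumes "w \<in> carrier G" "x \<in> carrier G" "y \<in> carrier G" "z \<in> carrier G"
  shows "gpw w x y \<ge> min (gpw w x z) (gpw w z y) - int D"
  using four_point[OF assms(2,3,4,1)] assms
  by (simp add: gpw_def dd_sym min_def max_def split: if_splits)

lemma gpw_sym: "\<lbrakk>x \<in> carrier G; y \<in> carrier G\<rbrakk> \<Longrightarrow> gpw w x y = gpw w y x"
  by (simp add: gpw_def dd_sym)

lemma gpw_one: "\<lbrakk>x \<in> carrier G; y \<in> carrier G\<rbrakk> \<Longrightarrow> gpw \<one> x y = gp2 x y"
  by (simp add: gpw_def gp2_def)

text \<open>Bisecting a chain of \<open>n\<close> points costs only \<open>log n\<close> applications of the four-point condition.\<close>

lemma gpw_chain:
  assumes "w \<in> carrier G"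
  shows "\<lbrakk>0 < n; n \<le> 2 ^ k; \<And>i. i \<le> n \<Longrightarrow> u i \<in> carrier G;
     \<And>i. i < n \<Longrightarrow> c \<le> gpw w (u i) (u (Suc i))\<rbrakk> \<Longrightarrow> c - int k * int D \<le> gpw w (u 0) (u n)"
proof (induction k arbitrary: n u)
  case 0
  then have "n = 1" by simp
  then show ?case using 0(4)[of 0] by simp
next
  case (Suc k)
  show ?case
  proof (cases "n \<le> 2 ^ k")
    case True
    then have "c - int k * int D \<le> gpw w (u 0) (u n)" using Suc by blast
    then show ?thesis by (simp add: algebra_simps)
  next
    case False
    let ?l = "2 ^ k :: nat"
    have "c - int k * int D \<le> gpw w (u 0) (u ?l)"
      using Suc(4,5) False by (intro Suc(1)) auto
    moreover have "c - int k * int D \<le> gpw w (u (?l + 0)) (u (?l + (n - ?l)))"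
      using Suc(3,4,5) False by (intro Suc(1)[of "n - ?l" "\<lambda>i. u (?l + i)"]) auto
    then have "c - int k * int D \<le> gpw w (u ?l) (u n)" using False by simp
    moreover have "min (gpw w (u 0) (u ?l)) (gpw w (u ?l) (u n)) - int D \<le> gpw w (u 0) (u n)"
      using Suc(4) False assms by (intro gpw_four) auto
    ultimately show ?thesis by (simp add: algebra_simps min_def split: if_splits)
  qed
qed

end

section \<open>Exponential against linear growth\<close>

lemma exp_beats_linear:
  fixes c k :: nat
  assumes "2 * c + 1 \<le> k"
  shows "c * (k + 1) \<le> 2 ^ k"
  using assms
proof (induction k rule: dec_induct)
  case base
  have "c < 2 ^ c" by (rule less_exp)
  then have c: "c + 1 \<le> 2 ^ c" by linarith
  have "c * (2 * c + 1 + 1) \<le> 2 * ((c + 1) * (c + 1))" by (simp add: algebra_simps)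
  also have "\<dots> \<le> 2 * (2 ^ c * 2 ^ c)" using c by (intro mult_le_mono) auto
  also have "\<dots> = 2 ^ (2 * c + 1)" by (simp add: power_add mult_2)
  finally show ?case .
next
  case (step k)
  have "c \<le> c * (k + 1)" by simp
  then have "c * (Suc k + 1) \<le> 2 * (c * (k + 1))" by (simp add: algebra_simps)
  then show ?case using step(3) by simp
qed

text \<open>The hypothesis bounds \<open>M\<close> by a multiple of its logarithm. Testing it at
  \<open>k = M div (d + 1)\<close> keeps \<open>k * d\<close> at most \<open>M\<close>, while
  \<open>2 ^ k\<close> exceeds \<open>b * M\<close> for large \<open>M\<close>; so \<open>M\<close>
  is at most \<open>a + 2 * d\<close>, which fails for large \<open>M\<close>.\<close>

lemma log_bound:
  fixes a b d :: nat
  shows "\<exists>K. \<forall>M. (\<forall>k. b * M \<le> 2 ^ k \<longrightarrow> 2 * M \<le> a + (k + 2) * d) \<longrightarrow> M \<le> K"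
proof -
  let ?c = "b * (d + 1)"
  define K where "K = (2 * ?c + 1) * (d + 1) + a + 2 * d"
  have "M \<le> K" if M: "\<forall>k. b * M \<le> 2 ^ k \<longrightarrow> 2 * M \<le> a + (k + 2) * d" for M
  proof (rule ccontr)
    assume "\<not> M \<le> K"
    then have MK: "(2 * ?c + 1) * (d + 1) \<le> M" "a + 2 * d < M" by (auto simp: K_def)
    define k where "k = M div (d + 1)"
    have "2 * ?c + 1 \<le> k"
      unfolding k_def using MK(1) by (simp add: less_eq_div_iff_mult_less_eq)
    then have "?c * (k + 1) \<le> 2 ^ k" by (rule exp_beats_linear)
    moreover have "M \<le> (d + 1) * (k + 1)"
      using dividend_less_div_times[of "d + 1" M] by (simp add: k_def algebra_simps)
    then have "b * M \<le> b * ((d + 1) * (k + 1))" by (rule mult_le_mono2)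
    ultimately have "b * M \<le> 2 ^ k" by (simp only: mult.assoc)
    then have "2 * M \<le> a + (k + 2) * d" using M by blast
    moreover have "k * (d + 1) \<le> M" unfolding k_def by (rule div_times_less_eq_dividend)
    then have "k * d \<le> M" by simp
    ultimately show False using MK(2) by simp
  qed
  then show ?thesis by blast
qed

text \<open>The four-point condition is assumed for \<open>S'\<close> alone. Geodesics for
  \<open>S\<close> are quasi-geodesics in the hyperbolic metric, and their stability carries the
  comparison.\<close>

locale two_metrics = H: hyperbolic_metric G S' D + V: word_metric G S
  for G (structure) and S' S :: "'a set" and D :: nat
begin

definition A :: nat where
  "A = (SOME A. A \<ge> 1 \<and> (\<forall>g\<in>carrier G. H.len g \<le> A * V.len g \<and> V.len g \<le> A * H.len g))"

lemma A_props: "A \<ge> 1" "g \<in> carrier G \<Longrightarrow> H.len g \<le> A * V.len g" "g \<in> carrier G \<Longrightarrow> V.len g \<le> A * H.len g"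
proof -
  obtain A1 where A1: "A1 \<ge> 1" "\<forall>g\<in>carrier G. H.len g \<le> A1 * V.len g"
    using H.len_compare[OF V.word_metric_axioms] by blast
  obtain A2 where A2: "A2 \<ge> 1" "\<forall>g\<in>carrier G. V.len g \<le> A2 * H.len g"
    using V.len_compare[OF H.word_metric_axioms] by blast
  have "H.len g \<le> (A1 + A2) * V.len g \<and> V.len g \<le> (A1 + A2) * H.len g" if "g \<in> carrier G" for g
    using A1(2)[rule_format, OF that] A2(2)[rule_format, OF that] by (simp add: add_mult_distrib)
  then have "\<exists>A. A \<ge> 1 \<and> (\<forall>g\<in>carrier G. H.len g \<le> A * V.len g \<and> V.len g \<le> A * H.len g)"
    using A1(1) by (intro exI[of _ "A1 + A2"]) auto
  then have "A \<ge> 1 \<and> (\<forall>g\<in>carrier G. H.len g \<le> A * V.len g \<and> V.len g \<le> A * H.len g)"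
    unfolding A_def by (rule someI_ex)
  then show "A \<ge> 1" "g \<in> carrier G \<Longrightarrow> H.len g \<le> A * V.len g" "g \<in> carrier G \<Longrightarrow> V.len g \<le> A * H.len g"
    by auto
qed

lemma dd_compare:
  assumes "x \<in> carrier G" "y \<in> carrier G"
  shows "H.dd x y \<le> A * V.dd x y" "V.dd x y \<le> A * H.dd x y"
  using A_props(2,3)[of "inv x \<otimes> y"] assms by (auto simp: H.dd_def V.dd_def)

text \<open>Let \<open>q\<close> be a point of a geodesic (for the hyperbolic metric) that is farthest, at distance
  \<open>M\<close>, from a geodesic \<open>u\<close> of the other metric. A detour around \<open>q\<close> at distance about \<open>M\<close> has length
  linear in \<open>M\<close>, while bisection shows that its length is exponential in \<open>M\<close>.\<close>

lemma fellow_travel_bound: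
  assumes u: "\<And>i. i \<le> n \<Longrightarrow> u i \<in> carrier G"
    and geo: "\<And>i j. \<lbrakk>i \<le> j; j \<le> n\<rbrakk> \<Longrightarrow> V.dd (u i) (u j) = j - i"
    and q: "q \<in> carrier G" "H.dd (u 0) q + H.dd q (u n) = H.dd (u 0) (u n)"
    and far: "\<And>i. i \<le> n \<Longrightarrow> M \<le> H.dd q (u i)"
    and max: "\<And>z. \<lbrakk>z \<in> carrier G; H.dd (u 0) z + H.dd z (u n) = H.dd (u 0) (u n)\<rbrakk>
        \<Longrightarrow> \<exists>i\<le>n. H.dd z (u i) \<le> M"
    and k: "6 * A * M \<le> 2 ^ k"
  shows "2 * M \<le> A + (k + 2) * D"
proof -
  have uc: "u 0 \<in> carrier G" "u n \<in> carrier G" using u by auto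
  \<comment> \<open>The detour leaves and rejoins the geodesic at distance \<open>2 * M\<close> from
    \<open>q\<close>, or at an endpoint if that is nearer.\<close>
  define e1 where "e1 = min (2 * M) (H.dd q (u 0))"
  define e2 where "e2 = min (2 * M) (H.dd q (u n))"
  have e: "e1 \<le> 2 * M" "e2 \<le> 2 * M" by (auto simp: e1_def e2_def)
  obtain p1 where p1: "p1 \<in> carrier G" "H.dd q p1 = e1" "H.dd p1 (u 0) + e1 = H.dd q (u 0)"
    using H.between_ex[OF q(1) uc(1), of e1] by (auto simp: e1_def)
  obtain p2 where p2: "p2 \<in> carrier G" "H.dd q p2 = e2" "H.dd p2 (u n) + e2 = H.dd q (u n)"
    using H.between_ex[OF q(1) uc(2), of e2] by (auto simp: e2_def)
  note sym = H.dd_sym[OF q(1) uc(1)] H.dd_sym[OF q(1) p1(1)] H.dd_sym[OF p1(1) uc(1)]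
  have l1: "H.dd (u 0) p1 + H.dd p1 (u n) = H.dd (u 0) (u n)"
    using H.dd_tri[OF uc(1) p1(1) uc(2)] H.dd_tri[OF p1(1) q(1) uc(2)] p1 q(2) sym by linarith
  have l2: "H.dd (u 0) p2 + H.dd p2 (u n) = H.dd (u 0) (u n)"
    using H.dd_tri[OF uc(1) p2(1) uc(2)] H.dd_tri[OF uc(1) q(1) p2(1)] p2 q(2) by linarith
  \<comment> \<open>\<open>q\<close> lies between \<open>p1\<close> and \<open>p2\<close>, so their
    Gromov product based at \<open>q\<close> vanishes.\<close>
  have l12: "H.dd p1 p2 = H.dd q p1 + H.dd q p2"
  proof (rule antisym)
    show "H.dd p1 p2 \<le> H.dd q p1 + H.dd q p2" using H.dd_tri[OF p1(1) q(1) p2(1)] sym by linarith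
    show "H.dd q p1 + H.dd q p2 \<le> H.dd p1 p2"
      using H.dd_tri[OF uc(1) p1(1) uc(2)] H.dd_tri[OF p1(1) p2(1) uc(2)] p1 p2 q(2) sym by linarith
  qed
  have near: "\<exists>a\<le>n. H.dd z (u a) \<le> M \<and> 2 * int M \<le> H.gpw q z (u a)"
    if z: "z \<in> carrier G" "H.dd (u 0) z + H.dd z (u n) = H.dd (u 0) (u n)"
      and e: "l = 0 \<or> l = n" and ze: "H.dd q z = min (2 * M) (H.dd q (u l))"
        "H.dd z (u l) + H.dd q z = H.dd q (u l)" for z l
  proof (cases "H.dd q (u l) \<le> 2 * M")
    case True
    have ue: "u l \<in> carrier G" "l \<le> n" using e uc by auto
    have "H.dd z (u l) = 0" using ze True by simp
    then have "z = u l" by (rule H.dd_eq_0[OF z(1) ue(1)])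
    then show ?thesis using far[OF ue(2)] ue by (intro exI[of _ l]) (auto simp: H.gpw_def)
  next
    case False
    \<comment> \<open>By maximality \<open>u\<close> comes within \<open>M\<close> of
      \<open>z\<close>; the product based at \<open>q\<close> is then at least
      \<open>2 * M + M - M\<close>.\<close>
    obtain a where a: "a \<le> n" "H.dd z (u a) \<le> M" using max[OF z] by blast
    have "H.dd q z = 2 * M" using ze(1) False by simp
    then have "2 * int M \<le> H.gpw q z (u a)" using far[OF a(1)] a(2) by (simp add: H.gpw_def)
    then show ?thesis using a by blast
  qed
  obtain a where a: "a \<le> n" "H.dd p1 (u a) \<le> M" "2 * int M \<le> H.gpw q p1 (u a)"
    using near[OF p1(1) l1, of 0] p1(2,3) unfolding e1_def by auto
  obtain b where b: "b \<le> n" "H.dd p2 (u b) \<le> M" "2 * int M \<le> H.gpw q p2 (u b)"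
    using near[OF p2(1) l2, of n] p2(2,3) unfolding e2_def by auto
  have ua: "u a \<in> carrier G" and ub: "u b \<in> carrier G" using u a b by auto
  have "H.dd (u a) (u b) \<le> H.dd (u a) p1 + (H.dd p1 p2 + H.dd p2 (u b))"
    using H.dd_tri[OF ua p1(1) ub] H.dd_tri[OF p1(1) p2(1) ub] by linarith
  \<comment> \<open>Two connections of length at most \<open>M\<close> and a segment through
    \<open>q\<close> of length at most \<open>4 * M\<close>.\<close>
  also have "\<dots> \<le> 6 * M" using a b p1(2) p2(2) e l12 H.dd_sym[OF ua p1(1)] by linarith
  finally have ab6: "H.dd (u a) (u b) \<le> 6 * M" .
  have "V.dd (u a) (u b) \<le> A * (6 * M)"
    using dd_compare(2)[OF ua ub] mult_le_mono2[OF ab6, of A] by linarith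
  then have ab: "V.dd (u a) (u b) \<le> 2 ^ k" using k by (simp add: mult.commute mult.left_commute)
  have chain: "2 * int M - int A - int k * int D \<le> H.gpw q (u a') (u b')"
    if ab': "a' \<le> b'" "b' \<le> n" "V.dd (u a') (u b') \<le> 2 ^ k" for a' b'
  proof (cases "a' = b'")
    case True
    then have "2 * int M \<le> H.gpw q (u a') (u b')"
      using far[of a'] ab' u by (simp add: H.gpw_def)
    moreover have "0 \<le> int k * int D" by simp
    ultimately show ?thesis by linarith
  next
    case False
    \<comment> \<open>Neighbours on \<open>u\<close> are at most \<open>A\<close> apart and at least
      \<open>M\<close> away from \<open>q\<close>.\<close>
    have "2 * int M - int A \<le> H.gpw q (u i) (u (Suc i))" if "Suc i \<le> n" for i
    proof -
      have "H.dd (u i) (u (Suc i)) \<le> A"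
        using dd_compare(1)[of "u i" "u (Suc i)"] geo[of i "Suc i"] that u by simp
      then show ?thesis using far[of i] far[of "Suc i"] that by (simp add: H.gpw_def)
    qed
    then have "2 * int M - int A - int k * int D \<le> H.gpw q (u (a' + 0)) (u (a' + (b' - a')))"
      using False ab' geo[OF ab'(1,2)] u q(1)
      by (intro H.gpw_chain[of q "b' - a'" k "\<lambda>i. u (a' + i)"]) auto
    then show ?thesis using ab'(1) by simp
  qed
  have gab: "2 * int M - int A - int k * int D \<le> H.gpw q (u a) (u b)"
  proof (cases "a \<le> b")
    case True
    then show ?thesis using chain[OF True b(1) ab] by simp
  next
    case False
    then show ?thesis
      using chain[of b a] a(1) ab V.dd_sym[OF ua ub] H.gpw_sym[OF ua ub] by simp
  qed
  \<comment> \<open>This zero is bounded below by the product along \<open>u\<close>, at the cost of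
    two more errors \<open>D\<close> for passing from \<open>p1\<close> and \<open>p2\<close> to
    \<open>u\<close>.\<close>
  have "H.gpw q p1 p2 = 0" using l12 by (simp add: H.gpw_def)
  moreover have "min (H.gpw q p1 (u a)) (H.gpw q (u a) p2) - int D \<le> H.gpw q p1 p2"
    by (rule H.gpw_four[OF q(1) p1(1) p2(1) ua])
  moreover have "min (H.gpw q (u a) (u b)) (H.gpw q (u b) p2) - int D \<le> H.gpw q (u a) p2"
    by (rule H.gpw_four[OF q(1) ua p2(1) ub])
  moreover have "2 * int M \<le> H.gpw q (u b) p2" using b(3) H.gpw_sym[OF p2(1) ub] by simp
  moreover have "0 \<le> int k * int D" by simp
  ultimately have "2 * int M \<le> int A + int k * int D + 2 * int D"
    using gab a(3) by linarith
  then have "int (2 * M) \<le> int (A + (k + 2) * D)" by (simp add: algebra_simps)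
  then show ?thesis by (simp only: of_nat_le_iff)
qed

text \<open>A point farthest from \<open>u\<close> exists because the distances to \<open>u\<close>
  are at most \<open>H.dd x y\<close>; \<open>fellow_travel_bound\<close> for all \<open>k\<close>
  together with \<open>log_bound\<close> then bounds its distance independently of the
  endpoints.\<close>

lemma fellow_travel:
  "\<exists>K. \<forall>x\<in>carrier G. \<forall>y\<in>carrier G. \<forall>z\<in>carrier G. H.dd x z + H.dd z y = H.dd x y \<longrightarrow>
     (\<exists>a\<in>carrier G. V.dd x a + V.dd a y = V.dd x y \<and> H.dd z a \<le> K)"
proof -
  obtain K where K: "\<forall>M. (\<forall>k. 6 * A * M \<le> 2 ^ k \<longrightarrow> 2 * M \<le> A + (k + 2) * D) \<longrightarrow> M \<le> K"
    using log_bound[of "6 * A" A D] by blast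
  have "\<exists>a\<in>carrier G. V.dd x a + V.dd a y = V.dd x y \<and> H.dd z a \<le> K"
    if x: "x \<in> carrier G" and y: "y \<in> carrier G" and z: "z \<in> carrier G" "H.dd x z + H.dd z y = H.dd x y"
    for x y z
  proof -
    define n where "n = V.dd x y"
    obtain u where u: "u 0 = x" "u n = y" "\<And>i. i \<le> n \<Longrightarrow> u i \<in> carrier G"
      "\<And>i j. \<lbrakk>i \<le> j; j \<le> n\<rbrakk> \<Longrightarrow> V.dd (u i) (u j) = j - i"
      using V.geodesic_ex[OF x y] unfolding n_def by blast
    define I where "I = {q \<in> carrier G. H.dd x q + H.dd q y = H.dd x y}"
    define ds where "ds q = Min ((\<lambda>i. H.dd q (u i)) ` {..n})" for q
    have ds_le: "ds q \<le> H.dd q (u i)" if "i \<le> n" for q i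
      unfolding ds_def using that by (intro Min_le) auto
    have ds_ex: "\<exists>i\<le>n. H.dd q (u i) = ds q" for q
    proof -
      have "ds q \<in> (\<lambda>i. H.dd q (u i)) ` {..n}" unfolding ds_def by (intro Min_in) auto
      then show ?thesis by auto
    qed
    have zI: "z \<in> I" using z by (simp add: I_def)
    have bnd: "\<forall>q. q \<in> I \<longrightarrow> ds q < Suc (H.dd x y)"
    proof (intro allI impI)
      fix r assume "r \<in> I"
      then have r: "r \<in> carrier G" "H.dd x r \<le> H.dd x y" by (auto simp: I_def)
      have "ds r \<le> H.dd r x" using ds_le[of 0 r] u(1) by simp
      then show "ds r < Suc (H.dd x y)" using r H.dd_sym[OF x r(1)] by linarith
    qed
    have "\<exists>q. q \<in> I \<and> (\<forall>r. r \<in> I \<longrightarrow> ds r \<le> ds q)"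
      by (rule ex_has_greatest_nat[OF zI bnd])
    then obtain q where q: "q \<in> I" "\<forall>r. r \<in> I \<longrightarrow> ds r \<le> ds q" by (elim exE conjE)
    have "2 * ds q \<le> A + (k + 2) * D" if "6 * A * ds q \<le> 2 ^ k" for k
    proof (rule fellow_travel_bound[of n u q])
      show "\<exists>i\<le>n. H.dd r (u i) \<le> ds q"
        if "r \<in> carrier G" "H.dd (u 0) r + H.dd r (u n) = H.dd (u 0) (u n)" for r
      proof -
        have "r \<in> I" using that u(1,2) by (simp add: I_def)
        then have "ds r \<le> ds q" using q(2) by blast
        then show ?thesis using ds_ex[of r] by auto
      qed
    qed (use u q that ds_le in \<open>auto simp: I_def\<close>)
    then have "ds q \<le> K" using K by blast
    then have "ds z \<le> K" using q(2) zI le_trans by blast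
    then obtain i where i: "i \<le> n" "H.dd z (u i) \<le> K" using ds_ex[of z] by auto
    have "V.dd x (u i) + V.dd (u i) y = V.dd x y"
      using u(4)[of 0 i] u(4)[of i n] i(1) u(1,2) by (simp add: n_def)
    then show ?thesis using i u(3) by blast
  qed
  then show ?thesis by blast
qed

text \<open>For a large product, the points at distance \<open>t\<close> from the identity on
  geodesics to \<open>x\<close> and \<open>y\<close> are close together. So are their shadows
  \<open>a\<close> and \<open>b\<close> on geodesics of the other metric, which lie far out and thus
  force its product to be large.\<close>

lemma gp2_forward: "\<exists>M'. \<forall>x\<in>carrier G. \<forall>y\<in>carrier G. M' \<le> H.gp2 x y \<longrightarrow> M \<le> V.gp2 x y"
proof -
  obtain K where K: "\<And>x y z. \<lbrakk>x \<in> carrier G; y \<in> carrier G; z \<in> carrier G; H.dd x z + H.dd z y = H.dd x y\<rbrakk>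
     \<Longrightarrow> \<exists>a\<in>carrier G. V.dd x a + V.dd a y = V.dd x y \<and> H.dd z a \<le> K"
    using fellow_travel by blast
  \<comment> \<open>\<open>L\<close> is the length wanted for the shadows in the metric of
    \<open>S\<close>; \<open>t\<close> secures it despite the error \<open>K\<close> and the factor
    \<open>A\<close>.\<close>
  define L where "L = nat M + A * (2 * K + 2 * D)"
  define t where "t = A * L + K"
  have "M \<le> V.gp2 x y" if x: "x \<in> carrier G" and y: "y \<in> carrier G" and big: "2 * int t \<le> H.gp2 x y" for x y
  proof -
    have tx: "t \<le> H.len x" using H.gp2_le[OF x y] big by simp
    have ty: "t \<le> H.len y" using H.gp2_le[OF y x] H.gp2_sym[OF x y] big by simp
    have pt: "\<exists>v\<in>carrier G. H.len v = t \<and> 2 * int t \<le> H.gp2 v x \<and>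
        (\<exists>a\<in>carrier G. V.len a + V.dd a x = V.len x \<and> H.dd v a \<le> K \<and> L \<le> V.len a)"
      if x: "x \<in> carrier G" and tx: "t \<le> H.len x" for x
    proof -
      obtain v where v: "v \<in> carrier G" "H.len v = t" "H.dd v x = H.len x - t"
        using H.between_ex[of \<one> x t] x tx by auto
      obtain a where a: "a \<in> carrier G" "V.len a + V.dd a x = V.len x" "H.dd v a \<le> K"
        using K[of \<one> x v] v x tx by auto
      have "t \<le> H.len a + K" using H.len_le_dd[OF a(1) v(1)] a(3) v H.dd_sym[OF v(1) a(1)] by simp
      then have "A * L \<le> H.len a" by (simp add: t_def)
      then have "A * L \<le> A * V.len a" using A_props(2)[OF a(1)] by linarith
      then have "L \<le> V.len a" using A_props(1) by simp
      moreover have "2 * int t \<le> H.gp2 v x" using v tx by (simp add: H.gp2_def)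
      ultimately show ?thesis using v a by blast
    qed
    obtain v a where v: "v \<in> carrier G" "H.len v = t" "2 * int t \<le> H.gp2 v x"
      and a: "a \<in> carrier G" "V.len a + V.dd a x = V.len x" "H.dd v a \<le> K" "L \<le> V.len a"
      using pt[OF x tx] by blast
    obtain w b where w: "w \<in> carrier G" "H.len w = t" "2 * int t \<le> H.gp2 w y"
      and b: "b \<in> carrier G" "V.len b + V.dd b y = V.len y" "H.dd w b \<le> K" "L \<le> V.len b"
      using pt[OF y ty] by blast
    have four: "H.gp2 r s \<ge> min (H.gp2 r z) (H.gp2 z s) - int D"
      if "r \<in> carrier G" "s \<in> carrier G" "z \<in> carrier G" for r s z
      using H.gpw_four[of \<one> r s z] that by (simp add: H.gpw_one)
    have "2 * int t - 2 * int D \<le> H.gp2 v w"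
      using four[OF v(1) w(1) x] four[OF x w(1) y] v(3) w(3) big H.gp2_sym[OF w(1) y]
      by (simp add: min_def split: if_splits)
    then have vw: "H.dd v w \<le> 2 * D" using v(2) w(2) by (simp add: H.gp2_def)
    have "H.dd a b \<le> H.dd a v + (H.dd v w + H.dd w b)"
      using H.dd_tri[OF a(1) v(1) b(1)] H.dd_tri[OF v(1) w(1) b(1)] by linarith
    then have "H.dd a b \<le> 2 * K + 2 * D"
      using vw a(3) b(3) H.dd_sym[OF a(1) v(1)] by simp
    then have "V.dd a b \<le> A * (2 * K + 2 * D)"
      using dd_compare(2)[OF a(1) b(1)] mult_le_mono2[of "H.dd a b" "2 * K + 2 * D" A] by linarith
    moreover have "V.dd x y \<le> V.dd a x + (V.dd a b + V.dd b y)"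
      using V.dd_tri[OF x a(1) y] V.dd_tri[OF a(1) b(1) y] V.dd_sym[OF x a(1)] by linarith
    ultimately have "int (V.len a) + int (V.len b) - int (A * (2 * K + 2 * D)) \<le> V.gp2 x y"
      using a(2) b(2) unfolding V.gp2_def by linarith
    moreover have "int L = int (nat M) + int (A * (2 * K + 2 * D))" by (simp add: L_def)
    ultimately show ?thesis using a(4) b(4) by linarith
  qed
  then show ?thesis by blast
qed

text \<open>A geodesic from \<open>x\<close> to \<open>y\<close> comes within about half of
  \<open>gp2 x y\<close> of the identity. The point \<open>z\<close> where it does so has a shadow
  \<open>a\<close> between \<open>x\<close> and \<open>y\<close> in the other metric, and
  \<open>V.gp2 x y\<close> is at most twice the length of any point between them.\<close>

lemma gp2_backward: "\<exists>M'. \<forall>x\<in>carrier G. \<forall>y\<in>carrier G. M' \<le> V.gp2 x y \<longrightarrow> M \<le> H.gp2 x y"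
proof -
  obtain K where K: "\<And>x y z. \<lbrakk>x \<in> carrier G; y \<in> carrier G; z \<in> carrier G; H.dd x z + H.dd z y = H.dd x y\<rbrakk>
     \<Longrightarrow> \<exists>a\<in>carrier G. V.dd x a + V.dd a y = V.dd x y \<and> H.dd z a \<le> K"
    using fellow_travel by blast
  have "M \<le> H.gp2 x y" if x: "x \<in> carrier G" and y: "y \<in> carrier G"
    and big: "int A * (M + 1 + 2 * int D + 2 * int K) \<le> V.gp2 x y" for x y
  proof -
    \<comment> \<open>The distance from \<open>x\<close> to the centre of the tripod on
      \<open>x\<close>, \<open>y\<close> and the identity; rounding causes the summand 1
      below.\<close>
    define t where "t = (H.len x + H.dd x y - H.len y) div 2"
    have yx: "H.len y \<le> H.len x + H.dd x y" "H.len x \<le> H.len y + H.dd x y"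
      using H.len_le_dd[OF x y] H.len_le_dd[OF y x] H.dd_sym[OF x y] by auto
    have t: "2 * t \<le> H.len x + H.dd x y - H.len y" "H.len x + H.dd x y - H.len y \<le> 2 * t + 1"
      unfolding t_def by auto
    then have td: "t \<le> H.dd x y" using yx by linarith
    obtain z where z: "z \<in> carrier G" "H.dd x z = t" "H.dd z y = H.dd x y - t"
      using H.between_ex[OF x y td] by blast
    obtain a where a: "a \<in> carrier G" "V.dd x a + V.dd a y = V.dd x y" "H.dd z a \<le> K"
      using K[OF x y z(1)] z td by auto
    have "H.dd x y + H.dd z \<one> \<le> max (H.dd x z + H.dd y \<one>) (H.dd x \<one> + H.dd y z) + D"
      using H.four_point[OF x y z(1)] by simp
    moreover have "H.dd z \<one> = H.len z" "H.dd y \<one> = H.len y" "H.dd x \<one> = H.len x" "H.dd y z = H.dd x y - t"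
      using H.dd_sym[of _ \<one>] H.dd_sym[OF y z(1)] x y z by auto
    ultimately have "2 * int (H.len z) \<le> H.gp2 x y + 1 + 2 * int D"
      using z(2) t yx td unfolding H.gp2_def by (simp add: max_def split: if_splits)
    moreover have "H.len a \<le> H.len z + K" using H.len_le_dd[OF z(1) a(1)] a(3) by simp
    ultimately have la: "2 * int (H.len a) \<le> H.gp2 x y + 1 + 2 * int D + 2 * int K" by simp
    have "V.gp2 x y \<le> 2 * int (V.len a)"
      using V.len_le_dd[OF a(1) x] V.len_le_dd[OF a(1) y] V.dd_sym[OF a(1) x] a(2)
      unfolding V.gp2_def by linarith
    also have "\<dots> \<le> 2 * (int A * int (H.len a))"
      using A_props(3)[OF a(1)] by (simp flip: of_nat_mult)
    also have "\<dots> \<le> int A * (H.gp2 x y + 1 + 2 * int D + 2 * int K)"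
      using mult_left_mono[OF la, of "int A"] by (simp add: algebra_simps)
    finally have "int A * (M + 1 + 2 * int D + 2 * int K) \<le> int A * (H.gp2 x y + 1 + 2 * int D + 2 * int K)"
      using big by linarith
    then show ?thesis using A_props(1) by (simp add: mult_le_cancel_left)
  qed
  then show ?thesis by blast
qed

lemma diverge_transfer:
  assumes "\<And>i. x i \<in> carrier G" "\<And>i. y i \<in> carrier G"
  shows "H.diverge x y \<longleftrightarrow> V.diverge x y"
proof
  assume *: "H.diverge x y"
  show "V.diverge x y"
    unfolding V.diverge_def
  proof
    fix M
    obtain M' where M': "\<forall>x\<in>carrier G. \<forall>y\<in>carrier G. M' \<le> H.gp2 x y \<longrightarrow> M \<le> V.gp2 x y"
      using gp2_forward by blast
    obtain N where "\<forall>i\<ge>N. \<forall>j\<ge>N. M' \<le> H.gp2 (x i) (y j)" using * unfolding H.diverge_def by blast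
    then show "\<exists>N. \<forall>i\<ge>N. \<forall>j\<ge>N. M \<le> V.gp2 (x i) (y j)" using M' assms by blast
  qed
next
  assume *: "V.diverge x y"
  show "H.diverge x y"
    unfolding H.diverge_def
  proof
    fix M
    obtain M' where M': "\<forall>x\<in>carrier G. \<forall>y\<in>carrier G. M' \<le> V.gp2 x y \<longrightarrow> M \<le> H.gp2 x y"
      using gp2_backward by blast
    obtain N where "\<forall>i\<ge>N. \<forall>j\<ge>N. M' \<le> V.gp2 (x i) (y j)" using * unfolding V.diverge_def by blast
    then show "\<exists>N. \<forall>i\<ge>N. \<forall>j\<ge>N. M \<le> H.gp2 (x i) (y j)" using M' assms by blast
  qed
qed

lemma conv_transfer: "H.conv x \<longleftrightarrow> V.conv x"
  unfolding H.conv_def V.conv_def using diverge_transfer[of x x] by blast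

section \<open>The boundary as the set of limit classes\<close>

lemma boundary_transfer: "gromov_boundary G S = gromov_boundary G S'"
proof -
  have "{y. V.conv y \<and> V.diverge x y} = {y. H.conv y \<and> H.diverge x y}" if "V.conv x" for x
    using that diverge_transfer[of x] unfolding conv_transfer by (auto simp: V.conv_def)
  then show ?thesis unfolding V.boundary_eq H.boundary_eq conv_transfer by blast
qed

lemma boundary_limit_class: "gromov_boundary G S = H.limit_class ` H.Hor"
proof -
  have 1: "\<exists>x. H.limit_class \<phi> = {y. H.conv y \<and> H.diverge x y} \<and> H.conv x" if "\<phi> \<in> H.Hor" for \<phi>
    using H.limit_class_eq[OF that] H.limit_class_conv[OF that H.ray_in_limit_class[OF that]] by blast
  have 2: "\<exists>\<phi>\<in>H.Hor. H.limit_class \<phi> = {y. H.conv y \<and> H.diverge x y}" if "H.conv x" for x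
    using H.limit_class_surj[OF that] .
  show ?thesis
    unfolding boundary_transfer H.boundary_eq
  proof (intro equalityI subsetI)
    fix \<xi> assume "\<xi> \<in> {{y. H.conv y \<and> H.diverge x y} | x. H.conv x}"
    then obtain x where x: "\<xi> = {y. H.conv y \<and> H.diverge x y}" "H.conv x" by blast
    obtain \<phi> where "\<phi> \<in> H.Hor" "H.limit_class \<phi> = \<xi>" using 2[OF x(2)] x(1) by blast
    then show "\<xi> \<in> H.limit_class ` H.Hor" by blast
  next
    fix \<xi> assume "\<xi> \<in> H.limit_class ` H.Hor"
    then obtain \<phi> where \<phi>: "\<phi> \<in> H.Hor" "\<xi> = H.limit_class \<phi>" by blast
    show "\<xi> \<in> {{y. H.conv y \<and> H.diverge x y} | x. H.conv x}"
      using 1[OF \<phi>(1)] unfolding \<phi>(2) by (rule CollectI)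
  qed
qed

text \<open>\<open>boundary_prod\<close> is a supremum over representatives, so the canonical paths
  give a lower bound; \<open>r + 1\<close> leaves room for the strict inequality.\<close>

lemma boundary_prod_large:
  "\<exists>n. \<forall>\<phi>\<in>H.Hor. \<forall>\<psi>\<in>H.Hor. H.agree n \<phi> \<psi> \<longrightarrow>
     ereal r < boundary_prod G S (H.limit_class \<phi>) (H.limit_class \<psi>)"
proof -
  obtain M' where M': "\<forall>x\<in>carrier G. \<forall>y\<in>carrier G. M' \<le> H.gp2 x y \<longrightarrow> \<lceil>2 * (r + 1)\<rceil> \<le> V.gp2 x y"
    using gp2_forward by blast
  define n where "n = nat M'"
  have "ereal r < boundary_prod G S (H.limit_class \<phi>) (H.limit_class \<psi>)"
    if \<phi>: "\<phi> \<in> H.Hor" and \<psi>: "\<psi> \<in> H.Hor" and ag: "H.agree n \<phi> \<psi>" for \<phi> \<psi>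
  proof -
    let ?f = "\<lambda>(i, j). ereal (gromov_prod G S \<one> (H.descent \<phi> i) (H.descent \<psi> j))"
    have "r + 1 \<le> gromov_prod G S \<one> (H.descent \<phi> i) (H.descent \<psi> j)" if "i \<ge> n" "j \<ge> n" for i j
    proof -
      have "M' \<le> H.gp2 (H.descent \<phi> i) (H.descent \<psi> j)"
        using H.agree_gp2[OF \<phi> \<psi> ag that] unfolding n_def by linarith
      then have "\<lceil>2 * (r + 1)\<rceil> \<le> V.gp2 (H.descent \<phi> i) (H.descent \<psi> j)" using M' \<phi> \<psi> by simp
      then have "2 * (r + 1) \<le> real_of_int (V.gp2 (H.descent \<phi> i) (H.descent \<psi> j))"
        by (simp only: ceiling_le_iff)
      then show ?thesis using \<phi> \<psi> by (simp add: V.gromov_prod_gp2)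
    qed
    then have "eventually (\<lambda>z. ereal (r + 1) \<le> ?f z) (sequentially \<times>\<^sub>F sequentially)"
      unfolding eventually_prod_sequentially by (intro exI[of _ n]) auto
    then have "ereal (r + 1) \<le> Liminf (sequentially \<times>\<^sub>F sequentially) ?f"
      by (rule Liminf_bounded)
    also have "\<dots> \<le> boundary_prod G S (H.limit_class \<phi>) (H.limit_class \<psi>)"
      unfolding boundary_prod_def
      by (rule SUP_upper2[OF H.ray_in_limit_class[OF \<phi>]], rule SUP_upper2[OF H.ray_in_limit_class[OF \<psi>]]) simp
    finally show ?thesis by (rule less_le_trans[rotated]) simp
  qed
  then show ?thesis by blast
qed

end

section \<open>The boundary topology and the quotient map\<close>

lemma openin_boundary_topology:
  "openin (boundary_topology G S) U \<longleftrightarrow> U \<subseteq> gromov_boundary G S \<and>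
     (\<forall>\<xi>\<in>U. \<exists>r::real. {\<eta> \<in> gromov_boundary G S. ereal r < boundary_prod G S \<xi> \<eta>} \<subseteq> U)"
proof -
  let ?P = "\<lambda>U. U \<subseteq> gromov_boundary G S \<and>
     (\<forall>\<xi>\<in>U. \<exists>r::real. {\<eta> \<in> gromov_boundary G S. ereal r < boundary_prod G S \<xi> \<eta>} \<subseteq> U)"
  have "?P (U \<inter> V)" if U: "?P U" and V: "?P V" for U V
  proof (intro conjI ballI)
    fix \<xi> assume \<xi>: "\<xi> \<in> U \<inter> V"
    obtain r where r: "{\<eta> \<in> gromov_boundary G S. ereal r < boundary_prod G S \<xi> \<eta>} \<subseteq> U" using U \<xi> by blast
    obtain s where s: "{\<eta> \<in> gromov_boundary G S. ereal s < boundary_prod G S \<xi> \<eta>} \<subseteq> V" using V \<xi> by blast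
    have "ereal r < e \<and> ereal s < e" if "ereal (max r s) < e" for e
      using that by (metis ereal_less_eq(3) le_less_trans max.cobounded1 max.cobounded2)
    then have "{\<eta> \<in> gromov_boundary G S. ereal (max r s) < boundary_prod G S \<xi> \<eta>} \<subseteq> U \<inter> V"
      using r s by blast
    then show "\<exists>r::real. {\<eta> \<in> gromov_boundary G S. ereal r < boundary_prod G S \<xi> \<eta>} \<subseteq> U \<inter> V" by blast
  qed (use U in blast)
  moreover have "?P (\<Union>\<K>)" if "\<forall>K\<in>\<K>. ?P K" for \<K>
  proof (intro conjI ballI)
    fix \<xi> assume "\<xi> \<in> \<Union>\<K>"
    then obtain K where "K \<in> \<K>" "\<xi> \<in> K" by blast
    then obtain r where "{\<eta> \<in> gromov_boundary G S. ereal r < boundary_prod G S \<xi> \<eta>} \<subseteq> K"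
      using \<open>\<forall>K\<in>\<K>. ?P K\<close> by blast
    then show "\<exists>r::real. {\<eta> \<in> gromov_boundary G S. ereal r < boundary_prod G S \<xi> \<eta>} \<subseteq> \<Union>\<K>"
      using \<open>K \<in> \<K>\<close> by blast
  qed (use that in blast)
  \<comment> \<open>Only now may \<open>openin\<close> of a space built by \<open>topology\<close>
    be unfolded.\<close>
  ultimately have "istopology ?P" unfolding istopology_def by blast
  then show ?thesis unfolding boundary_topology_def by (simp add: topology_inverse')
qed

lemma topspace_boundary_topology: "topspace (boundary_topology G S) = gromov_boundary G S"
proof
  show "topspace (boundary_topology G S) \<subseteq> gromov_boundary G S"
    using openin_topspace[of "boundary_topology G S"] unfolding openin_boundary_topology by blast
  have "openin (boundary_topology G S) (gromov_boundary G S)"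
    unfolding openin_boundary_topology by blast
  then show "gromov_boundary G S \<subseteq> topspace (boundary_topology G S)" by (rule openin_subset)
qed

text \<open>Continuity holds because bit sequences with a long common prefix give horofunctions with
  long agreement, whose limit classes have a large boundary product. Equivariance joins
  \<open>point_rep\<close> and \<open>limit_class_act\<close>.\<close>

lemma (in two_metrics) rational_boundary:
  assumes "infinite (carrier G)"
  shows "rational_action G (boundary_action G) (boundary_topology G S)"
proof -
  note ne = H.Hor_nonempty[OF assms]
  let ?q = "\<lambda>w. H.limit_class (H.point w)"
  have range: "range ?q = gromov_boundary G S"
    unfolding boundary_limit_class using H.point_in[OF ne] H.point_surj[OF ne] by (auto simp: image_iff) metis
  have "continuous_map cantor_top (boundary_topology G S) ?q"
    unfolding continuous_map_def
  proof (intro conjI allI impI)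
    show "?q \<in> topspace cantor_top \<rightarrow> topspace (boundary_topology G S)"
      unfolding topspace_boundary_topology using range by auto
    fix U assume U: "openin (boundary_topology G S) U"
    show "openin cantor_top {w \<in> topspace cantor_top. ?q w \<in> U}"
      unfolding openin_cantor_top
    proof
      fix w assume "w \<in> {w \<in> topspace cantor_top. ?q w \<in> U}"
      then obtain r where r: "{\<eta> \<in> gromov_boundary G S. ereal r < boundary_prod G S (?q w) \<eta>} \<subseteq> U"
        using U unfolding openin_boundary_topology by blast
      obtain n where n: "\<forall>\<phi>\<in>H.Hor. \<forall>\<psi>\<in>H.Hor. H.agree n \<phi> \<psi> \<longrightarrow>
          ereal r < boundary_prod G S (H.limit_class \<phi>) (H.limit_class \<psi>)"
        using boundary_prod_large by blast
      obtain k where k: "\<forall>w'. (\<forall>i<k. w' i = w i) \<longrightarrow> H.agree n (H.point w) (H.point w')"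
        using H.point_cont[OF ne] by (rule exE)
      have "?q w' \<in> U" if "\<forall>i<k. w' i = w i" for w'
      proof -
        have "H.agree n (H.point w) (H.point w')" using k that by blast
        then have "ereal r < boundary_prod G S (?q w) (?q w')" using n H.point_in[OF ne] by blast
        then show ?thesis using r range by blast
      qed
      then show "\<exists>n. \<forall>w'. (\<forall>i<n. w' i = w i) \<longrightarrow> w' \<in> {w \<in> topspace cantor_top. ?q w \<in> U}"
        by (intro exI[of _ k]) simp
    qed
  qed
  moreover have "?q \<circ> H.rep g = boundary_action G g \<circ> ?q" if "g \<in> carrier G" for g
    by (rule ext) (simp only: comp_apply H.point_rep[OF ne that] H.limit_class_act[OF H.point_in[OF ne] that])
  ultimately show ?thesis
    unfolding rational_action_def topspace_boundary_topology
    using range H.rep_rational[OF ne] H.rep_mult[OF ne]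
    by (intro exI[of _ ?q] exI[of _ H.rep] conjI ballI) auto
qed

lemma hyperbolic_metricI:
  assumes "group G" "finite_generating_set G S" "hyperbolic_wrt G S"
  shows "\<exists>D. hyperbolic_metric G S D"
proof -
  interpret word_metric G S
    using assms by (simp add: word_metric_def word_metric_axioms_def)
  obtain \<delta> :: real where \<delta>: "\<And>w x y z. \<lbrakk>w \<in> carrier G; x \<in> carrier G; y \<in> carrier G; z \<in> carrier G\<rbrakk> \<Longrightarrow>
        gromov_prod G S w x y \<ge> min (gromov_prod G S w x z) (gromov_prod G S w y z) - \<delta>"
    using assms(3) unfolding hyperbolic_wrt_def by blast
  \<comment> \<open>Gromov products are halved and \<open>D\<close> is a natural number, hence
    \<open>2 * \<delta>\<close> rounded up.\<close>
  have "hyperbolic_metric G S (nat \<lceil>2 * \<delta>\<rceil>)"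
  proof unfold_locales
    fix x y z w assume c: "x \<in> carrier G" "y \<in> carrier G" "z \<in> carrier G" "w \<in> carrier G"
    have 1: "2 * \<delta> \<le> real (nat \<lceil>2 * \<delta>\<rceil>)" by linarith
    have 2: "min (real (dd w x) + real (dd w z) - real (dd x z)) (real (dd w y) + real (dd w z) - real (dd y z))
        \<le> real (dd w x) + real (dd w y) - real (dd x y) + 2 * \<delta>"
      using \<delta>[OF c(4,1,2,3)] unfolding gromov_prod_def word_dist_dd min_def
      by (auto simp: field_simps split: if_splits)
    have "real (dd x y) + real (dd z w) \<le>
        max (real (dd x z) + real (dd y w)) (real (dd x w) + real (dd y z)) + real (nat \<lceil>2 * \<delta>\<rceil>)"
      using 1 2 unfolding dd_sym[OF c(4,1)] dd_sym[OF c(4,2)] dd_sym[OF c(4,3)] by linarith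
    then have "real (dd x y + dd z w) \<le> real (max (dd x z + dd y w) (dd x w + dd y z) + nat \<lceil>2 * \<delta>\<rceil>)"
      by (simp only: of_nat_add of_nat_max)
    then show "dd x y + dd z w \<le> max (dd x z + dd y w) (dd x w + dd y z) + nat \<lceil>2 * \<delta>\<rceil>"
      by (simp only: of_nat_le_iff)
  qed
  then show ?thesis by blast
qed

theorem theorem2:
  fixes G :: "('a, 'b) monoid_scheme" and S :: "'a set"
  assumes "hyperbolic_group G"
    and "finite_generating_set G S"
    and "infinite (carrier G)"
  shows "rational_action G (boundary_action G) (boundary_topology G S)"
proof -
  \<comment> \<open>\<open>S'\<close> is the generating set that witnesses hyperbolicity; the
    boundary is formed with \<open>S\<close>.\<close>
  obtain S' where G: "group G" and S': "finite_generating_set G S'" "hyperbolic_wrt G S'"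
    using assms(1) by (auto simp: hyperbolic_group_def)
  obtain D where H: "hyperbolic_metric G S' D" using hyperbolic_metricI[OF G S'] by blast
  have "word_metric G S" using G assms(2) by (simp add: word_metric_def word_metric_axioms_def)
  then have "two_metrics G S' S D" using H by (simp add: two_metrics_def)
  then show ?thesis using assms(3) by (rule two_metrics.rational_boundary)
qed

end
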